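(* Let $n$ be a non-negative integer. Let $A = \Bbbk Q_A/I_A$ and $B = \Bbbk Q_B/I_B$ be finite dimensional algebras, and let $C = \Bbbk Q_C/I_C$ be a finite dimensional algebra which is a Morita context algebra on $A$ and $B$, satisfying the following conditions: (1) $(Q_C)_0 = (Q_A)_0 \cup (Q_B)_0$ (disjoint union); (2) $(Q_C)_1 = (Q_A)_1 \cup (Q_B)_1 \cup \{\alpha_j\}_{j\in J}$ (disjoint union), where each arrow $\alpha_j$ starts at a vertex of $Q_A$ and ends at a vertex of $Q_B$; (3) the ideal of $\Bbbk Q_C$ generated by $I_A$, $I_B$ and all $\alpha\alpha_j$ with $\alpha\in (Q_A)_1$, $j\in J$, is contained in $I_C$; (4) the subgroup $\mathcal{O} = \langle \mathrm{add}\,\mathrm{Orb}_{\Omega_B}(\Pi_B(\Omega_C(C_0)))\rangle$ of $K_0(C)$ is finitely generated. If $A$ is an $n$-Igusa-Todorov algebra and $B$ is an $n$-LIT algebra, then $C$ is an $(n+1)$-LIT algebra.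
   Context: $\Bbbk$ is a field; quivers are finite and connected; $I_A, I_B, I_C$ are admissible ideals (an ideal $I$ of $\Bbbk Q$ is admissible if $J_Q^m\subset I\subset J_Q^2$ for some $m\ge 2$, $J_Q$ being the ideal generated by the arrows). Paths are composed from left to right. For an algebra $\Lambda$, $\mathrm{mod}\,\Lambda$ is the category of finitely generated right $\Lambda$-modules, identified for a bound quiver algebra $\Bbbk Q/I$ with finite dimensional representations of $Q$ bound by $I$. That $C$ is a Morita context algebra on $A$ and $B$ means that its diagonal corner algebras, for the idempotents given by the sums of the vertices of $Q_A$ and of $Q_B$, are $A$ and $B$ (i.e. $I_C\cap \Bbbk Q_A = I_A$ and $I_C\cap\Bbbk Q_B = I_B$). Modules over $A$ (resp. $B$) are regarded as $C$-modules supported on the vertices of $Q_A$ (resp. $Q_B$), with the arrows $\alpha_j$ acting as zero. The functor $\Pi_B:\mathrm{mod}\, C\to \mathrm{mod}\, B$ restricts a representation of $Q_C$ to the vertices and arrows of $Q_B$. $\Omega_\Lambda(M)$ is the syzygy of $M$ (kernel of the projective cover). $C_0$ is the direct sum of a complete set of representatives of the isomorphism classes of simple $C$-modules. $\mathrm{Orb}_{\Omega_\Lambda}(M)=\{\Omega_\Lambda^n(M)\}_{n\ge 0}$. For a class $\mathcal{C}$ of modules, $\mathrm{add}\,\mathcal{C}$ is the full subcategory of finite direct sums of direct summands of modules in $\mathcal{C}$. $K_0(\Lambda)$ is the abelian group generated by the symbols $[M]$, $M\in\mathrm{mod}\,\Lambda$, modulo the relations $[M]=[M']+[M'']$ if $M\cong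 M'\oplus M''$ and $[P]=0$ for $P$ projective. For a class $\mathcal{C}$ of modules, $\langle\mathcal{C}\rangle$ is the subgroup generated by the classes of direct summands of modules of $\mathcal{C}$. $\bar\Omega:K_0(\Lambda)\to K_0(\Lambda)$ is the endomorphism $\bar\Omega([M])=[\Omega(M)]$. The Igusa-Todorov function is $\phi(M)=\min\{k\ge 0: \bar\Omega \text{ restricted to } \bar\Omega^m(\langle \mathrm{add}\,M\rangle) \text{ is injective for all } m\ge k\}$, and $\phi\dim(\mathcal{D})=\sup\{\phi(M): M\in\mathcal{D}\}$. A $0$-Igusa-Todorov subcategory of $\mathrm{mod}\,\Lambda$ is a subcategory $\mathcal{D}$ with $\mathcal{D}=\mathrm{add}(\mathcal{D})$, $\Omega(\mathcal{D})\subset\mathcal{D}$ and $\phi\dim(\mathcal{D})=0$. $\Lambda$ is an $(n,V,\mathcal{D})$-LIT algebra if $\mathcal{D}\subset \mathrm{mod}\,\Lambda$ is a $0$-Igusa-Todorov subcategory, $V\in\mathrm{mod}\,\Lambda$, and every $M\in\mathrm{mod}\,\Lambda$ admits an exact sequence $0\to V_1\oplus D_1\to V_0\oplus D_0\to\Omega^n(M)\to 0$ with $V_0,V_1\in\mathrm{add}(V)$ and $D_0,D_1\in\mathcal{D}$. $\Lambda$ is $n$-LIT if it is $(n,V,\mathcal{D})$-LIT for some $V$ and $\mathcal{D}$; it is $n$-Igusa-Todorov if it is $(n,V,\{0\})$-LIT for some $V$. *)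

theory Defs
  imports
    "HOL-Algebra.Free_Abelian_Groups"
    "HOL-Algebra.Ideal_Product"
    "HOL-Library.Function_Algebras"
    "HOL-Library.Extended_Nat"
    "Graph_Theory.Graph_Theory"
begin

section \<open>Path algebras and admissible ideals\<close>

text \<open>
  A quiver is a directed multigraph. A path is given by its source and its list of arrows, composed
  from left to right; \<open>(x, [])\<close> is the trivial path at \<open>x\<close>.
\<close>

type_synonym ('v, 'a) quiver = "('v, 'a) pre_digraph"
type_synonym ('v, 'a) path = "'v \<times> 'a list"

definition path_end :: "('v, 'a) quiver \<Rightarrow> ('v, 'a) path \<Rightarrow> 'v" where
  "path_end Q p = pre_digraph.awlast Q (fst p) (snd p)"

definition paths :: "('v, 'a) quiver \<Rightarrow> ('v, 'a) path set" where
  "paths Q = {p. pre_digraph.awalk Q (fst p) (snd p) (path_end Q p)}"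

text \<open>The product of two basis paths is their concatenation if they are composable and zero otherwise.\<close>

definition path_mult ::
    "('v, 'a) quiver \<Rightarrow> (('v, 'a) path \<Rightarrow>\<^sub>0 'k::field) \<Rightarrow> (('v, 'a) path \<Rightarrow>\<^sub>0 'k) \<Rightarrow> (('v, 'a) path \<Rightarrow>\<^sub>0 'k)"
  where "path_mult Q f g =
    (\<Sum>p\<in>Poly_Mapping.keys f. \<Sum>q\<in>Poly_Mapping.keys g.
       if path_end Q p = fst q
       then Poly_Mapping.single (fst p, snd p @ snd q)
              (Poly_Mapping.lookup f p * Poly_Mapping.lookup g q)
       else 0)"

definition path_algebra :: "('v, 'a) quiver \<Rightarrow> (('v, 'a) path \<Rightarrow>\<^sub>0 'k::field) ring" where
  "path_algebra Q =
    \<lparr>carrier = {f. Poly_Mapping.keys f \<subseteq> paths Q},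
     monoid.mult = path_mult Q,
     one = (\<Sum>x\<in>verts Q. Poly_Mapping.single (x, []) 1),
     zero = 0,
     add = (+)\<rparr>"

definition arrow_elt :: "('v, 'a) quiver \<Rightarrow> 'a \<Rightarrow> (('v, 'a) path \<Rightarrow>\<^sub>0 'k::field)" where
  "arrow_elt Q a = Poly_Mapping.single (tail Q a, [a]) 1"

definition arrow_ideal :: "('v, 'a) quiver \<Rightarrow> (('v, 'a) path \<Rightarrow>\<^sub>0 'k::field) set" where
  "arrow_ideal Q = genideal (path_algebra Q) (arrow_elt Q ` arcs Q)"

primrec ideal_power :: "('r, 'b) ring_scheme \<Rightarrow> 'r set \<Rightarrow> nat \<Rightarrow> 'r set" where
  "ideal_power R I 0 = carrier R"
| "ideal_power R I (Suc m) = ideal_prod R (ideal_power R I m) I"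

definition admissible :: "('v, 'a) quiver \<Rightarrow> (('v, 'a) path \<Rightarrow>\<^sub>0 'k::field) set \<Rightarrow> bool" where
  "admissible Q I \<longleftrightarrow>
     ideal I (path_algebra Q) \<and>
     (\<exists>m\<ge>2. ideal_power (path_algebra Q) (arrow_ideal Q) m \<subseteq> I) \<and>
     I \<subseteq> ideal_power (path_algebra Q) (arrow_ideal Q) 2"

text \<open>
  The data of a bound quiver algebra. Its finite dimensionality is automatic, since the quiver is
  finite and the ideal contains a power of the arrow ideal.
\<close>

definition bound_quiver :: "('v, 'a) quiver \<Rightarrow> (('v, 'a) path \<Rightarrow>\<^sub>0 'k::field) set \<Rightarrow> bool" where
  "bound_quiver Q I \<longleftrightarrow> fin_digraph Q \<and> connected Q \<and> admissible Q I"


section \<open>Finite dimensional representations\<close>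

text \<open>
  The vector spaces of a representation are finite dimensional subspaces of the infinite dimensional
  space of sequences over the ground field. Up to isomorphism every finite dimensional representation
  is of this form, and kernels and direct sums can be taken inside this space.
\<close>

type_synonym 'k vect = "nat \<Rightarrow> 'k"

definition vscale :: "'k::field \<Rightarrow> 'k vect \<Rightarrow> 'k vect" where
  "vscale c u = (\<lambda>i. c * u i)"

global_interpretation vect: vector_space "vscale :: 'k::field \<Rightarrow> 'k vect \<Rightarrow> 'k vect"
  by standard (auto simp: vscale_def fun_eq_iff algebra_simps)

definition fin_dim_space :: "'k::field vect set \<Rightarrow> bool" where
  "fin_dim_space S \<longleftrightarrow> (\<exists>B. finite B \<and> S = vect.span B)"

definition linear_between :: "'k::field vect set \<Rightarrow> 'k vect set \<Rightarrow> ('k vect \<Rightarrow> 'k vect) \<Rightarrow> bool" where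
  "linear_between S T f \<longleftrightarrow>
     f ` S \<subseteq> T \<and>
     (\<forall>u\<in>S. \<forall>v\<in>S. f (u + v) = f u + f v) \<and>
     (\<forall>c. \<forall>u\<in>S. f (vscale c u) = vscale c (f u))"

record ('v, 'a, 'k) rep =
  vsp :: "'v \<Rightarrow> 'k vect set"
  amap :: "'a \<Rightarrow> 'k vect \<Rightarrow> 'k vect"

definition path_map :: "('v, 'a, 'k) rep \<Rightarrow> ('v, 'a) path \<Rightarrow> 'k vect \<Rightarrow> 'k vect" where
  "path_map M p v = foldl (\<lambda>w a. amap M a w) v (snd p)"

text \<open>
  The objects of the module category: representations on which every element of \<open>I\<close> that is
  a combination of parallel paths acts as zero. The values of \<open>vsp\<close> and \<open>amap\<close> outside the quiver,
  and of \<open>amap\<close> outside the relevant vector spaces, are irrelevant and not constrained.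
\<close>

definition mod_cat ::
    "('v, 'a) quiver \<Rightarrow> (('v, 'a) path \<Rightarrow>\<^sub>0 'k::field) set \<Rightarrow> ('v, 'a, 'k) rep set" where
  "mod_cat Q I = {M.
     (\<forall>x\<in>verts Q. fin_dim_space (vsp M x)) \<and>
     (\<forall>a\<in>arcs Q. linear_between (vsp M (tail Q a)) (vsp M (head Q a)) (amap M a)) \<and>
     (\<forall>\<rho>\<in>I. \<forall>x\<in>verts Q. \<forall>y\<in>verts Q.
        (\<forall>p\<in>Poly_Mapping.keys \<rho>. fst p = x \<and> path_end Q p = y) \<longrightarrow>
        (\<forall>v\<in>vsp M x.
           (\<Sum>p\<in>Poly_Mapping.keys \<rho>. vscale (Poly_Mapping.lookup \<rho> p) (path_map M p v)) = 0))}"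

definition rep_hom ::
    "('v, 'a) quiver \<Rightarrow> ('v, 'a, 'k::field) rep \<Rightarrow> ('v, 'a, 'k) rep \<Rightarrow> ('v \<Rightarrow> 'k vect \<Rightarrow> 'k vect) \<Rightarrow> bool"
  where "rep_hom Q M N f \<longleftrightarrow>
     (\<forall>x\<in>verts Q. linear_between (vsp M x) (vsp N x) (f x)) \<and>
     (\<forall>a\<in>arcs Q. \<forall>v\<in>vsp M (tail Q a). f (head Q a) (amap M a v) = amap N a (f (tail Q a) v))"

definition rep_mono ::
    "('v, 'a) quiver \<Rightarrow> ('v, 'a, 'k::field) rep \<Rightarrow> ('v, 'a, 'k) rep \<Rightarrow> ('v \<Rightarrow> 'k vect \<Rightarrow> 'k vect) \<Rightarrow> bool"
  where "rep_mono Q M N f \<longleftrightarrow> rep_hom Q M N f \<and> (\<forall>x\<in>verts Q. inj_on (f x) (vsp M x))"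

definition rep_epi ::
    "('v, 'a) quiver \<Rightarrow> ('v, 'a, 'k::field) rep \<Rightarrow> ('v, 'a, 'k) rep \<Rightarrow> ('v \<Rightarrow> 'k vect \<Rightarrow> 'k vect) \<Rightarrow> bool"
  where "rep_epi Q M N f \<longleftrightarrow> rep_hom Q M N f \<and> (\<forall>x\<in>verts Q. f x ` vsp M x = vsp N x)"

definition rep_iso :: "('v, 'a) quiver \<Rightarrow> ('v, 'a, 'k::field) rep \<Rightarrow> ('v, 'a, 'k) rep \<Rightarrow> bool" where
  "rep_iso Q M N \<longleftrightarrow> (\<exists>f. rep_mono Q M N f \<and> rep_epi Q M N f)"

definition rep_ker ::
    "('v, 'a, 'k::field) rep \<Rightarrow> ('v \<Rightarrow> 'k vect \<Rightarrow> 'k vect) \<Rightarrow> ('v, 'a, 'k) rep" where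
  "rep_ker M f = M\<lparr>vsp := \<lambda>x. {v \<in> vsp M x. f x v = 0}\<rparr>"

definition short_exact ::
    "('v, 'a) quiver \<Rightarrow> ('v, 'a, 'k::field) rep \<Rightarrow> ('v, 'a, 'k) rep \<Rightarrow> ('v, 'a, 'k) rep \<Rightarrow> bool"
  where "short_exact Q L M N \<longleftrightarrow>
     (\<exists>f g. rep_mono Q L M f \<and> rep_epi Q M N g \<and>
            (\<forall>x\<in>verts Q. f x ` vsp L x = vsp (rep_ker M g) x))"

definition subrep :: "('v, 'a) quiver \<Rightarrow> ('v, 'a, 'k::field) rep \<Rightarrow> ('v \<Rightarrow> 'k vect set) \<Rightarrow> bool" where
  "subrep Q M L \<longleftrightarrow>
     (\<forall>x\<in>verts Q. vect.subspace (L x) \<and> L x \<subseteq> vsp M x) \<and>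
     (\<forall>a\<in>arcs Q. amap M a ` L (tail Q a) \<subseteq> L (head Q a))"

definition simple_rep ::
    "('v, 'a) quiver \<Rightarrow> (('v, 'a) path \<Rightarrow>\<^sub>0 'k::field) set \<Rightarrow> ('v, 'a, 'k) rep \<Rightarrow> bool" where
  "simple_rep Q I M \<longleftrightarrow>
     M \<in> mod_cat Q I \<and> (\<exists>x\<in>verts Q. vsp M x \<noteq> {0}) \<and>
     (\<forall>L. subrep Q M L \<longrightarrow>
        (\<forall>x\<in>verts Q. L x = {0}) \<or> (\<forall>x\<in>verts Q. L x = vsp M x))"

text \<open>
  Direct sums are realised by interleaving sequences: \<open>(u, v) \<mapsto> vpair u v\<close> is a linear isomorphism
  from pairs of sequences to sequences, with components \<open>vfst\<close> and \<open>vsnd\<close>.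
\<close>

definition vpair :: "'k vect \<Rightarrow> 'k vect \<Rightarrow> 'k vect" where
  "vpair u v = (\<lambda>i. if even i then u (i div 2) else v (i div 2))"

definition vfst :: "'k vect \<Rightarrow> 'k vect" where
  "vfst w = (\<lambda>i. w (2 * i))"

definition vsnd :: "'k vect \<Rightarrow> 'k vect" where
  "vsnd w = (\<lambda>i. w (2 * i + 1))"

definition rep_zero :: "('v, 'a, 'k::field) rep" where
  "rep_zero = \<lparr>vsp = (\<lambda>x. {0}), amap = (\<lambda>a v. 0)\<rparr>"

definition rep_sum :: "('v, 'a, 'k::field) rep \<Rightarrow> ('v, 'a, 'k) rep \<Rightarrow> ('v, 'a, 'k) rep" where
  "rep_sum M N =
    \<lparr>vsp = (\<lambda>x. {vpair u v | u v. u \<in> vsp M x \<and> v \<in> vsp N x}),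
     amap = (\<lambda>a w. vpair (amap M a (vfst w)) (amap N a (vsnd w)))\<rparr>"

definition rep_sum_list :: "('v, 'a, 'k::field) rep list \<Rightarrow> ('v, 'a, 'k) rep" where
  "rep_sum_list Ms = foldr rep_sum Ms rep_zero"

definition is_summand ::
    "('v, 'a) quiver \<Rightarrow> (('v, 'a) path \<Rightarrow>\<^sub>0 'k::field) set \<Rightarrow> ('v, 'a, 'k) rep \<Rightarrow> ('v, 'a, 'k) rep \<Rightarrow> bool"
  where "is_summand Q I N M \<longleftrightarrow>
     N \<in> mod_cat Q I \<and> (\<exists>N'\<in>mod_cat Q I. rep_iso Q M (rep_sum N N'))"

definition add_cat ::
    "('v, 'a) quiver \<Rightarrow> (('v, 'a) path \<Rightarrow>\<^sub>0 'k::field) set \<Rightarrow> ('v, 'a, 'k) rep set \<Rightarrow> ('v, 'a, 'k) rep set"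
  where "add_cat Q I \<C> = {X \<in> mod_cat Q I.
     \<exists>Ns. (\<forall>N\<in>set Ns. \<exists>M\<in>\<C>. is_summand Q I N M) \<and> rep_iso Q X (rep_sum_list Ns)}"

definition simple_sum ::
    "('v, 'a) quiver \<Rightarrow> (('v, 'a) path \<Rightarrow>\<^sub>0 'k::field) set \<Rightarrow> ('v, 'a, 'k) rep \<Rightarrow> bool" where
  "simple_sum Q I X \<longleftrightarrow> X \<in> mod_cat Q I \<and>
     (\<exists>Ss. (\<forall>S\<in>set Ss. simple_rep Q I S) \<and>
           (\<forall>S. simple_rep Q I S \<longrightarrow> (\<exists>!i. i < length Ss \<and> rep_iso Q S (Ss ! i))) \<and>
           rep_iso Q X (rep_sum_list Ss))"

text \<open>
  For a subquiver \<open>Q\<close> of a quiver \<open>Q'\<close>, the same operation describes both the restriction of a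
  representation of \<open>Q'\<close> to \<open>Q\<close> and the extension by zero of a representation of \<open>Q\<close> to \<open>Q'\<close>.
\<close>

definition rep_on :: "('v, 'a) quiver \<Rightarrow> ('v, 'a, 'k::field) rep \<Rightarrow> ('v, 'a, 'k) rep" where
  "rep_on Q M =
    \<lparr>vsp = (\<lambda>x. if x \<in> verts Q then vsp M x else {0}),
     amap = (\<lambda>a. if a \<in> arcs Q then amap M a else (\<lambda>v. 0))\<rparr>"


section \<open>Syzygies\<close>

definition projective ::
    "('v, 'a) quiver \<Rightarrow> (('v, 'a) path \<Rightarrow>\<^sub>0 'k::field) set \<Rightarrow> ('v, 'a, 'k) rep \<Rightarrow> bool" where
  "projective Q I P \<longleftrightarrow> P \<in> mod_cat Q I \<and>
     (\<forall>X\<in>mod_cat Q I. \<forall>Y\<in>mod_cat Q I. \<forall>g f.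
        rep_epi Q X Y g \<and> rep_hom Q P Y f \<longrightarrow>
        (\<exists>h. rep_hom Q P X h \<and> (\<forall>x\<in>verts Q. \<forall>v\<in>vsp P x. g x (h x v) = f x v)))"

text \<open>
  The kernel is required to be superfluous. Syzygies are determined up to isomorphism only; one is
  chosen for each module.
\<close>

definition projective_cover ::
    "('v, 'a) quiver \<Rightarrow> (('v, 'a) path \<Rightarrow>\<^sub>0 'k::field) set \<Rightarrow> ('v, 'a, 'k) rep \<Rightarrow>
     ('v, 'a, 'k) rep \<Rightarrow> ('v \<Rightarrow> 'k vect \<Rightarrow> 'k vect) \<Rightarrow> bool"
  where "projective_cover Q I M P f \<longleftrightarrow>
     projective Q I P \<and> rep_epi Q P M f \<and>
     (\<forall>L. subrep Q P L \<and>
          (\<forall>x\<in>verts Q. {l + k | l k. l \<in> L x \<and> k \<in> vsp (rep_ker P f) x} = vsp P x) \<longrightarrow>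
          (\<forall>x\<in>verts Q. L x = vsp P x))"

definition syzygy ::
    "('v, 'a) quiver \<Rightarrow> (('v, 'a) path \<Rightarrow>\<^sub>0 'k::field) set \<Rightarrow> ('v, 'a, 'k) rep \<Rightarrow> ('v, 'a, 'k) rep"
  where "syzygy Q I M = (SOME N. \<exists>P f. projective_cover Q I M P f \<and> N = rep_ker P f)"

definition syzygy_orbit ::
    "('v, 'a) quiver \<Rightarrow> (('v, 'a) path \<Rightarrow>\<^sub>0 'k::field) set \<Rightarrow> ('v, 'a, 'k) rep \<Rightarrow> ('v, 'a, 'k) rep set"
  where "syzygy_orbit Q I M = {(syzygy Q I ^^ n) M | n. True}"


section \<open>The group \<open>K\<^sub>0\<close> and the Igusa--Todorov function\<close>

definition K0_relations ::
    "('v, 'a) quiver \<Rightarrow> (('v, 'a) path \<Rightarrow>\<^sub>0 'k::field) set \<Rightarrow> (('v, 'a, 'k) rep \<Rightarrow>\<^sub>0 int) set" where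
  "K0_relations Q I = generate (free_Abelian_group (mod_cat Q I))
     ({frag_of M - (frag_of M' + frag_of M'') | M M' M''.
         M \<in> mod_cat Q I \<and> M' \<in> mod_cat Q I \<and> M'' \<in> mod_cat Q I \<and> rep_iso Q M (rep_sum M' M'')} \<union>
      {frag_of P | P. projective Q I P})"

definition K0 ::
    "('v, 'a) quiver \<Rightarrow> (('v, 'a) path \<Rightarrow>\<^sub>0 'k::field) set \<Rightarrow> (('v, 'a, 'k) rep \<Rightarrow>\<^sub>0 int) set monoid"
  where "K0 Q I = free_Abelian_group (mod_cat Q I) Mod K0_relations Q I"

definition K0_proj ::
    "('v, 'a) quiver \<Rightarrow> (('v, 'a) path \<Rightarrow>\<^sub>0 'k::field) set \<Rightarrow>
     (('v, 'a, 'k) rep \<Rightarrow>\<^sub>0 int) \<Rightarrow> (('v, 'a, 'k) rep \<Rightarrow>\<^sub>0 int) set"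
  where "K0_proj Q I c = K0_relations Q I #>\<^bsub>free_Abelian_group (mod_cat Q I)\<^esub> c"

definition K0_class ::
    "('v, 'a) quiver \<Rightarrow> (('v, 'a) path \<Rightarrow>\<^sub>0 'k::field) set \<Rightarrow>
     ('v, 'a, 'k) rep \<Rightarrow> (('v, 'a, 'k) rep \<Rightarrow>\<^sub>0 int) set"
  where "K0_class Q I M = K0_proj Q I (frag_of M)"

text \<open>
  The endomorphism \<open>[M] \<mapsto> [\<Omega> M]\<close>: the extension of \<open>M \<mapsto> \<Omega> M\<close> to the free abelian group maps
  each coset of the relations into a single coset.
\<close>

definition K0_syzygy ::
    "('v, 'a) quiver \<Rightarrow> (('v, 'a) path \<Rightarrow>\<^sub>0 'k::field) set \<Rightarrow>
     (('v, 'a, 'k) rep \<Rightarrow>\<^sub>0 int) set \<Rightarrow> (('v, 'a, 'k) rep \<Rightarrow>\<^sub>0 int) set"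
  where "K0_syzygy Q I X =
     the_elem ((\<lambda>c. K0_proj Q I (frag_extend (\<lambda>M. frag_of (syzygy Q I M)) c)) ` X)"

definition K0_subgroup ::
    "('v, 'a) quiver \<Rightarrow> (('v, 'a) path \<Rightarrow>\<^sub>0 'k::field) set \<Rightarrow>
     ('v, 'a, 'k) rep set \<Rightarrow> (('v, 'a, 'k) rep \<Rightarrow>\<^sub>0 int) set set"
  where "K0_subgroup Q I \<C> =
     generate (K0 Q I) {K0_class Q I N | N. \<exists>M\<in>\<C>. is_summand Q I N M}"

definition finitely_generated_subgroup :: "('g, 'b) monoid_scheme \<Rightarrow> 'g set \<Rightarrow> bool" where
  "finitely_generated_subgroup G H \<longleftrightarrow>
     (\<exists>S. finite S \<and> S \<subseteq> carrier G \<and> generate G S = H)"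

definition IT_phi ::
    "('v, 'a) quiver \<Rightarrow> (('v, 'a) path \<Rightarrow>\<^sub>0 'k::field) set \<Rightarrow> ('v, 'a, 'k) rep \<Rightarrow> enat" where
  "IT_phi Q I M =
     Inf {enat k | k. \<forall>m\<ge>k.
            inj_on (K0_syzygy Q I) ((K0_syzygy Q I ^^ m) ` K0_subgroup Q I (add_cat Q I {M}))}"

definition IT_phi_dim ::
    "('v, 'a) quiver \<Rightarrow> (('v, 'a) path \<Rightarrow>\<^sub>0 'k::field) set \<Rightarrow> ('v, 'a, 'k) rep set \<Rightarrow> enat" where
  "IT_phi_dim Q I \<D> = (SUP M\<in>\<D>. IT_phi Q I M)"


section \<open>LIT algebras\<close>

definition zero_IT_subcategory ::
    "('v, 'a) quiver \<Rightarrow> (('v, 'a) path \<Rightarrow>\<^sub>0 'k::field) set \<Rightarrow> ('v, 'a, 'k) rep set \<Rightarrow> bool" where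
  "zero_IT_subcategory Q I \<D> \<longleftrightarrow>
     \<D> \<subseteq> mod_cat Q I \<and> \<D> = add_cat Q I \<D> \<and> syzygy Q I ` \<D> \<subseteq> \<D> \<and> IT_phi_dim Q I \<D> = 0"

definition LIT_with ::
    "('v, 'a) quiver \<Rightarrow> (('v, 'a) path \<Rightarrow>\<^sub>0 'k::field) set \<Rightarrow>
     nat \<Rightarrow> ('v, 'a, 'k) rep \<Rightarrow> ('v, 'a, 'k) rep set \<Rightarrow> bool"
  where "LIT_with Q I n V \<D> \<longleftrightarrow>
     zero_IT_subcategory Q I \<D> \<and> V \<in> mod_cat Q I \<and>
     (\<forall>M\<in>mod_cat Q I. \<exists>V0\<in>add_cat Q I {V}. \<exists>V1\<in>add_cat Q I {V}. \<exists>D0\<in>\<D>. \<exists>D1\<in>\<D>.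
        short_exact Q (rep_sum V1 D1) (rep_sum V0 D0) ((syzygy Q I ^^ n) M))"

definition LIT_algebra ::
    "('v, 'a) quiver \<Rightarrow> (('v, 'a) path \<Rightarrow>\<^sub>0 'k::field) set \<Rightarrow> nat \<Rightarrow> bool" where
  "LIT_algebra Q I n \<longleftrightarrow> (\<exists>V \<D>. LIT_with Q I n V \<D>)"

text \<open>The subcategory \<open>{0}\<close>, closed under isomorphism.\<close>

definition zero_cat ::
    "('v, 'a) quiver \<Rightarrow> (('v, 'a) path \<Rightarrow>\<^sub>0 'k::field) set \<Rightarrow> ('v, 'a, 'k) rep set" where
  "zero_cat Q I = {M \<in> mod_cat Q I. \<forall>x\<in>verts Q. vsp M x = {0}}"

definition Igusa_Todorov_algebra ::
    "('v, 'a) quiver \<Rightarrow> (('v, 'a) path \<Rightarrow>\<^sub>0 'k::field) set \<Rightarrow> nat \<Rightarrow> bool" where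
  "Igusa_Todorov_algebra Q I n \<longleftrightarrow> (\<exists>V. LIT_with Q I n V (zero_cat Q I))"

end

theory Submission
  imports Defs
begin

text \<open>
  Let \<open>A\<close>, \<open>B\<close> and \<open>C\<close> be the algebras of the bound quivers \<open>QA\<close>, \<open>QB\<close> and \<open>QC\<close>. The connecting arrows
  lead from \<open>QA\<close> to \<open>QB\<close>, and an arrow of \<open>QA\<close> followed by a connecting arrow is zero. So the
  connecting arrows annihilate the radical of every projective \<open>C\<close>-module, and with it every syzygy.
  A syzygy over \<open>C\<close> is therefore the direct sum of a module over \<open>A\<close> and a module over \<open>B\<close>, and the
  first summand is the syzygy over \<open>A\<close> of the restriction: \<open>\<Omega>\<^sub>C M \<cong> \<Omega>\<^sub>A M \<oplus> N\<close> with \<open>N\<close> over \<open>B\<close>.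

  It remains to iterate. For a \<open>B\<close>-module the syzygies over \<open>B\<close> and over \<open>C\<close> agree, because no arrow
  leaves \<open>QB\<close>. For an \<open>A\<close>-module \<open>X\<close> the summand over \<open>B\<close> of \<open>\<Omega>\<^sub>C X\<close> is the whole part over \<open>B\<close> of the
  projective cover, since \<open>X\<close> vanishes there; that is a sum of the finitely many modules
  \<open>T\<^sub>x = \<Pi>\<^sub>B P\<^sub>C(x)\<close>. By induction \<open>\<Omega>\<^sub>C\<^sup>n X\<close> is the sum of \<open>\<Omega>\<^sub>A\<^sup>n X\<close> and copies of the modules
  \<open>\<Omega>\<^sub>B\<^sup>i T\<^sub>x\<close> with \<open>i < n\<close> (lemma \<open>syzygy_funpow_extend_left\<close>). Altogether \<open>\<Omega>\<^sub>C\<^sup>n\<^sup>+\<^sup>1 M\<close> is the sum of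
  an \<open>n\<close>-th syzygy over \<open>A\<close>, an \<open>n\<close>-th syzygy over \<open>B\<close>, and such copies. The exact sequences given for
  \<open>A\<close> and for \<open>B\<close> and the trivial sequence of the copies add up to the required one, where \<open>V\<close> is the
  sum of the two given modules and of all \<open>\<Omega>\<^sub>B\<^sup>i T\<^sub>x\<close> with \<open>i < n\<close> (lemma \<open>LIT_gluing\<close>).

  The subcategory for \<open>C\<close> is the one given for \<open>B\<close>, extended by zero. That \<open>\<phi>\<close> still
  vanishes on it needs a passage from \<open>K\<^sub>0(C)\<close> back to \<open>K\<^sub>0(B)\<close>; restriction does not give one, as
  restrictions of projectives need not be projective, but \<open>[M] \<mapsto> [\<Pi>\<^sub>B \<Omega>\<^sub>C M]\<close> does, and on \<open>B\<close>-modules it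
  is the syzygy operator of \<open>B\<close> (lemma \<open>IT_phi_supported\<close>).

  All statements on syzygies rest on one description of projective covers, lemma
  \<open>projective_cover_iff\<close>: an epimorphism from a projective whose kernel lies in the radical. The radical
  is computed vertex by vertex, so this is easily compared between the three quivers. Existence of
  projective covers, in the form of sums of the projectives \<open>P(x)\<close>, is lemma
  \<open>projective_cover_vertex_projectives\<close>.
\<close>

section \<open>Linear algebra on subspaces\<close>

interpretation vects: vector_space_pair
  "vscale :: 'k::field \<Rightarrow> 'k vect \<Rightarrow> 'k vect" "vscale :: 'k \<Rightarrow> 'k vect \<Rightarrow> 'k vect"
  by unfold_locales

lemma linear_betweenI:
  assumes "\<And>u. u \<in> S \<Longrightarrow> f u \<in> T"
    and "\<And>u v. u \<in> S \<Longrightarrow> v \<in> S \<Longrightarrow> f (u + v) = f u + f v"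
    and "\<And>c u. u \<in> S \<Longrightarrow> f (vscale c u) = vscale c (f u)"
  shows "linear_between S T f"
  using assms by (auto simp: linear_between_def)

lemma linear_between_in: "linear_between S T f \<Longrightarrow> u \<in> S \<Longrightarrow> f u \<in> T"
  by (auto simp: linear_between_def)

lemma linear_between_add:
  "linear_between S T f \<Longrightarrow> u \<in> S \<Longrightarrow> v \<in> S \<Longrightarrow> f (u + v) = f u + f v"
  by (auto simp: linear_between_def)

lemma linear_between_scale:
  "linear_between S T f \<Longrightarrow> u \<in> S \<Longrightarrow> f (vscale c u) = vscale c (f u)"
  by (auto simp: linear_between_def)

text \<open>
  A map that is linear on a subspace only agrees there with a globally linear map. This gives
  access to the general theory of linear maps.
\<close>

lemma linear_between_extend:
  assumes S: "vect.subspace S" and f: "linear_between S T f"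
  obtains g where "Vector_Spaces.linear vscale vscale g" "\<And>v. v \<in> S \<Longrightarrow> g v = f v"
proof -
  obtain B where B: "B \<subseteq> S" "vect.independent B" "S \<subseteq> vect.span B"
    using vect.maximal_independent_subset by blast
  obtain g where g: "Vector_Spaces.linear vscale vscale g" "\<forall>x\<in>B. g x = f x"
    using vects.linear_independent_extend[OF B(2)] by blast
  interpret g: Vector_Spaces.linear vscale vscale g by fact
  have f0: "f 0 = 0"
    using linear_between_scale[OF f, of 0 0] vect.subspace_0[OF S] by simp
  have "vect.subspace {v \<in> S. g v = f v}"
  proof (rule vect.subspaceI)
    show "0 \<in> {v \<in> S. g v = f v}" using f0 g.zero vect.subspace_0[OF S] by simp
  next
    fix u v assume "u \<in> {v \<in> S. g v = f v}" "v \<in> {v \<in> S. g v = f v}"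
    then show "u + v \<in> {v \<in> S. g v = f v}"
      using vect.subspace_add[OF S, of u v] linear_between_add[OF f, of u v] g.add by simp
  next
    fix c u assume "u \<in> {v \<in> S. g v = f v}"
    then show "vscale c u \<in> {v \<in> S. g v = f v}"
      using vect.subspace_scale[OF S, of u c] linear_between_scale[OF f, of u c] g.scale by simp
  qed
  moreover have "B \<subseteq> {v \<in> S. g v = f v}" using B(1) g(2) by blast
  ultimately have "vect.span B \<subseteq> {v \<in> S. g v = f v}" by (intro vect.span_minimal)
  with B(3) that[OF g(1)] show ?thesis by blast
qed

lemma linear_between_zero: "vect.subspace S \<Longrightarrow> linear_between S T f \<Longrightarrow> f 0 = 0"
  using linear_between_scale[of S T f 0 0] vect.subspace_0[of S] by simp

lemma linear_between_diff:
  assumes "vect.subspace S" "linear_between S T f" "u \<in> S" "v \<in> S"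
  shows "f (u - v) = f u - f v"
  using linear_between_add[OF assms(2), of "u - v" v] assms vect.subspace_diff[of S u v] by simp

lemma linear_between_sum:
  assumes S: "vect.subspace S" and f: "linear_between S T f" and u: "\<And>i. i \<in> A \<Longrightarrow> u i \<in> S"
  shows "f (\<Sum>i\<in>A. vscale (c i) (u i)) = (\<Sum>i\<in>A. vscale (c i) (f (u i)))"
proof -
  obtain g where g: "Vector_Spaces.linear vscale vscale g" and gf: "\<And>v. v \<in> S \<Longrightarrow> g v = f v"
    using linear_between_extend[OF S f] by blast
  interpret g: Vector_Spaces.linear vscale vscale g by fact
  have "(\<Sum>i\<in>A. vscale (c i) (u i)) \<in> S"
    using S u by (intro vect.subspace_sum vect.subspace_scale)
  then show ?thesis
    using u by (simp flip: gf add: g.sum g.scale)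
qed

lemma linear_between_compose:
  "linear_between S T f \<Longrightarrow> linear_between T U g \<Longrightarrow> linear_between S U (\<lambda>v. g (f v))"
  by (auto simp: linear_between_def image_subset_iff)

lemma linear_between_plus:
  assumes "vect.subspace T" "linear_between S T f" "linear_between S T g"
  shows "linear_between S T (\<lambda>v. f v + g v)"
  using assms
  by (auto simp: linear_between_def image_subset_iff vect.subspace_add vect.scale_right_distrib
      algebra_simps)

lemma linear_between_restrict:
  "linear_between S T f \<Longrightarrow> S' \<subseteq> S \<Longrightarrow> f ` S' \<subseteq> T' \<Longrightarrow> linear_between S' T' f"
  unfolding linear_between_def by (meson subsetD)

lemma linear_between_id: "linear_between S S (\<lambda>v. v)"
  by (simp add: linear_between_def)

lemma linear_between_const_0: "vect.subspace T \<Longrightarrow> linear_between S T (\<lambda>v. 0)"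
  by (auto simp: linear_between_def vect.subspace_0)

lemma subspace_linear_image:
  assumes S: "vect.subspace S" and f: "linear_between S T f"
  shows "vect.subspace (f ` S)"
proof -
  obtain g where g: "Vector_Spaces.linear vscale vscale g" and gf: "\<And>v. v \<in> S \<Longrightarrow> g v = f v"
    using linear_between_extend[OF S f] by blast
  interpret g: Vector_Spaces.linear vscale vscale g by fact
  have "f ` S = g ` S" using gf by auto
  with g.subspace_image[OF S] show ?thesis by simp
qed

lemma linear_image_span:
  assumes S: "vect.subspace S" and f: "linear_between S T f" and B: "B \<subseteq> S"
  shows "f ` vect.span B = vect.span (f ` B)"
proof -
  obtain g where g: "Vector_Spaces.linear vscale vscale g" and gf: "\<And>v. v \<in> S \<Longrightarrow> g v = f v"
    using linear_between_extend[OF S f] by blast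
  interpret g: Vector_Spaces.linear vscale vscale g by fact
  have "vect.span B \<subseteq> S" using B S by (rule vect.span_minimal)
  then have "f ` vect.span B = g ` vect.span B" "f ` B = g ` B" using gf B by (auto simp: subset_iff)
  then show ?thesis using g.span_image by metis
qed

lemma subspace_linear_preimage:
  assumes S: "vect.subspace S" and f: "linear_between S T f" and U: "vect.subspace U"
  shows "vect.subspace {v \<in> S. f v \<in> U}"
  using assms linear_between_zero[OF S f]
  by (auto simp: vect.subspace_def linear_between_def)

lemma subspace_linear_kernel:
  assumes "vect.subspace S" "linear_between S T f"
  shows "vect.subspace {v \<in> S. f v = 0}"
  using subspace_linear_preimage[OF assms vect.subspace_single_0] by simp

lemma inj_on_linear_iff:
  assumes "vect.subspace S" "linear_between S T f"
  shows "inj_on f S \<longleftrightarrow> (\<forall>v\<in>S. f v = 0 \<longrightarrow> v = 0)"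
proof
  assume "inj_on f S"
  then show "\<forall>v\<in>S. f v = 0 \<longrightarrow> v = 0"
    using linear_between_zero[OF assms] vect.subspace_0[OF assms(1)] by (metis inj_onD)
next
  assume r: "\<forall>v\<in>S. f v = 0 \<longrightarrow> v = 0"
  show "inj_on f S"
  proof (rule inj_onI)
    fix u v assume uv: "u \<in> S" "v \<in> S" "f u = f v"
    then have "f (u - v) = 0" "u - v \<in> S"
      using linear_between_diff[OF assms, of u v] vect.subspace_diff[OF assms(1), of u v] by auto
    with r have "u - v = 0" by blast
    then show "u = v" by simp
  qed
qed

lemma linear_between_inv_into:
  assumes S: "vect.subspace S" and f: "linear_between S T f" and b: "bij_betw f S T"
  shows "linear_between T S (inv_into S f)"
proof -
  have inv: "inv_into S f v \<in> S" "f (inv_into S f v) = v" if "v \<in> T" for v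
    using b that by (auto simp: bij_betw_def f_inv_into_f inv_into_into)
  have inj: "inj_on f S" using b by (simp add: bij_betw_def)
  show ?thesis
  proof (rule linear_betweenI)
    fix u v assume uv: "u \<in> T" "v \<in> T"
    have "inv_into S f (f (inv_into S f u + inv_into S f v)) = inv_into S f u + inv_into S f v"
      using inj inv uv S by (intro inv_into_f_f vect.subspace_add) auto
    then show "inv_into S f (u + v) = inv_into S f u + inv_into S f v"
      using inv uv by (simp add: linear_between_add[OF f])
  next
    fix c u assume u: "u \<in> T"
    have "inv_into S f (f (vscale c (inv_into S f u))) = vscale c (inv_into S f u)"
      using inj inv u S by (intro inv_into_f_f vect.subspace_scale) auto
    then show "inv_into S f (vscale c u) = vscale c (inv_into S f u)"
      using inv u by (simp add: linear_between_scale[OF f])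
  qed (use inv in auto)
qed

lemma fin_dim_imp_subspace: "fin_dim_space S \<Longrightarrow> vect.subspace S"
  by (auto simp: fin_dim_space_def)

lemma fin_dim_basis:
  assumes "fin_dim_space S"
  obtains B where "finite B" "B \<subseteq> S" "vect.independent B" "vect.span B = S" "card B = vect.dim S"
proof -
  obtain B0 where B0: "finite B0" "S = vect.span B0" using assms by (auto simp: fin_dim_space_def)
  obtain B where B: "B \<subseteq> S" "vect.independent B" "S \<subseteq> vect.span B" "card B = vect.dim S"
    using vect.basis_exists by blast
  have "finite B" using vect.independent_span_bound[OF B0(1) B(2)] B(1) B0(2) by blast
  moreover have "vect.span B = S" using B B0 by (metis vect.span_minimal vect.subspace_span subset_antisym)
  ultimately show ?thesis using that B by blast
qed

lemma fin_dim_subspace: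
  assumes S: "fin_dim_space S" and L: "vect.subspace L" "L \<subseteq> S"
  shows "fin_dim_space L"
proof -
  obtain B0 where B0: "finite B0" "S = vect.span B0" using S by (auto simp: fin_dim_space_def)
  obtain B where B: "B \<subseteq> L" "vect.independent B" "L \<subseteq> vect.span B"
    using vect.maximal_independent_subset by blast
  have "finite B" using vect.independent_span_bound[OF B0(1) B(2)] B(1) B0(2) L by blast
  moreover have "vect.span B = L" using B L by (meson vect.span_minimal subset_antisym)
  ultimately show ?thesis by (auto simp: fin_dim_space_def)
qed

lemma fin_dim_zero: "fin_dim_space {0}"
  unfolding fin_dim_space_def by (rule exI[of _ "{}"]) simp

text \<open>
  The ambient space of sequences has infinite dimension, so the dimensions are compared through bases:
  a finite basis of the source is mapped onto a spanning set of the target.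
\<close>

lemma dim_surj_le:
  assumes S: "fin_dim_space S" and f: "linear_between S T f" and T: "f ` S = T"
  shows "vect.dim T \<le> vect.dim S"
    and "vect.dim T = vect.dim S \<Longrightarrow> inj_on f S"
proof -
  note subS = fin_dim_imp_subspace[OF S]
  obtain B where B: "finite B" "B \<subseteq> S" "vect.independent B" "vect.span B = S" "card B = vect.dim S"
    using fin_dim_basis[OF S] by blast
  have TB: "T = vect.span (f ` B)" using linear_image_span[OF subS f B(2)] B(4) T by simp
  have dT: "vect.dim T \<le> card (f ` B)" using TB B(1) by (intro vect.dim_le_card) auto
  have le: "card (f ` B) \<le> card B" using B(1) by (rule card_image_le)
  show "vect.dim T \<le> vect.dim S" using dT le B(5) by simp
  assume eq: "vect.dim T = vect.dim S"
  with dT le B(5) have c: "card (f ` B) = card B" by simp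
  have ind: "vect.independent (f ` B)"
  proof
    assume "vect.dependent (f ` B)"
    then obtain a where a: "a \<in> f ` B" "a \<in> vect.span (f ` B - {a})"
      by (auto simp: vect.dependent_def)
    then have "vect.span (f ` B - {a}) = T"
      using TB vect.span_redundant[OF a(2)] by (simp add: insert_absorb)
    then have "vect.dim T \<le> card (f ` B - {a})" using B(1) by (intro vect.dim_le_card) auto
    also have "\<dots> < card (f ` B)" using a B(1) by (intro card_Diff1_less) auto
    finally show False using eq B(5) le by simp
  qed
  obtain g where g: "Vector_Spaces.linear vscale vscale g" and gf: "\<And>v. v \<in> S \<Longrightarrow> g v = f v"
    using linear_between_extend[OF subS f] by blast
  interpret g: Vector_Spaces.linear vscale vscale g by fact
  have "g ` B = f ` B" using gf B(2) by (intro image_cong) auto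
  moreover from this have "inj_on g B" using c B(1) eq_card_imp_inj_on by metis
  ultimately have "inj_on g S" using g.inj_on_span_independent_image[of B] ind B(4) by simp
  then show "inj_on f S" using gf by (simp cong: inj_on_cong)
qed


section \<open>Pairs of vectors\<close>

lemma vfst_vpair [simp]: "vfst (vpair u v) = u"
  and vsnd_vpair [simp]: "vsnd (vpair u v) = v"
  by (auto simp: vfst_def vsnd_def vpair_def)

lemma vpair_vfst_vsnd [simp]: "vpair (vfst w) (vsnd w) = w"
  by (rule ext) (simp add: vfst_def vsnd_def vpair_def odd_two_times_div_two_succ)

lemma vpair_eq_iff [simp]: "vpair u v = vpair u' v' \<longleftrightarrow> u = u' \<and> v = v'"
  by (metis vfst_vpair vsnd_vpair)

lemma vpair_zero [simp]: "vpair 0 0 = 0"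
  by (simp add: vpair_def fun_eq_iff)

lemma vfst_zero [simp]: "vfst 0 = 0" and vsnd_zero [simp]: "vsnd 0 = 0"
  by (simp_all add: vfst_def vsnd_def fun_eq_iff)

lemma vpair_eq_0_iff [simp]: "vpair u v = 0 \<longleftrightarrow> u = 0 \<and> v = 0"
  by (metis vpair_eq_iff vpair_zero)

lemma vpair_add: "vpair u v + vpair u' v' = vpair (u + u') (v + v')"
  by (simp add: vpair_def fun_eq_iff)

lemma vfst_add: "vfst (w + w') = vfst w + vfst w'" and vsnd_add: "vsnd (w + w') = vsnd w + vsnd w'"
  by (simp_all add: vfst_def vsnd_def fun_eq_iff)

lemma vscale_vpair: "vscale c (vpair u v) = vpair (vscale c u) (vscale c v)"
  by (simp add: vpair_def vscale_def fun_eq_iff)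

lemma vfst_vscale: "vfst (vscale c w) = vscale c (vfst w)"
  and vsnd_vscale: "vsnd (vscale c w) = vscale c (vsnd w)"
  by (simp_all add: vfst_def vsnd_def vscale_def fun_eq_iff)

lemma vpair_eq_0D: "vfst w = 0 \<Longrightarrow> vsnd w = 0 \<Longrightarrow> w = 0"
  by (metis vpair_vfst_vsnd vpair_zero)

lemma in_vsp_rep_sum: "w \<in> vsp (rep_sum M N) x \<longleftrightarrow> vfst w \<in> vsp M x \<and> vsnd w \<in> vsp N x"
  unfolding rep_sum_def by simp (metis vfst_vpair vsnd_vpair vpair_vfst_vsnd)

lemma amap_rep_sum: "amap (rep_sum M N) a w = vpair (amap M a (vfst w)) (amap N a (vsnd w))"
  by (simp add: rep_sum_def)

lemma subspace_vsp_rep_sum: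
  "vect.subspace (vsp M x) \<Longrightarrow> vect.subspace (vsp N x) \<Longrightarrow> vect.subspace (vsp (rep_sum M N) x)"
  by (auto simp: vect.subspace_def in_vsp_rep_sum vfst_add vsnd_add vfst_vscale vsnd_vscale)

lemma fin_dim_vsp_rep_sum:
  assumes M: "fin_dim_space (vsp M x)" and N: "fin_dim_space (vsp N x)"
  shows "fin_dim_space (vsp (rep_sum M N) x)"
proof -
  let ?i = "\<lambda>u. vpair u 0" and ?j = "\<lambda>v. vpair 0 v"
  obtain B where B: "finite B" "vect.span B = vsp M x" using M by (auto simp: fin_dim_space_def)
  obtain D where D: "finite D" "vect.span D = vsp N x" using N by (auto simp: fin_dim_space_def)
  have i: "linear_between UNIV UNIV ?i" and j: "linear_between UNIV UNIV ?j"
    by (auto intro!: linear_betweenI simp: vpair_add vscale_vpair)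
  have "vsp (rep_sum M N) x = {u + v |u v. u \<in> ?i ` vsp M x \<and> v \<in> ?j ` vsp N x}"
    by (auto simp: rep_sum_def vpair_add image_iff) (metis add.right_neutral add.left_neutral vpair_add)
  also have "\<dots> = vect.span (?i ` B \<union> ?j ` D)"
    using linear_image_span[OF vect.subspace_UNIV i, of B]
      linear_image_span[OF vect.subspace_UNIV j, of D] B D
    by (simp add: vect.span_Un)
  finally show ?thesis using B(1) D(1) unfolding fin_dim_space_def by (metis finite_Un finite_imageI)
qed


section \<open>Homomorphisms and direct sums of representations\<close>

text \<open>
  The linear structure of a representation, on which homomorphisms, kernels and direct sums depend.
\<close>

definition linear_rep :: "('v, 'a) quiver \<Rightarrow> ('v, 'a, 'k::field) rep \<Rightarrow> bool" where
  "linear_rep Q M \<longleftrightarrow>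
     (\<forall>x\<in>verts Q. vect.subspace (vsp M x)) \<and>
     (\<forall>a\<in>arcs Q. linear_between (vsp M (tail Q a)) (vsp M (head Q a)) (amap M a))"

lemma linear_rep_subspace: "linear_rep Q M \<Longrightarrow> x \<in> verts Q \<Longrightarrow> vect.subspace (vsp M x)"
  by (simp add: linear_rep_def)

lemma linear_rep_amap:
  "linear_rep Q M \<Longrightarrow> a \<in> arcs Q \<Longrightarrow>
     linear_between (vsp M (tail Q a)) (vsp M (head Q a)) (amap M a)"
  by (simp add: linear_rep_def)

lemma mod_cat_linear_rep: "M \<in> mod_cat Q I \<Longrightarrow> linear_rep Q M"
  by (auto simp: mod_cat_def linear_rep_def fin_dim_imp_subspace)

lemma mod_cat_fin_dim: "M \<in> mod_cat Q I \<Longrightarrow> x \<in> verts Q \<Longrightarrow> fin_dim_space (vsp M x)"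
  by (simp add: mod_cat_def)

lemma mod_cat_relation:
  "M \<in> mod_cat Q I \<Longrightarrow> \<rho> \<in> I \<Longrightarrow> x \<in> verts Q \<Longrightarrow> y \<in> verts Q \<Longrightarrow>
     \<forall>p\<in>Poly_Mapping.keys \<rho>. fst p = x \<and> path_end Q p = y \<Longrightarrow> v \<in> vsp M x \<Longrightarrow>
     (\<Sum>p\<in>Poly_Mapping.keys \<rho>. vscale (Poly_Mapping.lookup \<rho> p) (path_map M p v)) = 0"
  unfolding mod_cat_def by blast

lemma rep_hom_linear:
  "rep_hom Q M N f \<Longrightarrow> x \<in> verts Q \<Longrightarrow> linear_between (vsp M x) (vsp N x) (f x)"
  by (simp add: rep_hom_def)

lemma rep_hom_in: "rep_hom Q M N f \<Longrightarrow> x \<in> verts Q \<Longrightarrow> v \<in> vsp M x \<Longrightarrow> f x v \<in> vsp N x"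
  using rep_hom_linear linear_between_in by metis

lemma rep_hom_amap:
  "rep_hom Q M N f \<Longrightarrow> a \<in> arcs Q \<Longrightarrow> v \<in> vsp M (tail Q a) \<Longrightarrow>
     f (head Q a) (amap M a v) = amap N a (f (tail Q a) v)"
  by (simp add: rep_hom_def)

lemma rep_homI:
  assumes "\<And>x. x \<in> verts Q \<Longrightarrow> linear_between (vsp M x) (vsp N x) (f x)"
    and "\<And>a v. a \<in> arcs Q \<Longrightarrow> v \<in> vsp M (tail Q a) \<Longrightarrow>
      f (head Q a) (amap M a v) = amap N a (f (tail Q a) v)"
  shows "rep_hom Q M N f"
  using assms by (simp add: rep_hom_def)

lemma rep_epi_hom: "rep_epi Q M N f \<Longrightarrow> rep_hom Q M N f"
  by (simp add: rep_epi_def)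

lemma rep_epi_image: "rep_epi Q M N f \<Longrightarrow> x \<in> verts Q \<Longrightarrow> f x ` vsp M x = vsp N x"
  by (simp add: rep_epi_def)

lemma rep_iso_iff:
  "rep_iso Q M N \<longleftrightarrow>
     (\<exists>f. rep_hom Q M N f \<and> (\<forall>x\<in>verts Q. bij_betw (f x) (vsp M x) (vsp N x)))"
proof -
  have "rep_mono Q M N f \<and> rep_epi Q M N f \<longleftrightarrow>
      rep_hom Q M N f \<and> (\<forall>x\<in>verts Q. bij_betw (f x) (vsp M x) (vsp N x))" for f
    by (auto simp: rep_mono_def rep_epi_def bij_betw_def)
  then show ?thesis by (simp add: rep_iso_def)
qed

lemma rep_isoI:
  assumes "rep_hom Q M N f" "\<And>x. x \<in> verts Q \<Longrightarrow> bij_betw (f x) (vsp M x) (vsp N x)"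
  shows "rep_iso Q M N"
  using assms by (auto simp: rep_iso_iff)

lemma rep_isoE:
  assumes "rep_iso Q M N"
  obtains f where "rep_hom Q M N f" "\<And>x. x \<in> verts Q \<Longrightarrow> bij_betw (f x) (vsp M x) (vsp N x)"
  using assms by (auto simp: rep_iso_iff)

lemma rep_hom_id: "rep_hom Q M M (\<lambda>x v. v)"
  by (simp add: rep_hom_def linear_between_id)

lemma rep_iso_refl: "rep_iso Q M M"
  by (rule rep_isoI[OF rep_hom_id]) (simp add: bij_betw_def)

locale bound_quiver_algebra =
  fixes Q :: "('v, 'a) quiver" and I :: "(('v, 'a) path \<Rightarrow>\<^sub>0 'k::field) set"
  assumes bound: "bound_quiver Q I"
begin

lemma fin_digraph: "fin_digraph Q"
  using bound by (simp add: bound_quiver_def)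

lemma tail_in [simp]: "a \<in> arcs Q \<Longrightarrow> tail Q a \<in> verts Q"
  and head_in [simp]: "a \<in> arcs Q \<Longrightarrow> head Q a \<in> verts Q"
  and finite_verts [simp]: "finite (verts Q)"
  and finite_arcs [simp]: "finite (arcs Q)"
  using fin_digraph
  by (auto simp: fin_digraph_def fin_digraph_axioms_def wf_digraph_def)

lemma ideal_I: "ideal I (path_algebra Q)"
  using bound by (simp add: bound_quiver_def admissible_def)

lemma relation_keys: "\<rho> \<in> I \<Longrightarrow> p \<in> Poly_Mapping.keys \<rho> \<Longrightarrow> p \<in> paths Q"
  using ideal.Icarr[OF ideal_I] by (auto simp: path_algebra_def)

lemma rep_hom_compose:
  assumes "rep_hom Q L M f" "rep_hom Q M N g"
  shows "rep_hom Q L N (\<lambda>x v. g x (f x v))"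
proof (rule rep_homI)
  show "linear_between (vsp L x) (vsp N x) (\<lambda>v. g x (f x v))" if "x \<in> verts Q" for x
    by (rule linear_between_compose[OF assms[THEN rep_hom_linear, OF that]])
  show "g (head Q a) (f (head Q a) (amap L a v)) = amap N a (g (tail Q a) (f (tail Q a) v))"
    if "a \<in> arcs Q" "v \<in> vsp L (tail Q a)" for a v
    using rep_hom_amap[OF assms(1) that] rep_hom_amap[OF assms(2) that(1)]
      rep_hom_in[OF assms(1) tail_in that(2)] that(1) by simp
qed

lemma rep_hom_plus:
  assumes f: "rep_hom Q M N f" and g: "rep_hom Q M N g" and N: "linear_rep Q N"
  shows "rep_hom Q M N (\<lambda>x v. f x v + g x v)"
proof (rule rep_homI)
  fix a v assume a: "a \<in> arcs Q" "v \<in> vsp M (tail Q a)"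
  have "amap N a (f (tail Q a) v + g (tail Q a) v) = amap N a (f (tail Q a) v) + amap N a (g (tail Q a) v)"
    using rep_hom_in[OF f tail_in a(2)] rep_hom_in[OF g tail_in a(2)] a(1)
    by (intro linear_between_add[OF linear_rep_amap[OF N]]) auto
  then show "f (head Q a) (amap M a v) + g (head Q a) (amap M a v)
      = amap N a (f (tail Q a) v + g (tail Q a) v)"
    using rep_hom_amap[OF f a] rep_hom_amap[OF g a] by simp
next
  fix x assume x: "x \<in> verts Q"
  show "linear_between (vsp M x) (vsp N x) (\<lambda>v. f x v + g x v)"
    by (rule linear_between_plus[OF linear_rep_subspace[OF N x] rep_hom_linear[OF f x]
          rep_hom_linear[OF g x]])
qed

lemma amap_zero: "linear_rep Q M \<Longrightarrow> a \<in> arcs Q \<Longrightarrow> amap M a 0 = 0"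
  by (rule linear_between_zero[OF linear_rep_subspace linear_rep_amap]) auto

lemma amap_in: "linear_rep Q M \<Longrightarrow> a \<in> arcs Q \<Longrightarrow> v \<in> vsp M (tail Q a) \<Longrightarrow> amap M a v \<in> vsp M (head Q a)"
  using linear_rep_amap linear_between_in by metis

lemma rep_hom_0: "linear_rep Q M \<Longrightarrow> rep_hom Q M N f \<Longrightarrow> x \<in> verts Q \<Longrightarrow> f x 0 = 0"
  by (rule linear_between_zero[OF linear_rep_subspace rep_hom_linear])

lemma rep_hom_diff:
  "linear_rep Q M \<Longrightarrow> rep_hom Q M N f \<Longrightarrow> x \<in> verts Q \<Longrightarrow> u \<in> vsp M x \<Longrightarrow> v \<in> vsp M x \<Longrightarrow>
     f x (u - v) = f x u - f x v"
  by (rule linear_between_diff[OF linear_rep_subspace rep_hom_linear])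

lemma rep_hom_inv:
  assumes M: "linear_rep Q M" and f: "rep_hom Q M N f"
    and bij: "\<And>x. x \<in> verts Q \<Longrightarrow> bij_betw (f x) (vsp M x) (vsp N x)"
  shows "rep_hom Q N M (\<lambda>x. inv_into (vsp M x) (f x))"
proof (rule rep_homI)
  fix x assume "x \<in> verts Q"
  then show "linear_between (vsp N x) (vsp M x) (inv_into (vsp M x) (f x))"
    using M f bij by (intro linear_between_inv_into linear_rep_subspace rep_hom_linear)
next
  fix a v assume a: "a \<in> arcs Q" and v: "v \<in> vsp N (tail Q a)"
  obtain u where u: "u \<in> vsp M (tail Q a)" "v = f (tail Q a) u"
    using bij[of "tail Q a"] a v by (auto simp: bij_betw_def)
  have inv: "inv_into (vsp M x) (f x) (f x w) = w" if "x \<in> verts Q" "w \<in> vsp M x" for x w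
    using bij that by (auto simp: bij_betw_def)
  have "amap N a v = f (head Q a) (amap M a u)"
    using rep_hom_amap[OF f a u(1)] u(2) by simp
  moreover have "amap M a u \<in> vsp M (head Q a)" by (rule amap_in[OF M a u(1)])
  ultimately show "inv_into (vsp M (head Q a)) (f (head Q a)) (amap N a v)
      = amap M a (inv_into (vsp M (tail Q a)) (f (tail Q a)) v)"
    using inv a u by simp
qed

lemma rep_iso_sym:
  assumes M: "linear_rep Q M" and iso: "rep_iso Q M N"
  shows "rep_iso Q N M"
proof -
  obtain f where f: "rep_hom Q M N f" "\<And>x. x \<in> verts Q \<Longrightarrow> bij_betw (f x) (vsp M x) (vsp N x)"
    using rep_isoE[OF iso] by blast
  show ?thesis by (rule rep_isoI[OF rep_hom_inv[OF M f]]) (auto intro: bij_betw_inv_into f(2))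
qed

lemma rep_iso_trans:
  assumes "rep_iso Q L M" "rep_iso Q M N"
  shows "rep_iso Q L N"
proof -
  obtain f where f: "rep_hom Q L M f" "\<And>x. x \<in> verts Q \<Longrightarrow> bij_betw (f x) (vsp L x) (vsp M x)"
    using rep_isoE[OF assms(1)] by blast
  obtain g where g: "rep_hom Q M N g" "\<And>x. x \<in> verts Q \<Longrightarrow> bij_betw (g x) (vsp M x) (vsp N x)"
    using rep_isoE[OF assms(2)] by blast
  show ?thesis
    using bij_betw_trans[OF f(2) g(2)]
    by (intro rep_isoI[OF rep_hom_compose[OF f(1) g(1)]]) (simp add: comp_def)
qed


subsection \<open>The action of paths\<close>

lemma path_map_Nil [simp]: "path_map M (x, []) v = v"
  and path_map_Cons [simp]: "path_map M (x, a # p) v = path_map M (head Q a, p) (amap M a v)"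
  and path_map_snoc [simp]: "path_map M (x, p @ [a]) v = amap M a (path_map M (x, p) v)"
  by (simp_all add: path_map_def)

abbreviation "walk \<equiv> pre_digraph.awalk Q"

lemma walk_Nil [simp]: "walk x [] y \<longleftrightarrow> x = y \<and> x \<in> verts Q"
  by (auto simp: pre_digraph.awalk_def pre_digraph.cas.simps)

lemma walk_Cons [simp]: "walk x (a # p) y \<longleftrightarrow> a \<in> arcs Q \<and> tail Q a = x \<and> walk (head Q a) p y"
  by (auto simp: pre_digraph.awalk_def pre_digraph.cas.simps)

lemma walk_append: "walk x (p @ q) y \<longleftrightarrow> (\<exists>z. walk x p z \<and> walk z q y)"
proof (induction p arbitrary: x)
  case Nil
  show ?case by (auto simp: pre_digraph.awalk_def pre_digraph.cas.simps)
next
  case (Cons a p)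
  show ?case using Cons.IH[of "head Q a"] by auto
qed

lemma walk_snoc [simp]: "walk x (p @ [a]) y \<longleftrightarrow> walk x p (tail Q a) \<and> a \<in> arcs Q \<and> head Q a = y"
  by (auto simp: walk_append)

lemma walk_verts: "walk x p y \<Longrightarrow> x \<in> verts Q \<and> y \<in> verts Q"
  by (induction p arbitrary: x) auto

lemma walk_backward_closed:
  assumes "\<And>a. a \<in> arcs Q \<Longrightarrow> head Q a \<in> S \<Longrightarrow> a \<in> T \<and> tail Q a \<in> S"
  shows "walk x p y \<Longrightarrow> y \<in> S \<Longrightarrow> set p \<subseteq> T"
proof (induction p arbitrary: y rule: rev_induct)
  case (snoc a p)
  then have "walk x p (tail Q a)" "a \<in> arcs Q" "head Q a \<in> S" by auto
  with assms snoc.IH show ?case by auto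
qed simp

lemma walk_forward_closed:
  assumes "\<And>a. a \<in> arcs Q \<Longrightarrow> tail Q a \<in> S \<Longrightarrow> a \<in> T \<and> head Q a \<in> S"
  shows "walk x p y \<Longrightarrow> x \<in> S \<Longrightarrow> set p \<subseteq> T"
proof (induction p arbitrary: x)
  case (Cons a p)
  then have "walk (head Q a) p y" "a \<in> arcs Q" "tail Q a \<in> S" by auto
  with assms Cons.IH show ?case by auto
qed simp

lemma path_end_walk: "walk x p y \<Longrightarrow> path_end Q (x, p) = y"
  by (induction p arbitrary: x)
    (auto simp: path_end_def pre_digraph.awalk_verts.simps pre_digraph.awalk_verts_non_Nil)

lemma paths_iff: "(x, p) \<in> paths Q \<longleftrightarrow> walk x p (path_end Q (x, p))"
  by (simp add: paths_def)

lemma linear_path_map: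
  "linear_rep Q M \<Longrightarrow> walk x p y \<Longrightarrow> linear_between (vsp M x) (vsp M y) (path_map M (x, p))"
proof (induction p arbitrary: x)
  case Nil
  then show ?case by (simp add: linear_between_def)
next
  case (Cons a p)
  then have "linear_between (vsp M x) (vsp M y) (\<lambda>v. path_map M (head Q a, p) (amap M a v))"
    using linear_between_compose[OF linear_rep_amap[OF Cons.prems(1), of a]] by auto
  then show ?case by (simp add: linear_between_def)
qed

lemma path_map_in: "linear_rep Q M \<Longrightarrow> walk x p y \<Longrightarrow> v \<in> vsp M x \<Longrightarrow> path_map M (x, p) v \<in> vsp M y"
  using linear_path_map linear_between_in by metis

lemma rep_hom_path_map:
  assumes M: "linear_rep Q M" and f: "rep_hom Q M N f"
  shows "walk x p y \<Longrightarrow> v \<in> vsp M x \<Longrightarrow> f y (path_map M (x, p) v) = path_map N (x, p) (f x v)"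
proof (induction p arbitrary: x v)
  case (Cons a p)
  then show ?case
    using rep_hom_amap[OF f, of a v] amap_in[OF M, of a v] by simp
qed simp

text \<open>
  A representation belongs to the module category as soon as its vectors are separated by
  homomorphisms to modules. Submodules and direct sums of modules are of this kind.
\<close>

lemma mod_cat_separated:
  assumes fin: "\<And>x. x \<in> verts Q \<Longrightarrow> fin_dim_space (vsp M x)"
    and lin: "\<And>a. a \<in> arcs Q \<Longrightarrow> linear_between (vsp M (tail Q a)) (vsp M (head Q a)) (amap M a)"
    and sep: "\<And>x v. x \<in> verts Q \<Longrightarrow> v \<in> vsp M x \<Longrightarrow> v \<noteq> 0 \<Longrightarrow>
      \<exists>N\<in>mod_cat Q I. \<exists>f. rep_hom Q M N f \<and> f x v \<noteq> 0"
  shows "M \<in> mod_cat Q I"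
proof -
  have M: "linear_rep Q M" using fin lin by (simp add: linear_rep_def fin_dim_imp_subspace)
  have "(\<Sum>p\<in>Poly_Mapping.keys \<rho>. vscale (Poly_Mapping.lookup \<rho> p) (path_map M p v)) = 0" (is "?s = 0")
    if \<rho>: "\<rho> \<in> I" and x: "x \<in> verts Q" and y: "y \<in> verts Q"
      and par: "\<forall>p\<in>Poly_Mapping.keys \<rho>. fst p = x \<and> path_end Q p = y" and v: "v \<in> vsp M x" for \<rho> x y v
  proof (rule ccontr)
    assume ne: "?s \<noteq> 0"
    have walk: "walk x (snd p) y" if "p \<in> Poly_Mapping.keys \<rho>" for p
      using relation_keys[OF \<rho> that] par that paths_iff[of x "snd p"] by force
    have in_M: "path_map M p v \<in> vsp M y" if "p \<in> Poly_Mapping.keys \<rho>" for p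
      using path_map_in[OF M walk[OF that] v] par that by force
    then have "?s \<in> vsp M y"
      using linear_rep_subspace[OF M y] by (intro vect.subspace_sum vect.subspace_scale)
    with sep[OF y _ ne] obtain N f where N: "N \<in> mod_cat Q I" "rep_hom Q M N f" "f y ?s \<noteq> 0"
      by blast
    have "f y ?s = (\<Sum>p\<in>Poly_Mapping.keys \<rho>. vscale (Poly_Mapping.lookup \<rho> p) (f y (path_map M p v)))"
      using in_M by (intro linear_between_sum[OF linear_rep_subspace[OF M y] rep_hom_linear[OF N(2) y]])
    also have "\<dots> = (\<Sum>p\<in>Poly_Mapping.keys \<rho>. vscale (Poly_Mapping.lookup \<rho> p) (path_map N p (f x v)))"
      using rep_hom_path_map[OF M N(2) walk v] par
      by (intro sum.cong arg_cong2[where f = vscale]) (auto simp: path_map_def)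
    also have "\<dots> = 0"
      by (rule mod_cat_relation[OF N(1) \<rho> x y par rep_hom_in[OF N(2) x v]])
    finally show False using N(3) by simp
  qed
  with fin lin show ?thesis unfolding mod_cat_def by blast
qed

lemma mod_cat_embed:
  assumes N: "N \<in> mod_cat Q I" and f: "rep_hom Q M N f"
    and inj: "\<And>x v. x \<in> verts Q \<Longrightarrow> v \<in> vsp M x \<Longrightarrow> f x v = 0 \<Longrightarrow> v = 0"
    and fin: "\<And>x. x \<in> verts Q \<Longrightarrow> fin_dim_space (vsp M x)"
    and lin: "\<And>a. a \<in> arcs Q \<Longrightarrow> linear_between (vsp M (tail Q a)) (vsp M (head Q a)) (amap M a)"
  shows "M \<in> mod_cat Q I"
  using fin lin
proof (rule mod_cat_separated)
  fix x v assume "x \<in> verts Q" "v \<in> vsp M x" "v \<noteq> 0"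
  then show "\<exists>N\<in>mod_cat Q I. \<exists>f. rep_hom Q M N f \<and> f x v \<noteq> 0"
    using N f inj by blast
qed auto

lemma subrepI:
  assumes "\<And>x. x \<in> verts Q \<Longrightarrow> vect.subspace (L x)" "\<And>x. x \<in> verts Q \<Longrightarrow> L x \<subseteq> vsp M x"
    and "\<And>a v. a \<in> arcs Q \<Longrightarrow> v \<in> L (tail Q a) \<Longrightarrow> amap M a v \<in> L (head Q a)"
  shows "subrep Q M L"
  using assms by (auto simp: subrep_def)

lemma subrep_subspace: "subrep Q M L \<Longrightarrow> x \<in> verts Q \<Longrightarrow> vect.subspace (L x)"
  and subrep_subset: "subrep Q M L \<Longrightarrow> x \<in> verts Q \<Longrightarrow> L x \<subseteq> vsp M x"
  and subrep_amap: "subrep Q M L \<Longrightarrow> a \<in> arcs Q \<Longrightarrow> v \<in> L (tail Q a) \<Longrightarrow> amap M a v \<in> L (head Q a)"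
  unfolding subrep_def by blast+

lemma mod_cat_subrep:
  assumes M: "M \<in> mod_cat Q I" and L: "subrep Q M L"
  shows "M\<lparr>vsp := L\<rparr> \<in> mod_cat Q I"
proof (rule mod_cat_embed[OF M, where f = "\<lambda>x v. v"])
  show "rep_hom Q (M\<lparr>vsp := L\<rparr>) M (\<lambda>x v. v)"
    using L by (intro rep_homI) (auto simp: subrep_def linear_between_def)
  show "fin_dim_space (vsp (M\<lparr>vsp := L\<rparr>) x)" if "x \<in> verts Q" for x
    using fin_dim_subspace[OF mod_cat_fin_dim[OF M that]] L that by (auto simp: subrep_def)
  show "linear_between (vsp (M\<lparr>vsp := L\<rparr>) (tail Q a)) (vsp (M\<lparr>vsp := L\<rparr>) (head Q a)) (amap (M\<lparr>vsp := L\<rparr>) a)"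
    if "a \<in> arcs Q" for a
    using linear_between_restrict[OF linear_rep_amap[OF mod_cat_linear_rep[OF M] that]] L that
    by (simp add: subrep_def)
qed auto

lemma subrep_ker:
  assumes M: "linear_rep Q M" and N: "linear_rep Q N" and f: "rep_hom Q M N f"
  shows "subrep Q M (vsp (rep_ker M f))"
proof (rule subrepI)
  show "vect.subspace (vsp (rep_ker M f) x)" if "x \<in> verts Q" for x
    using subspace_linear_kernel[OF linear_rep_subspace[OF M that] rep_hom_linear[OF f that]]
    by (simp add: rep_ker_def)
  show "amap M a v \<in> vsp (rep_ker M f) (head Q a)"
    if "a \<in> arcs Q" "v \<in> vsp (rep_ker M f) (tail Q a)" for a v
    using that amap_in[OF M] rep_hom_amap[OF f that(1), of v] amap_zero[OF N that(1)]
    by (simp add: rep_ker_def)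
qed (simp add: rep_ker_def)

lemma mod_cat_ker:
  "M \<in> mod_cat Q I \<Longrightarrow> linear_rep Q N \<Longrightarrow> rep_hom Q M N f \<Longrightarrow> rep_ker M f \<in> mod_cat Q I"
  using mod_cat_subrep[OF _ subrep_ker[OF mod_cat_linear_rep]] by (simp add: rep_ker_def)

lemma mod_cat_zero: "rep_zero \<in> mod_cat Q I"
  by (rule mod_cat_separated)
    (auto simp: rep_zero_def fin_dim_zero linear_between_def)


subsection \<open>Direct sums\<close>

lemma linear_rep_sum: "linear_rep Q M \<Longrightarrow> linear_rep Q N \<Longrightarrow> linear_rep Q (rep_sum M N)"
  unfolding linear_rep_def
  by (auto simp: subspace_vsp_rep_sum linear_between_def in_vsp_rep_sum amap_rep_sum
      image_subset_iff vpair_add vscale_vpair vfst_add vsnd_add vfst_vscale vsnd_vscale)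

lemma rep_hom_fst: "rep_hom Q (rep_sum M N) M (\<lambda>x. vfst)"
  and rep_hom_snd: "rep_hom Q (rep_sum M N) N (\<lambda>x. vsnd)"
  by (auto intro!: rep_homI linear_betweenI
      simp: in_vsp_rep_sum amap_rep_sum vfst_add vsnd_add vfst_vscale vsnd_vscale)

lemma rep_hom_pair:
  "rep_hom Q L M f \<Longrightarrow> rep_hom Q L N g \<Longrightarrow> rep_hom Q L (rep_sum M N) (\<lambda>x v. vpair (f x v) (g x v))"
  unfolding rep_hom_def linear_between_def
  by (auto simp: in_vsp_rep_sum amap_rep_sum vpair_add vscale_vpair image_subset_iff)

lemma rep_hom_inl: "linear_rep Q N \<Longrightarrow> rep_hom Q M (rep_sum M N) (\<lambda>x u. vpair u 0)"
  and rep_hom_inr: "linear_rep Q M \<Longrightarrow> rep_hom Q N (rep_sum M N) (\<lambda>x v. vpair 0 v)"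
  by (auto intro!: rep_homI linear_betweenI
      simp: in_vsp_rep_sum amap_rep_sum vpair_add vscale_vpair amap_zero vect.subspace_0
        linear_rep_subspace)

lemma rep_hom_copair:
  assumes "rep_hom Q M L f" "rep_hom Q N L g" "linear_rep Q L"
  shows "rep_hom Q (rep_sum M N) L (\<lambda>x w. f x (vfst w) + g x (vsnd w))"
  by (rule rep_hom_plus[OF rep_hom_compose[OF rep_hom_fst assms(1)]
        rep_hom_compose[OF rep_hom_snd assms(2)] assms(3)])

lemma rep_hom_sum_map:
  assumes "rep_hom Q M M' f" "rep_hom Q N N' g"
  shows "rep_hom Q (rep_sum M N) (rep_sum M' N') (\<lambda>x w. vpair (f x (vfst w)) (g x (vsnd w)))"
  by (rule rep_hom_pair[OF rep_hom_compose[OF rep_hom_fst assms(1)]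
        rep_hom_compose[OF rep_hom_snd assms(2)]])

lemma mod_cat_sum:
  assumes M: "M \<in> mod_cat Q I" and N: "N \<in> mod_cat Q I"
  shows "rep_sum M N \<in> mod_cat Q I"
proof (rule mod_cat_separated)
  fix x v assume "v \<noteq> (0 :: 'k vect)"
  then have "vfst v \<noteq> 0 \<or> vsnd v \<noteq> 0" using vpair_eq_0D by blast
  then show "\<exists>L\<in>mod_cat Q I. \<exists>f. rep_hom Q (rep_sum M N) L f \<and> f x v \<noteq> 0"
    using M N rep_hom_fst[of M N] rep_hom_snd[of M N] by blast
qed (use M N linear_rep_sum[OF mod_cat_linear_rep[OF M] mod_cat_linear_rep[OF N]] in
    \<open>auto simp: fin_dim_vsp_rep_sum mod_cat_fin_dim linear_rep_amap\<close>)

lemma mod_cat_sum_list: "set Ms \<subseteq> mod_cat Q I \<Longrightarrow> rep_sum_list Ms \<in> mod_cat Q I"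
  by (induction Ms) (auto simp: rep_sum_list_def mod_cat_zero mod_cat_sum)

lemma rep_sum_list_Nil [simp]: "rep_sum_list [] = rep_zero"
  and rep_sum_list_Cons [simp]: "rep_sum_list (M # Ms) = rep_sum M (rep_sum_list Ms)"
  by (simp_all add: rep_sum_list_def)

lemma rep_iso_sum:
  assumes M: "rep_iso Q M M'" and N: "rep_iso Q N N'"
  shows "rep_iso Q (rep_sum M N) (rep_sum M' N')"
proof -
  obtain f where f: "rep_hom Q M M' f" "\<And>x. x \<in> verts Q \<Longrightarrow> bij_betw (f x) (vsp M x) (vsp M' x)"
    using rep_isoE[OF M] by blast
  obtain g where g: "rep_hom Q N N' g" "\<And>x. x \<in> verts Q \<Longrightarrow> bij_betw (g x) (vsp N x) (vsp N' x)"
    using rep_isoE[OF N] by blast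
  show ?thesis
  proof (rule rep_isoI[OF rep_hom_sum_map[OF f(1) g(1)]])
    fix x assume x: "x \<in> verts Q"
    have "bij_betw (\<lambda>w. vpair (f x (vfst w)) (g x (vsnd w))) (vsp (rep_sum M N) x) (vsp (rep_sum M' N') x)"
      (is "bij_betw ?h _ _")
    proof (rule bij_betw_byWitness[where f' =
          "\<lambda>w. vpair (inv_into (vsp M x) (f x) (vfst w)) (inv_into (vsp N x) (g x) (vsnd w))"])
    qed (use f(2)[OF x] g(2)[OF x] in \<open>auto simp: in_vsp_rep_sum bij_betw_def inv_into_into
          f_inv_into_f image_subset_iff\<close>)
    then show "bij_betw (\<lambda>w. vpair (f x (vfst w)) (g x (vsnd w))) (vsp (rep_sum M N) x) (vsp (rep_sum M' N') x)" .
  qed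
qed

lemma rep_iso_sum_assoc: "rep_iso Q (rep_sum (rep_sum L M) N) (rep_sum L (rep_sum M N))"
proof (rule rep_isoI)
  show "rep_hom Q (rep_sum (rep_sum L M) N) (rep_sum L (rep_sum M N))
      (\<lambda>x w. vpair (vfst (vfst w)) (vpair (vsnd (vfst w)) (vsnd w)))"
    by (rule rep_hom_pair[OF rep_hom_compose[OF rep_hom_fst rep_hom_fst]
          rep_hom_pair[OF rep_hom_compose[OF rep_hom_fst rep_hom_snd] rep_hom_snd]])
  show "bij_betw (\<lambda>w. vpair (vfst (vfst w)) (vpair (vsnd (vfst w)) (vsnd w)))
      (vsp (rep_sum (rep_sum L M) N) x) (vsp (rep_sum L (rep_sum M N)) x)" for x
    by (rule bij_betw_byWitness[where f' =
          "\<lambda>w. vpair (vpair (vfst w) (vfst (vsnd w))) (vsnd (vsnd w))"]) (auto simp: in_vsp_rep_sum)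
qed

lemma rep_iso_sum_comm: "rep_iso Q (rep_sum M N) (rep_sum N M)"
proof (rule rep_isoI)
  show "rep_hom Q (rep_sum M N) (rep_sum N M) (\<lambda>x w. vpair (vsnd w) (vfst w))"
    by (rule rep_hom_pair[OF rep_hom_snd rep_hom_fst])
  show "bij_betw (\<lambda>w. vpair (vsnd w) (vfst w)) (vsp (rep_sum M N) x) (vsp (rep_sum N M) x)" for x
    by (rule bij_betw_byWitness[where f' = "\<lambda>w. vpair (vsnd w) (vfst w)"]) (auto simp: in_vsp_rep_sum)
qed

lemma rep_iso_sum_zero:
  assumes N: "\<And>x. x \<in> verts Q \<Longrightarrow> vsp N x = {0}"
  shows "rep_iso Q (rep_sum M N) M" and "rep_iso Q (rep_sum N M) M"
proof -
  show "rep_iso Q (rep_sum M N) M"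
  proof (rule rep_isoI[OF rep_hom_fst])
    show "bij_betw vfst (vsp (rep_sum M N) x) (vsp M x)" if "x \<in> verts Q" for x
      using N[OF that] by (intro bij_betw_byWitness[where f' = "\<lambda>u. vpair u 0"])
        (auto simp: in_vsp_rep_sum, metis vpair_vfst_vsnd)
  qed
  with rep_iso_sum_comm rep_iso_trans show "rep_iso Q (rep_sum N M) M" by blast
qed

lemma rep_iso_sum_rep_zero: "rep_iso Q (rep_sum M rep_zero) M" "rep_iso Q (rep_sum rep_zero M) M"
  by (auto intro!: rep_iso_sum_zero simp: rep_zero_def)

lemma rep_iso_zero:
  assumes "\<And>x. x \<in> verts Q \<Longrightarrow> vsp M x = {0}" "linear_rep Q M"
    "\<And>x. x \<in> verts Q \<Longrightarrow> vsp N x = {0}" "linear_rep Q N"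
  shows "rep_iso Q M N"
proof (rule rep_isoI[where f = "\<lambda>x v. 0"])
  show "rep_hom Q M N (\<lambda>x v. 0)"
    using assms by (auto intro!: rep_homI linear_betweenI simp: amap_zero)
qed (use assms in \<open>auto simp: bij_betw_def\<close>)

lemma rep_iso_sum_list_append:
  "rep_iso Q (rep_sum_list (Ms @ Ns)) (rep_sum (rep_sum_list Ms) (rep_sum_list Ns))"
  if "set Ms \<subseteq> mod_cat Q I" "set Ns \<subseteq> mod_cat Q I"
  using that
proof (induction Ms)
  case Nil
  then show ?case
    using rep_iso_sym[OF _ rep_iso_sum_rep_zero(2)]
      mod_cat_linear_rep[OF mod_cat_sum[OF mod_cat_zero mod_cat_sum_list]] by auto
next
  case (Cons M Ms)
  let ?T = "rep_sum (rep_sum M (rep_sum_list Ms)) (rep_sum_list Ns)"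
  have "?T \<in> mod_cat Q I" using Cons.prems by (auto intro!: mod_cat_sum mod_cat_sum_list)
  then have "rep_iso Q (rep_sum M (rep_sum (rep_sum_list Ms) (rep_sum_list Ns))) ?T"
    using rep_iso_sym[OF mod_cat_linear_rep rep_iso_sum_assoc] by blast
  with Cons show ?case
    using rep_iso_sum[OF rep_iso_refl[of Q M]] rep_iso_trans by fastforce
qed


subsection \<open>Short exact sequences\<close>

lemma short_exact_sum:
  fixes L M N :: "('v, 'a, 'k) rep"
  assumes S: "short_exact Q L M N" and S': "short_exact Q L' M' N'"
  shows "short_exact Q (rep_sum L L') (rep_sum M M') (rep_sum N N')"
proof -
  obtain f g where fg: "rep_mono Q L M f" "rep_epi Q M N g"
      "\<And>x. x \<in> verts Q \<Longrightarrow> f x ` vsp L x = vsp (rep_ker M g) x"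
    using S by (auto simp: short_exact_def)
  obtain f' g' where fg': "rep_mono Q L' M' f'" "rep_epi Q M' N' g'"
      "\<And>x. x \<in> verts Q \<Longrightarrow> f' x ` vsp L' x = vsp (rep_ker M' g') x"
    using S' by (auto simp: short_exact_def)
  let ?f = "\<lambda>x w. vpair (f x (vfst w)) (f' x (vsnd w))"
  let ?g = "\<lambda>x w. vpair (g x (vfst w)) (g' x (vsnd w))"
  have image: "(\<lambda>w. vpair (h (vfst w)) (h' (vsnd w))) ` vsp (rep_sum A B) x
      = {w. vfst w \<in> h ` vsp A x \<and> vsnd w \<in> h' ` vsp B x}" for h h' and A B :: "('v, 'a, 'k) rep" and x
  proof (intro equalityI subsetI)
    fix w assume "w \<in> {w. vfst w \<in> h ` vsp A x \<and> vsnd w \<in> h' ` vsp B x}"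
    then obtain u v where "u \<in> vsp A x" "v \<in> vsp B x" "vfst w = h u" "vsnd w = h' v" by blast
    then have "w = vpair (h u) (h' v)" "vpair u v \<in> vsp (rep_sum A B) x"
      by (metis vpair_vfst_vsnd) (simp add: in_vsp_rep_sum \<open>u \<in> vsp A x\<close> \<open>v \<in> vsp B x\<close>)
    then show "w \<in> (\<lambda>w. vpair (h (vfst w)) (h' (vsnd w))) ` vsp (rep_sum A B) x"
      by (intro image_eqI[of _ _ "vpair u v"]) simp_all
  qed (auto simp: in_vsp_rep_sum)
  show ?thesis
    unfolding short_exact_def
  proof (intro exI conjI ballI)
    show "rep_mono Q (rep_sum L L') (rep_sum M M') ?f"
      unfolding rep_mono_def
    proof (intro conjI ballI inj_onI)
      fix x w w' assume x: "x \<in> verts Q" and w: "w \<in> vsp (rep_sum L L') x" "w' \<in> vsp (rep_sum L L') x"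
        "?f x w = ?f x w'"
      then have "vfst w = vfst w'" "vsnd w = vsnd w'"
        using fg(1) fg'(1) by (auto simp: rep_mono_def inj_on_def in_vsp_rep_sum)
      then show "w = w'" by (metis vpair_vfst_vsnd)
    next
      show "rep_hom Q (rep_sum L L') (rep_sum M M') ?f"
        using fg(1) fg'(1) by (intro rep_hom_sum_map) (simp_all add: rep_mono_def)
    qed
    have "?g x ` vsp (rep_sum M M') x = vsp (rep_sum N N') x" if x: "x \<in> verts Q" for x
      unfolding image[of "g x" "g' x" M M' x] rep_epi_image[OF fg(2) x] rep_epi_image[OF fg'(2) x]
      by (simp add: set_eq_iff in_vsp_rep_sum)
    then show "rep_epi Q (rep_sum M M') (rep_sum N N') ?g"
      unfolding rep_epi_def
      using rep_hom_sum_map[OF rep_epi_hom[OF fg(2)] rep_epi_hom[OF fg'(2)]] by blast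
    show "?f x ` vsp (rep_sum L L') x = vsp (rep_ker (rep_sum M M') ?g) x" if x: "x \<in> verts Q" for x
      unfolding image[of "f x" "f' x" L L' x] fg(3)[OF x] fg'(3)[OF x]
      by (auto simp: rep_ker_def in_vsp_rep_sum)
  qed
qed

lemma short_exact_iso:
  assumes S: "short_exact Q L M N" and L: "rep_iso Q L' L" and M: "rep_iso Q M M'" and N: "rep_iso Q N N'"
    and lin: "linear_rep Q M" "linear_rep Q N"
  shows "short_exact Q L' M' N'"
proof -
  obtain f g where f: "rep_hom Q L M f" and g: "rep_hom Q M N g"
      and ex: "\<And>x. x \<in> verts Q \<Longrightarrow> inj_on (f x) (vsp L x)" "\<And>x. x \<in> verts Q \<Longrightarrow> g x ` vsp M x = vsp N x"
      "\<And>x. x \<in> verts Q \<Longrightarrow> f x ` vsp L x = {v \<in> vsp M x. g x v = 0}"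
    using S by (auto simp: short_exact_def rep_mono_def rep_epi_def rep_ker_def)
  obtain i where i: "rep_hom Q L' L i" "\<And>x. x \<in> verts Q \<Longrightarrow> bij_betw (i x) (vsp L' x) (vsp L x)"
    using rep_isoE[OF L] by blast
  obtain j where j: "rep_hom Q M M' j" "\<And>x. x \<in> verts Q \<Longrightarrow> bij_betw (j x) (vsp M x) (vsp M' x)"
    using rep_isoE[OF M] by blast
  obtain k where k: "rep_hom Q N N' k" "\<And>x. x \<in> verts Q \<Longrightarrow> bij_betw (k x) (vsp N x) (vsp N' x)"
    using rep_isoE[OF N] by blast
  let ?j' = "\<lambda>x. inv_into (vsp M x) (j x)"
  have j': "rep_hom Q M' M ?j'" by (rule rep_hom_inv[OF lin(1) j])
  let ?f = "\<lambda>x v. j x (f x (i x v))" and ?g = "\<lambda>x v. k x (g x (?j' x v))"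
  have inv: "?j' x (j x v) = v" if "x \<in> verts Q" "v \<in> vsp M x" for x v
    using j(2) that by (auto simp: bij_betw_def)
  have bj: "bij_betw (?j' x) (vsp M' x) (vsp M x)" if "x \<in> verts Q" for x
    using bij_betw_inv_into[OF j(2)[OF that]] .
  show ?thesis
    unfolding short_exact_def
  proof (intro exI conjI ballI)
    have "inj_on (?f x) (vsp L' x)" if x: "x \<in> verts Q" for x
    proof (rule inj_onI)
      fix u v assume uv: "u \<in> vsp L' x" "v \<in> vsp L' x" "?f x u = ?f x v"
      then have "f x (i x u) = f x (i x v)"
        using j(2)[OF x] rep_hom_in[OF f x] rep_hom_in[OF i(1) x] by (auto simp: bij_betw_def inj_on_def)
      then have "i x u = i x v" using ex(1)[OF x] rep_hom_in[OF i(1) x] uv by (auto simp: inj_on_def)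
      then show "u = v" using i(2)[OF x] uv by (auto simp: bij_betw_def inj_on_def)
    qed
    then show "rep_mono Q L' M' ?f"
      unfolding rep_mono_def using rep_hom_compose[OF rep_hom_compose[OF i(1) f] j(1)] by blast
    have "?g x ` vsp M' x = vsp N' x" if x: "x \<in> verts Q" for x
    proof -
      have "?g x ` vsp M' x = k x ` g x ` ?j' x ` vsp M' x" by (simp add: image_image)
      also have "\<dots> = vsp N' x" using bj[OF x] ex(2)[OF x] k(2)[OF x] by (simp add: bij_betw_def)
      finally show ?thesis .
    qed
    then show "rep_epi Q M' N' ?g"
      unfolding rep_epi_def using rep_hom_compose[OF rep_hom_compose[OF j' g] k(1)] by blast
    fix x assume x: "x \<in> verts Q"
    have k0: "k x v = 0 \<longleftrightarrow> v = 0" if "v \<in> vsp N x" for v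
      using inj_on_linear_iff[OF linear_rep_subspace[OF lin(2) x] rep_hom_linear[OF k(1) x]]
        k(2)[OF x] rep_hom_0[OF lin(2) k(1) x] that by (auto simp: bij_betw_def)
    have "?f x ` vsp L' x = j x ` f x ` i x ` vsp L' x" by (simp add: image_image)
    also have "\<dots> = j x ` {v \<in> vsp M x. g x v = 0}" using i(2)[OF x] ex(3)[OF x] by (simp add: bij_betw_def)
    also have "\<dots> = {v \<in> vsp M' x. g x (?j' x v) = 0}"
    proof (intro equalityI subsetI)
      fix w assume "w \<in> {v \<in> vsp M' x. g x (?j' x v) = 0}"
      then show "w \<in> j x ` {v \<in> vsp M x. g x v = 0}"
        using j(2)[OF x] bj[OF x]
        by (intro image_eqI[of _ _ "?j' x w"]) (auto simp: bij_betw_def f_inv_into_f)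
    qed (use inv x rep_hom_in[OF j(1) x] in auto)
    also have "\<dots> = {v \<in> vsp M' x. ?g x v = 0}"
      using k0 rep_hom_in[OF g x] rep_hom_in[OF j' x] by auto
    finally show "?f x ` vsp L' x = vsp (rep_ker M' ?g) x" by (simp add: rep_ker_def)
  qed
qed

lemma short_exact_zero:
  assumes "linear_rep Q M"
  shows "short_exact Q rep_zero M M"
  unfolding short_exact_def
proof (intro exI conjI ballI)
  show "rep_mono Q rep_zero M (\<lambda>x v. 0)"
    using assms
    by (auto simp: rep_mono_def rep_zero_def amap_zero vect.subspace_0 linear_rep_subspace
        intro!: rep_homI linear_betweenI)
  show "rep_epi Q M M (\<lambda>x v. v)" by (simp add: rep_epi_def rep_hom_id)
qed (use assms in \<open>auto simp: rep_zero_def rep_ker_def vect.subspace_0 linear_rep_subspace\<close>)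


subsection \<open>Additive closures\<close>

lemma is_summandI:
  "N \<in> mod_cat Q I \<Longrightarrow> N' \<in> mod_cat Q I \<Longrightarrow> rep_iso Q M (rep_sum N N') \<Longrightarrow> is_summand Q I N M"
  by (auto simp: is_summand_def)

lemma is_summand_refl: "M \<in> mod_cat Q I \<Longrightarrow> is_summand Q I M M"
  by (rule is_summandI[OF _ mod_cat_zero]) (auto intro!: rep_iso_sym[OF _ rep_iso_sum_rep_zero(1)]
      mod_cat_linear_rep mod_cat_sum mod_cat_zero)

lemma is_summand_trans:
  assumes "is_summand Q I L M" "is_summand Q I M N"
  shows "is_summand Q I L N"
proof -
  obtain L' M' where L': "L \<in> mod_cat Q I" "L' \<in> mod_cat Q I" "rep_iso Q M (rep_sum L L')"
    and M': "M' \<in> mod_cat Q I" "rep_iso Q N (rep_sum M M')"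
    using assms by (auto simp: is_summand_def)
  have "rep_iso Q N (rep_sum L (rep_sum L' M'))"
    by (rule rep_iso_trans[OF M'(2)], rule rep_iso_trans[OF rep_iso_sum[OF L'(3) rep_iso_refl]],
        rule rep_iso_sum_assoc)
  then show ?thesis by (rule is_summandI[OF L'(1) mod_cat_sum[OF L'(2) M'(1)]])
qed

lemma is_summand_sum:
  assumes "M \<in> mod_cat Q I" "N \<in> mod_cat Q I"
  shows "is_summand Q I M (rep_sum M N)" "is_summand Q I N (rep_sum M N)"
  using assms by (auto intro: is_summandI rep_iso_refl rep_iso_sum_comm)

lemma is_summand_sum_list:
  "set Ms \<subseteq> mod_cat Q I \<Longrightarrow> M \<in> set Ms \<Longrightarrow> is_summand Q I M (rep_sum_list Ms)"
proof (induction Ms)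
  case (Cons N Ms)
  then have N: "N \<in> mod_cat Q I" "rep_sum_list Ms \<in> mod_cat Q I" by (auto intro: mod_cat_sum_list)
  show ?case
  proof (cases "M = N")
    case True
    with is_summand_sum(1)[OF N] show ?thesis by simp
  next
    case False
    with Cons have "is_summand Q I M (rep_sum_list Ms)" by simp
    with is_summand_sum(2)[OF N] show ?thesis by (simp add: is_summand_trans)
  qed
qed simp

lemma summand_imp_mod_cat: "is_summand Q I N M \<Longrightarrow> N \<in> mod_cat Q I"
  by (simp add: is_summand_def)

lemma add_cat_imp_mod_cat: "M \<in> add_cat Q I \<C> \<Longrightarrow> M \<in> mod_cat Q I"
  by (simp add: add_cat_def)

lemma add_catI:
  "X \<in> mod_cat Q I \<Longrightarrow> (\<And>N. N \<in> set Ns \<Longrightarrow> \<exists>M\<in>\<C>. is_summand Q I N M) \<Longrightarrow>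
     rep_iso Q X (rep_sum_list Ns) \<Longrightarrow> X \<in> add_cat Q I \<C>"
  by (auto simp: add_cat_def)

lemma add_cat_iso:
  "M \<in> add_cat Q I \<C> \<Longrightarrow> N \<in> mod_cat Q I \<Longrightarrow> rep_iso Q N M \<Longrightarrow> N \<in> add_cat Q I \<C>"
  unfolding add_cat_def using rep_iso_trans[of N M] by blast

lemma add_cat_summand:
  assumes M: "M \<in> \<C>" and N: "is_summand Q I N M"
  shows "N \<in> add_cat Q I \<C>"
proof (rule add_catI[where Ns = "[N]"])
  have "N \<in> mod_cat Q I" using N by (rule summand_imp_mod_cat)
  then show "rep_iso Q N (rep_sum_list [N])" "N \<in> mod_cat Q I"
    by (auto intro!: rep_iso_sym[OF _ rep_iso_sum_rep_zero(1)] mod_cat_linear_rep mod_cat_sum mod_cat_zero)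
qed (use M N in auto)

lemma add_cat_zero: "M \<in> mod_cat Q I \<Longrightarrow> (\<And>x. x \<in> verts Q \<Longrightarrow> vsp M x = {0}) \<Longrightarrow> M \<in> add_cat Q I \<C>"
  using rep_iso_zero[of M rep_zero] mod_cat_linear_rep[of M] mod_cat_linear_rep[OF mod_cat_zero]
  by (intro add_catI[where Ns = "[]"]) (simp_all add: rep_zero_def)

lemma add_cat_sum:
  assumes "M \<in> add_cat Q I \<C>" "N \<in> add_cat Q I \<C>"
  shows "rep_sum M N \<in> add_cat Q I \<C>"
proof -
  obtain Ms Ns where Ms: "\<forall>N\<in>set Ms. \<exists>M\<in>\<C>. is_summand Q I N M" "rep_iso Q M (rep_sum_list Ms)"
    and Ns: "\<forall>N\<in>set Ns. \<exists>M\<in>\<C>. is_summand Q I N M" "rep_iso Q N (rep_sum_list Ns)"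
    and MN: "M \<in> mod_cat Q I" "N \<in> mod_cat Q I"
    using assms by (auto simp: add_cat_def)
  have sub: "set Ms \<subseteq> mod_cat Q I" "set Ns \<subseteq> mod_cat Q I"
    using Ms(1) Ns(1) summand_imp_mod_cat by blast+
  then have "rep_sum_list (Ms @ Ns) \<in> mod_cat Q I" by (intro mod_cat_sum_list) auto
  then have "rep_iso Q (rep_sum M N) (rep_sum_list (Ms @ Ns))"
    using rep_iso_trans[OF rep_iso_sum[OF Ms(2) Ns(2)]
        rep_iso_sym[OF mod_cat_linear_rep rep_iso_sum_list_append[OF sub]]] by blast
  with Ms Ns MN show ?thesis by (intro add_catI[where Ns = "Ms @ Ns"] mod_cat_sum) auto
qed

lemma add_cat_mono:
  assumes X: "X \<in> add_cat Q I \<C>" and sub: "\<And>M. M \<in> \<C> \<Longrightarrow> \<exists>N\<in>\<D>. is_summand Q I M N"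
  shows "X \<in> add_cat Q I \<D>"
proof -
  obtain Ns where Ns: "\<forall>N\<in>set Ns. \<exists>M\<in>\<C>. is_summand Q I N M" "rep_iso Q X (rep_sum_list Ns)"
    and "X \<in> mod_cat Q I"
    using X by (auto simp: add_cat_def)
  moreover have "\<exists>M\<in>\<D>. is_summand Q I N M" if N: "N \<in> set Ns" for N
  proof -
    obtain M where M: "M \<in> \<C>" "is_summand Q I N M" using Ns(1) N by blast
    obtain L where "L \<in> \<D>" "is_summand Q I M L" using sub[OF M(1)] by blast
    with M(2) show ?thesis using is_summand_trans by blast
  qed
  ultimately show ?thesis by (intro add_catI)
qed

end


section \<open>Radicals and projective covers\<close>

text \<open>
  The component at \<open>x\<close> of \<open>M J\<close>, where \<open>J\<close> is the arrow ideal.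
\<close>

definition rad :: "('v, 'a) quiver \<Rightarrow> ('v, 'a, 'k::field) rep \<Rightarrow> 'v \<Rightarrow> 'k vect set" where
  "rad Q M x = vect.span (\<Union>a\<in>{a \<in> arcs Q. head Q a = x}. amap M a ` vsp M (tail Q a))"

context bound_quiver_algebra
begin

lemma path_map_append: "walk x p y \<Longrightarrow> path_map M (x, p @ q) v = path_map M (y, q) (path_map M (x, p) v)"
  by (simp add: path_map_def)

lemma single_path_mult:
  assumes "walk x p (tail Q a)"
  shows "path_mult Q (Poly_Mapping.single (x, p) 1) (arrow_elt Q a)
    = (Poly_Mapping.single (x, p @ [a]) 1 :: ('v, 'a) path \<Rightarrow>\<^sub>0 'k)"
  using path_end_walk[OF assms] by (simp add: path_mult_def arrow_elt_def)

lemma single_path_in_ideal_power: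
  "walk x p y \<Longrightarrow> (Poly_Mapping.single (x, p) 1 :: ('v, 'a) path \<Rightarrow>\<^sub>0 'k)
     \<in> ideal_power (path_algebra Q) (arrow_ideal Q) (length p)"
proof (induction p arbitrary: y rule: rev_induct)
  case Nil
  then show ?case
    by (auto simp: path_algebra_def paths_def path_end_def pre_digraph.awalk_verts.simps)
next
  case (snoc a p)
  then have w: "walk x p (tail Q a)" and a: "a \<in> arcs Q" by auto
  have "(arrow_elt Q a :: ('v, 'a) path \<Rightarrow>\<^sub>0 'k) \<in> arrow_ideal Q"
    using a by (auto simp: arrow_ideal_def genideal_def)
  from ideal_prod.prod[OF snoc.IH[OF w] this, of "path_algebra Q"]
  show ?case using single_path_mult[OF w] by (simp add: path_algebra_def)
qed

lemma path_relation_acts_as_zero: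
  assumes rel: "(Poly_Mapping.single (x, p) 1 :: ('v, 'a) path \<Rightarrow>\<^sub>0 'k) \<in> I"
    and w: "walk x p y" and M: "M \<in> mod_cat Q I" and v: "v \<in> vsp M x"
  shows "path_map M (x, p) v = 0"
proof -
  from mod_cat_relation[OF M rel, of x y v] show ?thesis
    using walk_verts[OF w] path_end_walk[OF w] v by simp
qed

text \<open>
  The ideal of relations contains a power of the arrow ideal, hence all long paths; the bound on their
  length does not depend on the module.
\<close>

lemma long_paths_act_as_zero:
  obtains m where "\<And>M x p y v. M \<in> mod_cat Q I \<Longrightarrow> walk x p y \<Longrightarrow> m \<le> length p \<Longrightarrow> v \<in> vsp M x \<Longrightarrow>
    path_map M (x, p) v = 0"
proof -
  obtain m where m: "ideal_power (path_algebra Q) (arrow_ideal Q) m \<subseteq> I"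
    using bound by (auto simp: bound_quiver_def admissible_def)
  have "path_map M (x, p) v = 0"
    if M: "M \<in> mod_cat Q I" and w: "walk x p y" and len: "m \<le> length p" and v: "v \<in> vsp M x" for M x p y v
  proof -
    define q r where "q = take m p" and "r = drop m p"
    have p: "p = q @ r" and "length q = m" using len by (auto simp: q_def r_def)
    from w p obtain z where q: "walk x q z" and r: "walk z r y" by (auto simp: walk_append)
    have rel: "(Poly_Mapping.single (x, q) 1 :: ('v, 'a) path \<Rightarrow>\<^sub>0 'k) \<in> I"
      using single_path_in_ideal_power[OF q] m \<open>length q = m\<close> by auto
    have "path_map M (x, q) v = 0" by (rule path_relation_acts_as_zero[OF rel q M v])
    then show ?thesis
      using linear_between_zero[OF linear_rep_subspace[OF mod_cat_linear_rep[OF M]]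
          linear_path_map[OF mod_cat_linear_rep[OF M] r]] walk_verts[OF r]
      by (simp add: p path_map_append[OF q])
  qed
  with that show ?thesis by blast
qed

lemma subspace_rad: "vect.subspace (rad Q M x)"
  by (simp add: rad_def)

lemma amap_in_rad: "a \<in> arcs Q \<Longrightarrow> v \<in> vsp M (tail Q a) \<Longrightarrow> amap M a v \<in> rad Q M (head Q a)"
  unfolding rad_def by (rule vect.span_base) blast

lemma rad_minimal:
  "vect.subspace U \<Longrightarrow> (\<And>a v. a \<in> arcs Q \<Longrightarrow> head Q a = x \<Longrightarrow> v \<in> vsp M (tail Q a) \<Longrightarrow> amap M a v \<in> U) \<Longrightarrow>
     rad Q M x \<subseteq> U"
  unfolding rad_def by (rule vect.span_minimal) blast+

lemma rad_subset: "linear_rep Q M \<Longrightarrow> x \<in> verts Q \<Longrightarrow> rad Q M x \<subseteq> vsp M x"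
  using amap_in[of M] by (intro rad_minimal linear_rep_subspace) auto

lemma rep_hom_rad:
  assumes M: "linear_rep Q M" and f: "rep_hom Q M N f" and x: "x \<in> verts Q" and v: "v \<in> rad Q M x"
  shows "f x v \<in> rad Q N x"
proof -
  have "rad Q M x \<subseteq> {v \<in> vsp M x. f x v \<in> rad Q N x}"
  proof (rule rad_minimal)
    show "vect.subspace {v \<in> vsp M x. f x v \<in> rad Q N x}"
      by (rule subspace_linear_preimage[OF linear_rep_subspace[OF M x] rep_hom_linear[OF f x] subspace_rad])
    fix a v assume a: "a \<in> arcs Q" and hd: "head Q a = x" and v: "v \<in> vsp M (tail Q a)"
    show "amap M a v \<in> {v \<in> vsp M x. f x v \<in> rad Q N x}"
      using amap_in[OF M a v] rep_hom_amap[OF f a v] amap_in_rad[OF a rep_hom_in[OF f tail_in[OF a] v]]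
      by (simp add: hd)
  qed
  with v show ?thesis by blast
qed

lemma path_map_in_rad:
  assumes M: "linear_rep Q M" and w: "walk x p y" and p: "p \<noteq> []" and v: "v \<in> vsp M x"
  shows "path_map M (x, p) v \<in> rad Q M y"
proof -
  obtain q a where q: "p = q @ [a]" using p by (metis rev_exhaust)
  with w have "walk x q (tail Q a)" "a \<in> arcs Q" "head Q a = y" by auto
  then show ?thesis using amap_in_rad[OF _ path_map_in[OF M _ v]] q by auto
qed

lemma in_rad_sum:
  assumes M: "linear_rep Q M" and N: "linear_rep Q N" and x: "x \<in> verts Q"
  shows "w \<in> rad Q (rep_sum M N) x \<longleftrightarrow> vfst w \<in> rad Q M x \<and> vsnd w \<in> rad Q N x"
proof
  assume "w \<in> rad Q (rep_sum M N) x"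
  then show "vfst w \<in> rad Q M x \<and> vsnd w \<in> rad Q N x"
    using rep_hom_rad[OF linear_rep_sum[OF M N] rep_hom_fst x]
      rep_hom_rad[OF linear_rep_sum[OF M N] rep_hom_snd x] by blast
next
  assume w: "vfst w \<in> rad Q M x \<and> vsnd w \<in> rad Q N x"
  then have "vpair (vfst w) 0 + vpair 0 (vsnd w) \<in> rad Q (rep_sum M N) x"
    using rep_hom_rad[OF M rep_hom_inl[OF N] x] rep_hom_rad[OF N rep_hom_inr[OF M] x]
    by (intro vect.subspace_add subspace_rad) auto
  then show "w \<in> rad Q (rep_sum M N) x" by (simp add: vpair_add)
qed

text \<open>
  Nakayama's lemma. Modulo a submodule \<open>L\<close> with \<open>L + rad M = M\<close> every vector is a combination of
  values of longer and longer paths, and long paths act as zero.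
\<close>

lemma nakayama:
  assumes M: "M \<in> mod_cat Q I" and L: "subrep Q M L"
    and gen: "\<And>x v. x \<in> verts Q \<Longrightarrow> v \<in> vsp M x \<Longrightarrow> \<exists>l\<in>L x. v - l \<in> rad Q M x"
    and x: "x \<in> verts Q"
  shows "L x = vsp M x"
proof -
  note lin = mod_cat_linear_rep[OF M]
  have subL: "vect.subspace (L x)" "L x \<subseteq> vsp M x" if "x \<in> verts Q" for x
    using L that by (auto simp: subrep_def)
  have path_L: "path_map M (x, p) l \<in> L y" if "walk x p y" "l \<in> L x" for x p y l
    using that
  proof (induction p arbitrary: x l)
    case (Cons a p)
    then have "amap M a l \<in> L (head Q a)" using subrep_amap[OF L] by simp
    with Cons show ?case by simp
  qed simp
  obtain m where m: "\<And>M x p y v. M \<in> mod_cat Q I \<Longrightarrow> walk x p y \<Longrightarrow> m \<le> length p \<Longrightarrow> v \<in> vsp M x \<Longrightarrow>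
      path_map M (x, p) v = 0"
    using long_paths_act_as_zero by blast
  \<comment> \<open>Induction on how much shorter than \<open>m\<close> the path is; \<open>k = m\<close> admits the trivial path.\<close>
  have step: "path_map M (x, p) v \<in> L y" if "walk x p y" "v \<in> vsp M x" "m - k \<le> length p" for k x p y v
    using that
  proof (induction k arbitrary: x p y v)
    case 0
    then have zero: "path_map M (x, p) v = 0" by (intro m[OF M, of x p y v]) auto
    show ?case
      unfolding zero using walk_verts[OF 0(1)] by (intro vect.subspace_0[OF subL(1)]) simp
  next
    case (Suc k)
    note y = walk_verts[OF Suc.prems(1)]
    obtain l where l: "l \<in> L x" "v - l \<in> rad Q M x" using gen Suc.prems y by blast
    have lp: "linear_between (vsp M x) (vsp M y) (path_map M (x, p))"
      by (rule linear_path_map[OF lin Suc.prems(1)])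
    have "rad Q M x \<subseteq> {v \<in> vsp M x. path_map M (x, p) v \<in> L y}"
    proof (rule rad_minimal)
      show "vect.subspace {v \<in> vsp M x. path_map M (x, p) v \<in> L y}"
        using y by (intro subspace_linear_preimage[OF linear_rep_subspace[OF lin] lp] subL(1)) auto
      fix a w assume a: "a \<in> arcs Q" and hd: "head Q a = x" and w: "w \<in> vsp M (tail Q a)"
      have "path_map M (tail Q a, a # p) w \<in> L y"
        using a hd w Suc.prems by (intro Suc.IH) auto
      then show "amap M a w \<in> {v \<in> vsp M x. path_map M (x, p) v \<in> L y}"
        using amap_in[OF lin a w] hd by simp
    qed
    then have "path_map M (x, p) (v - l) \<in> L y" using l(2) by blast
    moreover have "path_map M (x, p) l \<in> L y" using path_L Suc.prems(1) l(1) by blast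
    ultimately have "path_map M (x, p) (v - l) + path_map M (x, p) l \<in> L y"
      by (rule vect.subspace_add[OF subL(1)[OF conjunct2[OF y]]])
    moreover have "path_map M (x, p) v = path_map M (x, p) (v - l) + path_map M (x, p) l"
      using linear_between_diff[OF linear_rep_subspace[OF lin] lp, of v l] y Suc.prems l(1) subL(2)[of x]
      by auto
    ultimately show ?case by metis
  qed
  have "vsp M x \<subseteq> L x" using step[of x "[]" x _ m] x by auto
  with subL(2)[OF x] show ?thesis by blast
qed

lemma subrep_image:
  assumes M: "linear_rep Q M" and f: "rep_hom Q M N f"
  shows "subrep Q N (\<lambda>x. f x ` vsp M x)"
proof (rule subrepI)
  show "vect.subspace (f x ` vsp M x)" if "x \<in> verts Q" for x
    by (rule subspace_linear_image[OF linear_rep_subspace[OF M that] rep_hom_linear[OF f that]])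
  show "f x ` vsp M x \<subseteq> vsp N x" if "x \<in> verts Q" for x
    using rep_hom_in[OF f that] by blast
  fix a v assume a: "a \<in> arcs Q" and "v \<in> f (tail Q a) ` vsp M (tail Q a)"
  then obtain u where u: "u \<in> vsp M (tail Q a)" "v = f (tail Q a) u" by blast
  then have "amap N a v = f (head Q a) (amap M a u)" using rep_hom_amap[OF f a] by simp
  then show "amap N a v \<in> f (head Q a) ` vsp M (head Q a)" using amap_in[OF M a u(1)] by blast
qed

lemma nakayama_epi:
  assumes M: "linear_rep Q M" and N: "N \<in> mod_cat Q I" and f: "rep_hom Q M N f"
    and gen: "\<And>x v. x \<in> verts Q \<Longrightarrow> v \<in> vsp N x \<Longrightarrow> \<exists>u\<in>vsp M x. v - f x u \<in> rad Q N x"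
  shows "rep_epi Q M N f"
proof -
  have "\<exists>l\<in>f x ` vsp M x. v - l \<in> rad Q N x" if "x \<in> verts Q" "v \<in> vsp N x" for x v
    using gen[OF that] by blast
  then have "f x ` vsp M x = vsp N x" if "x \<in> verts Q" for x
    using nakayama[OF N subrep_image[OF M f] _ that] by blast
  with f show ?thesis by (simp add: rep_epi_def)
qed

text \<open>
  A submodule \<open>K\<close> not contained in the radical is not superfluous: a hyperplane that contains the
  radical but not \<open>K\<close> at one vertex, together with everything at the other vertices, is a proper
  submodule, and its sum with \<open>K\<close> is \<open>P\<close>. The converse is Nakayama's lemma.
\<close>

lemma superfluous_iff_subset_rad:
  assumes P: "P \<in> mod_cat Q I" and K: "subrep Q P K"
  shows "(\<forall>L. subrep Q P L \<and> (\<forall>x\<in>verts Q. {l + k | l k. l \<in> L x \<and> k \<in> K x} = vsp P x) \<longrightarrow>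
            (\<forall>x\<in>verts Q. L x = vsp P x)) \<longleftrightarrow>
         (\<forall>x\<in>verts Q. K x \<subseteq> rad Q P x)" (is "?superfluous \<longleftrightarrow> _")
proof (intro iffI allI impI ballI)
  note lin = mod_cat_linear_rep[OF P]
  fix x assume superfluous: ?superfluous and x: "x \<in> verts Q"
  show "K x \<subseteq> rad Q P x"
  proof
    fix v assume v: "v \<in> K x"
    show "v \<in> rad Q P x"
    proof (rule ccontr)
      assume v_rad: "v \<notin> rad Q P x"
      have vP: "v \<in> vsp P x" using K x v by (auto simp: subrep_def)
      obtain B0 where B0: "B0 \<subseteq> rad Q P x" "vect.independent B0" "rad Q P x \<subseteq> vect.span B0"
        using vect.maximal_independent_subset by blast
      have "vect.span B0 \<subseteq> rad Q P x" using B0(1) subspace_rad by (rule vect.span_minimal)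
      then have ind: "vect.independent (insert v B0)"
        using v_rad B0(2) by (intro vect.independent_insertI) auto
      have sub: "insert v B0 \<subseteq> vsp P x" using B0(1) rad_subset[OF lin x] vP by blast
      obtain B where B: "insert v B0 \<subseteq> B" "B \<subseteq> vsp P x" "vect.independent B" "vsp P x \<subseteq> vect.span B"
        using vect.maximal_independent_subset_extend[OF sub ind] by blast
      define H where "H = vect.span (B - {v})"
      have vH: "v \<notin> H" using B(1,3) by (auto simp: H_def vect.dependent_def)
      have HP: "H \<subseteq> vsp P x"
        unfolding H_def using B(2) by (intro vect.span_minimal linear_rep_subspace[OF lin x]) auto
      have "B0 \<subseteq> B - {v}" using B(1) B0(1) v_rad by blast
      then have radH: "rad Q P x \<subseteq> H" unfolding H_def using B0(3) vect.span_mono by blast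
      define L where "L = (vsp P)(x := H)"
      have "subrep Q P L"
      proof (rule subrepI)
        show "vect.subspace (L y)" if "y \<in> verts Q" for y
          using linear_rep_subspace[OF lin that] by (simp add: L_def H_def)
        show "L y \<subseteq> vsp P y" for y using HP by (simp add: L_def)
        fix a w assume a: "a \<in> arcs Q" and "w \<in> L (tail Q a)"
        then have "w \<in> vsp P (tail Q a)" using HP by (auto simp: L_def split: if_splits)
        then show "amap P a w \<in> L (head Q a)"
          using amap_in_rad[OF a] amap_in[OF lin a] radH by (auto simp: L_def)
      qed
      moreover have "{l + k | l k. l \<in> L y \<and> k \<in> K y} = vsp P y" if y: "y \<in> verts Q" for y
      proof (intro equalityI subsetI)
        fix w assume "w \<in> {l + k | l k. l \<in> L y \<and> k \<in> K y}"
        then obtain l k where "w = l + k" "l \<in> vsp P y" "k \<in> vsp P y"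
          using subrep_subset[OF K y] HP by (auto simp: L_def split: if_splits)
        then show "w \<in> vsp P y"
          using vect.subspace_add[OF linear_rep_subspace[OF lin y]] by simp
      next
        fix w assume w: "w \<in> vsp P y"
        have subK: "vect.subspace (K y)" using K y by (simp add: subrep_def)
        show "w \<in> {l + k | l k. l \<in> L y \<and> k \<in> K y}"
        proof (cases "y = x")
          case True
          have "w \<in> vect.span (insert v (B - {v}))"
            using w B(1,4) True by (simp add: insert_absorb) blast
          then obtain c where "w - vscale c v \<in> H" unfolding H_def vect.span_breakdown_eq by blast
          moreover have "vscale c v \<in> K y" using vect.subspace_scale[OF subK] v True by simp
          moreover have "w = (w - vscale c v) + vscale c v" by simp
          moreover have "L y = H" using True by (simp add: L_def)
          ultimately show ?thesis by blast
        next
          case False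
          then have "w \<in> L y" "0 \<in> K y" "w = w + 0"
            using w vect.subspace_0[OF subK] by (simp_all add: L_def)
          then show ?thesis by blast
        qed
      qed
      ultimately have "L x = vsp P x" using superfluous x by blast
      with vP vH show False by (simp add: L_def)
    qed
  qed
next
  fix L x assume K_rad: "\<forall>x\<in>verts Q. K x \<subseteq> rad Q P x"
    and L: "subrep Q P L \<and> (\<forall>x\<in>verts Q. {l + k | l k. l \<in> L x \<and> k \<in> K x} = vsp P x)"
    and x: "x \<in> verts Q"
  have gen: "\<exists>l\<in>L y. v - l \<in> rad Q P y" if "y \<in> verts Q" "v \<in> vsp P y" for y v
  proof -
    have "v \<in> {l + k | l k. l \<in> L y \<and> k \<in> K y}" using L that by blast
    then obtain l k where "l \<in> L y" "k \<in> K y" "v = l + k" by blast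
    with K_rad that show ?thesis by (intro bexI[of _ l]) auto
  qed
  show "L x = vsp P x" using nakayama[OF P conjunct1[OF L] gen x] by blast
qed

lemma projective_imp_mod_cat: "projective Q I P \<Longrightarrow> P \<in> mod_cat Q I"
  by (simp add: projective_def)

lemma projective_lift:
  assumes "projective Q I P" "X \<in> mod_cat Q I" "Y \<in> mod_cat Q I" "rep_epi Q X Y g" "rep_hom Q P Y f"
  obtains h where "rep_hom Q P X h" "\<And>x v. x \<in> verts Q \<Longrightarrow> v \<in> vsp P x \<Longrightarrow> g x (h x v) = f x v"
  using assms unfolding projective_def by blast

text \<open>
  The condition on the kernel is checked vertex by vertex. This makes it easy to transfer to direct
  sums and to other quivers, unlike a condition on all submodules.
\<close>

lemma projective_cover_iff:
  assumes M: "linear_rep Q M"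
  shows "projective_cover Q I M P f \<longleftrightarrow>
     projective Q I P \<and> rep_epi Q P M f \<and> (\<forall>x\<in>verts Q. \<forall>v\<in>vsp P x. f x v = 0 \<longrightarrow> v \<in> rad Q P x)"
proof (cases "projective Q I P \<and> rep_epi Q P M f")
  case True
  then have P: "P \<in> mod_cat Q I" and f: "rep_hom Q P M f"
    by (auto simp: projective_imp_mod_cat rep_epi_def)
  have ker: "(\<forall>x\<in>verts Q. vsp (rep_ker P f) x \<subseteq> rad Q P x) \<longleftrightarrow>
      (\<forall>x\<in>verts Q. \<forall>v\<in>vsp P x. f x v = 0 \<longrightarrow> v \<in> rad Q P x)"
    by (auto simp: rep_ker_def)
  show ?thesis
    unfolding projective_cover_def
      superfluous_iff_subset_rad[OF P subrep_ker[OF mod_cat_linear_rep[OF P] M f]] ker ..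
next
  case False
  then show ?thesis unfolding projective_cover_def by blast
qed

lemma projective_zero:
  assumes "P \<in> mod_cat Q I" "\<And>x. x \<in> verts Q \<Longrightarrow> vsp P x = {0}"
  shows "projective Q I P"
  unfolding projective_def
proof (intro conjI ballI allI impI)
  fix X Y g f assume X: "X \<in> mod_cat Q I" and "Y \<in> mod_cat Q I" and gf: "rep_epi Q X Y g \<and> rep_hom Q P Y f"
  note lin = mod_cat_linear_rep[OF X] mod_cat_linear_rep[OF assms(1)]
  have "rep_hom Q P X (\<lambda>x v. 0)"
    using lin linear_rep_subspace[OF lin(1)]
    by (intro rep_homI linear_between_const_0) (auto simp: amap_zero)
  moreover have "g x 0 = f x v" if "x \<in> verts Q" "v \<in> vsp P x" for x v
    using rep_hom_0[OF lin(1) rep_epi_hom] rep_hom_0[OF lin(2)] gf that assms(2) by auto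
  ultimately show "\<exists>h. rep_hom Q P X h \<and> (\<forall>x\<in>verts Q. \<forall>v\<in>vsp P x. g x (h x v) = f x v)" by blast
qed (use assms in simp)

lemma projective_sum:
  assumes P: "projective Q I P" and P': "projective Q I P'"
  shows "projective Q I (rep_sum P P')"
  unfolding projective_def
proof (intro conjI ballI allI impI)
  note mods = projective_imp_mod_cat[OF P] projective_imp_mod_cat[OF P']
  note lins = mod_cat_linear_rep[OF mods(1)] mod_cat_linear_rep[OF mods(2)]
  show "rep_sum P P' \<in> mod_cat Q I" using mods by (rule mod_cat_sum)
  fix X Y g f assume X: "X \<in> mod_cat Q I" and Y: "Y \<in> mod_cat Q I"
    and gf: "rep_epi Q X Y g \<and> rep_hom Q (rep_sum P P') Y f"
  have f: "rep_hom Q (rep_sum P P') Y f" and g: "rep_hom Q X Y g" using gf by (auto simp: rep_epi_def)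
  obtain h where h: "rep_hom Q P X h" "\<And>x v. x \<in> verts Q \<Longrightarrow> v \<in> vsp P x \<Longrightarrow> g x (h x v) = f x (vpair v 0)"
    using projective_lift[OF P X Y _ rep_hom_compose[OF rep_hom_inl[OF lins(2)] f]] gf by blast
  obtain h' where h': "rep_hom Q P' X h'" "\<And>x v. x \<in> verts Q \<Longrightarrow> v \<in> vsp P' x \<Longrightarrow> g x (h' x v) = f x (vpair 0 v)"
    using projective_lift[OF P' X Y _ rep_hom_compose[OF rep_hom_inr[OF lins(1)] f]] gf by blast
  have "g x (h x (vfst w) + h' x (vsnd w)) = f x w" if x: "x \<in> verts Q" and w: "w \<in> vsp (rep_sum P P') x" for x w
  proof -
    have uv: "vfst w \<in> vsp P x" "vsnd w \<in> vsp P' x" using w by (auto simp: in_vsp_rep_sum)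
    have "g x (h x (vfst w) + h' x (vsnd w)) = g x (h x (vfst w)) + g x (h' x (vsnd w))"
      by (rule linear_between_add[OF rep_hom_linear[OF g x] rep_hom_in[OF h(1) x uv(1)] rep_hom_in[OF h'(1) x uv(2)]])
    also have "\<dots> = f x (vpair (vfst w) 0) + f x (vpair 0 (vsnd w))"
      using h(2)[OF x uv(1)] h'(2)[OF x uv(2)] by simp
    also have "\<dots> = f x (vpair (vfst w) 0 + vpair 0 (vsnd w))"
      using uv linear_rep_subspace[OF lins(1) x] linear_rep_subspace[OF lins(2) x]
      by (intro linear_between_add[OF rep_hom_linear[OF f x], symmetric])
        (auto simp: in_vsp_rep_sum vect.subspace_0)
    finally show ?thesis by (simp add: vpair_add)
  qed
  then show "\<exists>h. rep_hom Q (rep_sum P P') X h \<and> (\<forall>x\<in>verts Q. \<forall>v\<in>vsp (rep_sum P P') x. g x (h x v) = f x v)"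
    using rep_hom_copair[OF h(1) h'(1) mod_cat_linear_rep[OF X]] by blast
qed

text \<open>
  Projective covers are unique. The lift \<open>h\<close> of the isomorphism is onto by Nakayama's lemma, hence has
  a section \<open>s\<close>, which is onto for the same reason; so \<open>h\<close> is bijective.
\<close>

lemma projective_cover_unique:
  assumes M: "M \<in> mod_cat Q I" and M': "M' \<in> mod_cat Q I" and iso: "rep_iso Q M M'"
    and cov: "projective_cover Q I M P f" and cov': "projective_cover Q I M' P' f'"
  shows "rep_iso Q (rep_ker P f) (rep_ker P' f')"
proof -
  note linM = mod_cat_linear_rep[OF M] and linM' = mod_cat_linear_rep[OF M']
  have P: "projective Q I P" and f: "rep_epi Q P M f"
    and ker: "\<And>x v. x \<in> verts Q \<Longrightarrow> v \<in> vsp P x \<Longrightarrow> f x v = 0 \<Longrightarrow> v \<in> rad Q P x"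
    using cov unfolding projective_cover_iff[OF linM] by auto
  have P': "projective Q I P'" and f': "rep_epi Q P' M' f'"
    and ker': "\<And>x v. x \<in> verts Q \<Longrightarrow> v \<in> vsp P' x \<Longrightarrow> f' x v = 0 \<Longrightarrow> v \<in> rad Q P' x"
    using cov' unfolding projective_cover_iff[OF linM'] by auto
  note mP = projective_imp_mod_cat[OF P] and mP' = projective_imp_mod_cat[OF P']
  note lP = mod_cat_linear_rep[OF mP] and lP' = mod_cat_linear_rep[OF mP']
  note hf = rep_epi_hom[OF f] and hf' = rep_epi_hom[OF f']
  obtain t where t: "rep_hom Q M M' t" "\<And>x. x \<in> verts Q \<Longrightarrow> bij_betw (t x) (vsp M x) (vsp M' x)"
    using rep_isoE[OF iso] by blast
  have t0: "t x v = 0 \<longleftrightarrow> v = 0" if "x \<in> verts Q" "v \<in> vsp M x" for x v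
    using inj_on_linear_iff[OF linear_rep_subspace[OF linM that(1)] rep_hom_linear[OF t(1) that(1)]]
      t(2)[OF that(1)] rep_hom_0[OF linM t(1) that(1)] that(2) by (auto simp: bij_betw_def)
  obtain h where h: "rep_hom Q P P' h" "\<And>x v. x \<in> verts Q \<Longrightarrow> v \<in> vsp P x \<Longrightarrow> f' x (h x v) = t x (f x v)"
    using projective_lift[OF P mP' M' f' rep_hom_compose[OF hf t(1)]] by blast
  have h_epi: "rep_epi Q P P' h"
  proof (rule nakayama_epi[OF lP mP' h(1)])
    fix x v assume x: "x \<in> verts Q" and v: "v \<in> vsp P' x"
    have "f' x v \<in> t x ` f x ` vsp P x"
      using rep_epi_image[OF f x] t(2)[OF x] rep_hom_in[OF hf' x v] by (simp add: bij_betw_def)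
    then obtain u where u: "u \<in> vsp P x" "f' x v = f' x (h x u)" using h(2)[OF x] by auto
    have hu: "h x u \<in> vsp P' x" by (rule rep_hom_in[OF h(1) x u(1)])
    have "f' x (v - h x u) = 0" using rep_hom_diff[OF lP' hf' x v hu] u(2) by simp
    moreover have "v - h x u \<in> vsp P' x"
      by (rule vect.subspace_diff[OF linear_rep_subspace[OF lP' x] v hu])
    ultimately show "\<exists>u\<in>vsp P x. v - h x u \<in> rad Q P' x" using ker'[OF x] u(1) by blast
  qed
  obtain s where s: "rep_hom Q P' P s" "\<And>x v. x \<in> verts Q \<Longrightarrow> v \<in> vsp P' x \<Longrightarrow> h x (s x v) = v"
    using projective_lift[OF P' mP mP' h_epi rep_hom_id] by blast
  have s_epi: "rep_epi Q P' P s"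
  proof (rule nakayama_epi[OF lP' mP s(1)])
    fix x v assume x: "x \<in> verts Q" and v: "v \<in> vsp P x"
    have hv: "h x v \<in> vsp P' x" by (rule rep_hom_in[OF h(1) x v])
    have shv: "s x (h x v) \<in> vsp P x" by (rule rep_hom_in[OF s(1) x hv])
    have d: "v - s x (h x v) \<in> vsp P x"
      by (rule vect.subspace_diff[OF linear_rep_subspace[OF lP x] v shv])
    have "h x (v - s x (h x v)) = 0"
      using rep_hom_diff[OF lP h(1) x v shv] s(2)[OF x hv] by simp
    then have "t x (f x (v - s x (h x v))) = 0"
      using h(2)[OF x d] rep_hom_0[OF lP' hf' x] by simp
    then have "f x (v - s x (h x v)) = 0" using t0[OF x rep_hom_in[OF hf x d]] by simp
    then show "\<exists>u\<in>vsp P' x. v - s x u \<in> rad Q P x" using ker[OF x d] hv by blast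
  qed
  have bij: "bij_betw (h x) (vsp P x) (vsp P' x)" if x: "x \<in> verts Q" for x
    unfolding bij_betw_def
  proof
    show "h x ` vsp P x = vsp P' x" by (rule rep_epi_image[OF h_epi x])
    show "inj_on (h x) (vsp P x)"
    proof (rule inj_onI)
      fix u v assume "u \<in> vsp P x" "v \<in> vsp P x" and eq: "h x u = h x v"
      then obtain u' v' where "u' \<in> vsp P' x" "u = s x u'" "v' \<in> vsp P' x" "v = s x v'"
        using rep_epi_image[OF s_epi x] by blast
      with eq s(2)[OF x] show "u = v" by metis
    qed
  qed
  show ?thesis
  proof (rule rep_isoI)
    have ker_iff: "f' x (h x v) = 0 \<longleftrightarrow> f x v = 0" if "x \<in> verts Q" "v \<in> vsp P x" for x v
      using h(2)[OF that] t0[OF that(1) rep_hom_in[OF hf that]] by simp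
    show b: "bij_betw (h x) (vsp (rep_ker P f) x) (vsp (rep_ker P' f') x)" if x: "x \<in> verts Q" for x
    proof (rule bij_betw_subset[OF bij[OF x]])
      show "h x ` vsp (rep_ker P f) x = vsp (rep_ker P' f') x"
      proof (intro equalityI subsetI)
        fix w assume "w \<in> vsp (rep_ker P' f') x"
        then have w: "w \<in> vsp P' x" "f' x w = 0" by (auto simp: rep_ker_def)
        then obtain v where "v \<in> vsp P x" "w = h x v" using rep_epi_image[OF h_epi x] by blast
        with w ker_iff[OF x] show "w \<in> h x ` vsp (rep_ker P f) x" by (auto simp: rep_ker_def)
      qed (use ker_iff[OF x] rep_hom_in[OF h(1) x] in \<open>auto simp: rep_ker_def\<close>)
    qed (simp add: rep_ker_def)
    show "rep_hom Q (rep_ker P f) (rep_ker P' f') h"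
    proof (rule rep_homI)
      show "linear_between (vsp (rep_ker P f) x) (vsp (rep_ker P' f') x) (h x)" if x: "x \<in> verts Q" for x
        using b[OF x] by (intro linear_between_restrict[OF rep_hom_linear[OF h(1) x]])
          (auto simp: bij_betw_def rep_ker_def)
    qed (use rep_hom_amap[OF h(1)] in \<open>auto simp: rep_ker_def\<close>)
  qed
qed

end


section \<open>Existence of projective covers\<close>

context bound_quiver_algebra
begin

definition generated_by :: "('v, 'a, 'k) rep \<Rightarrow> 'v \<Rightarrow> 'k vect \<Rightarrow> 'v \<Rightarrow> 'k vect set" where
  "generated_by M x v y = vect.span {path_map M (x, p) v | p. walk x p y}"

lemma path_map_vsp_update [simp]: "path_map (M\<lparr>vsp := L\<rparr>) p v = path_map M p v"
  by (simp add: path_map_def)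

lemma generated_by_minimal:
  assumes L: "subrep Q M L" and v: "v \<in> L x"
  shows "y \<in> verts Q \<Longrightarrow> generated_by M x v y \<subseteq> L y"
proof -
  have "path_map M (x, p) v \<in> L y" if "walk x p y" for p y
    using that v
  proof (induction p arbitrary: y rule: rev_induct)
    case (snoc a p)
    then have "a \<in> arcs Q" "path_map M (x, p) v \<in> L (tail Q a)" "head Q a = y" by auto
    then show ?case using subrep_amap[OF L] by auto
  qed simp
  then show "y \<in> verts Q \<Longrightarrow> generated_by M x v y \<subseteq> L y"
    unfolding generated_by_def using subrep_subspace[OF L] by (intro vect.span_minimal) auto
qed

lemma path_map_in_generated_by: "walk x p y \<Longrightarrow> path_map M (x, p) v \<in> generated_by M x v y"
  unfolding generated_by_def by (rule vect.span_base) blast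

lemma in_generated_by: "x \<in> verts Q \<Longrightarrow> v \<in> generated_by M x v x"
  using path_map_in_generated_by[of x "[]" x M v] by simp

lemma subrep_generated_by:
  assumes M: "linear_rep Q M" and v: "v \<in> vsp M x"
  shows "subrep Q M (generated_by M x v)"
proof (rule subrepI)
  let ?S = "\<lambda>y. {path_map M (x, p) v | p. walk x p y}"
  have sub: "?S y \<subseteq> vsp M y" for y using path_map_in[OF M _ v] by blast
  show "vect.subspace (generated_by M x v y)" for y by (simp add: generated_by_def)
  show "generated_by M x v y \<subseteq> vsp M y" if "y \<in> verts Q" for y
    unfolding generated_by_def using sub linear_rep_subspace[OF M that] by (rule vect.span_minimal)
  fix a w assume a: "a \<in> arcs Q" and w: "w \<in> generated_by M x v (tail Q a)"
  have "amap M a ` vect.span (?S (tail Q a)) = vect.span (amap M a ` ?S (tail Q a))"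
    by (rule linear_image_span[OF linear_rep_subspace[OF M tail_in[OF a]] linear_rep_amap[OF M a] sub])
  also have "\<dots> \<subseteq> vect.span (?S (head Q a))"
  proof (rule vect.span_mono, safe)
    fix p assume "walk x p (tail Q a)"
    with a have "walk x (p @ [a]) (head Q a)" by simp
    then show "\<exists>q. amap M a (path_map M (x, p) v) = path_map M (x, q) v \<and> walk x q (head Q a)"
      using path_map_snoc by metis
  qed
  finally show "amap M a w \<in> generated_by M x v (head Q a)"
    using w by (auto simp: generated_by_def)
qed

text \<open>
  A cyclic module is spanned by the images of its generator under the finitely many short paths.
\<close>

lemma dim_generated_by_bounded:
  obtains K where "\<And>M x v y. M \<in> mod_cat Q I \<Longrightarrow> v \<in> vsp M x \<Longrightarrow> vect.dim (generated_by M x v y) \<le> K"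
proof -
  obtain m where m: "\<And>M x p y v. M \<in> mod_cat Q I \<Longrightarrow> walk x p y \<Longrightarrow> m \<le> length p \<Longrightarrow> v \<in> vsp M x \<Longrightarrow>
      path_map M (x, p) v = 0"
    using long_paths_act_as_zero by blast
  define W where "W = {p. set p \<subseteq> arcs Q \<and> length p \<le> m}"
  have W: "finite W" unfolding W_def by (rule finite_lists_length_le) simp
  have "vect.dim (generated_by M x v y) \<le> card W" if M: "M \<in> mod_cat Q I" and v: "v \<in> vsp M x" for M x v y
  proof -
    let ?S = "{path_map M (x, p) v | p. walk x p y}" and ?T = "(\<lambda>p. path_map M (x, p) v) ` W"
    have "?S \<subseteq> vect.span ?T"
    proof safe
      fix p assume p: "walk x p y"
      show "path_map M (x, p) v \<in> vect.span ?T"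
      proof (cases "length p \<le> m")
        case True
        with p have "p \<in> W" by (simp add: W_def pre_digraph.awalk_def)
        then show ?thesis by (intro vect.span_base) simp
      next
        case False
        then have "path_map M (x, p) v = 0" using m[OF M p _ v] by simp
        then show ?thesis by (metis vect.span_zero)
      qed
    qed
    then have "generated_by M x v y \<subseteq> vect.span ?T"
      unfolding generated_by_def by (intro vect.span_minimal) auto
    then have "vect.dim (generated_by M x v y) \<le> card ?T" using W by (intro vect.dim_le_card) auto
    also have "\<dots> \<le> card W" using W by (rule card_image_le)
    finally show ?thesis .
  qed
  with that show ?thesis by blast
qed

lemma span_rad: "vect.span (rad Q M x) = rad Q M x"
  by (simp add: rad_def)

definition cyclic :: "'v \<Rightarrow> ('v, 'a, 'k) rep \<times> 'k vect \<Rightarrow> bool" where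
  "cyclic x P \<longleftrightarrow> fst P \<in> mod_cat Q I \<and> snd P \<in> vsp (fst P) x \<and>
     (\<forall>y\<in>verts Q. vsp (fst P) y = generated_by (fst P) x (snd P) y)"

text \<open>
  The universal property of \<open>(e\<^sub>x \<Lambda>, e\<^sub>x)\<close> for the bound quiver algebra \<open>\<Lambda>\<close>.
\<close>

definition free_cyclic :: "'v \<Rightarrow> ('v, 'a, 'k) rep \<times> 'k vect \<Rightarrow> bool" where
  "free_cyclic x P \<longleftrightarrow> cyclic x P \<and>
     (\<forall>Y\<in>mod_cat Q I. \<forall>v\<in>vsp Y x. \<exists>h. rep_hom Q (fst P) Y h \<and> h x (snd P) = v)"

text \<open>
  A cyclic module of largest dimension is free. If \<open>e\<close> generates such a module \<open>P\<close> and \<open>v\<close> is a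
  vector of \<open>Y\<close>, then the submodule of \<open>P \<oplus> Y\<close> generated by \<open>(e, v)\<close> maps onto \<open>P\<close>, and by
  maximality isomorphically: it is the graph of a homomorphism that takes \<open>e\<close> to \<open>v\<close>.
\<close>

lemma free_cyclic_exists:
  assumes x: "x \<in> verts Q"
  shows "\<exists>P. free_cyclic x P"
proof -
  let ?d = "\<lambda>P. \<Sum>y\<in>verts Q. vect.dim (vsp (fst P) y)"
  obtain K where K: "\<And>M x v y. M \<in> mod_cat Q I \<Longrightarrow> v \<in> vsp M x \<Longrightarrow> vect.dim (generated_by M x v y) \<le> K"
    using dim_generated_by_bounded by blast
  have restrict_cyclic: "cyclic x (M\<lparr>vsp := generated_by M x v\<rparr>, v)" if M: "M \<in> mod_cat Q I" and v: "v \<in> vsp M x" for M v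
    using mod_cat_subrep[OF M subrep_generated_by[OF mod_cat_linear_rep[OF M] v]] in_generated_by[OF x]
    by (simp add: cyclic_def) (simp add: generated_by_def)
  have bounded: "?d P < Suc (card (verts Q) * K)" if P: "cyclic x P" for P
  proof -
    have "?d P \<le> (\<Sum>y\<in>verts Q. K)" using P K by (intro sum_mono) (auto simp: cyclic_def)
    then show ?thesis by simp
  qed
  have "\<exists>P. cyclic x P"
    using restrict_cyclic[OF mod_cat_zero, of 0] by (auto simp: rep_zero_def)
  then obtain P where P: "cyclic x P" and max: "\<And>R. cyclic x R \<Longrightarrow> ?d R \<le> ?d P"
    using ex_has_greatest_nat[of "cyclic x" _ ?d "Suc (card (verts Q) * K)"] bounded by blast
  obtain M e where Me: "P = (M, e)" by (cases P)
  have M: "M \<in> mod_cat Q I" and e: "e \<in> vsp M x"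
    and gen: "\<And>y. y \<in> verts Q \<Longrightarrow> vsp M y = generated_by M x e y"
    using P by (auto simp: cyclic_def Me)
  note lM = mod_cat_linear_rep[OF M]
  have "\<exists>h. rep_hom Q M Y h \<and> h x e = v" if Y: "Y \<in> mod_cat Q I" and v: "v \<in> vsp Y x" for Y v
  proof -
    define Z where "Z = (rep_sum M Y)\<lparr>vsp := generated_by (rep_sum M Y) x (vpair e v)\<rparr>"
    have S: "rep_sum M Y \<in> mod_cat Q I" by (rule mod_cat_sum[OF M Y])
    have ev: "vpair e v \<in> vsp (rep_sum M Y) x" using e v by (simp add: in_vsp_rep_sum)
    have cZ: "cyclic x (Z, vpair e v)" unfolding Z_def by (rule restrict_cyclic[OF S ev])
    then have Z: "Z \<in> mod_cat Q I" and evZ: "vpair e v \<in> vsp Z x" by (auto simp: cyclic_def)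
    note lZ = mod_cat_linear_rep[OF Z]
    have sub: "subrep Q (rep_sum M Y) (vsp Z)"
      unfolding Z_def using subrep_generated_by[OF mod_cat_linear_rep[OF S] ev] by simp
    have incl: "rep_hom Q Z (rep_sum M Y) (\<lambda>y w. w)"
    proof (rule rep_homI)
      show "linear_between (vsp Z y) (vsp (rep_sum M Y) y) (\<lambda>w. w)" if "y \<in> verts Q" for y
        using subrep_subset[OF sub that] by (auto simp: linear_between_def)
    qed (simp add: Z_def)
    have fst: "rep_hom Q Z M (\<lambda>y. vfst)" using rep_hom_compose[OF incl rep_hom_fst] by simp
    have onto: "vfst ` vsp Z y = vsp M y" if y: "y \<in> verts Q" for y
    proof
      show "vfst ` vsp Z y \<subseteq> vsp M y" using rep_hom_in[OF fst y] by blast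
      have "e \<in> vfst ` vsp Z x" using evZ by (intro image_eqI[of _ _ "vpair e v"]) simp_all
      then show "vsp M y \<subseteq> vfst ` vsp Z y"
        using generated_by_minimal[OF subrep_image[OF lZ fst] _ y] gen[OF y] by simp
    qed
    have le: "vect.dim (vsp M y) \<le> vect.dim (vsp Z y)" if "y \<in> verts Q" for y
      by (rule dim_surj_le(1)[OF mod_cat_fin_dim[OF Z that] rep_hom_linear[OF fst that] onto[OF that]])
    have "vect.dim (vsp M y) = vect.dim (vsp Z y)" if y: "y \<in> verts Q" for y
    proof (rule ccontr)
      assume "vect.dim (vsp M y) \<noteq> vect.dim (vsp Z y)"
      with le[OF y] have "vect.dim (vsp M y) < vect.dim (vsp Z y)" by simp
      with y have "(\<Sum>y\<in>verts Q. vect.dim (vsp M y)) < (\<Sum>y\<in>verts Q. vect.dim (vsp Z y))"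
        using le by (intro sum_strict_mono_ex1) (auto intro!: bexI[of _ y])
      with max[OF cZ] show False by (simp add: Me)
    qed
    then have bij: "bij_betw vfst (vsp Z y) (vsp M y)" if y: "y \<in> verts Q" for y
      using dim_surj_le(2)[OF mod_cat_fin_dim[OF Z y] rep_hom_linear[OF fst y] onto[OF y]] onto[OF y] y
      by (simp add: bij_betw_def)
    let ?g = "\<lambda>y. inv_into (vsp Z y) vfst"
    have g: "rep_hom Q M Z ?g" by (rule rep_hom_inv[OF lZ fst bij])
    have "?g x e = vpair e v"
      using bij[OF x] evZ inv_into_f_f[of vfst "vsp Z x" "vpair e v"] by (simp add: bij_betw_def)
    with rep_hom_compose[OF g rep_hom_compose[OF incl rep_hom_snd]] show ?thesis
      by (intro exI[of _ "\<lambda>y u. vsnd (?g y u)"]) simp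
  qed
  then have "free_cyclic x (M, e)"
    using P unfolding free_cyclic_def Me fst_conv snd_conv by blast
  then show ?thesis by blast
qed

definition vertex_projective :: "'v \<Rightarrow> ('v, 'a, 'k) rep" where
  "vertex_projective x = fst (SOME P. free_cyclic x P)"

definition vertex_generator :: "'v \<Rightarrow> 'k vect" where
  "vertex_generator x = snd (SOME P. free_cyclic x P)"

lemma free_cyclic_vertex_projective:
  "x \<in> verts Q \<Longrightarrow> free_cyclic x (vertex_projective x, vertex_generator x)"
  using someI_ex[OF free_cyclic_exists] by (simp add: vertex_projective_def vertex_generator_def)

lemma vertex_projective_mod_cat: "x \<in> verts Q \<Longrightarrow> vertex_projective x \<in> mod_cat Q I"
  and vertex_generator_in: "x \<in> verts Q \<Longrightarrow> vertex_generator x \<in> vsp (vertex_projective x) x"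
  and vertex_projective_generated: "x \<in> verts Q \<Longrightarrow> y \<in> verts Q \<Longrightarrow>
    vsp (vertex_projective x) y = generated_by (vertex_projective x) x (vertex_generator x) y"
  using free_cyclic_vertex_projective[of x] by (simp_all add: free_cyclic_def cyclic_def in_generated_by)

lemma vertex_projective_hom:
  assumes "x \<in> verts Q" "Y \<in> mod_cat Q I" "v \<in> vsp Y x"
  obtains h where "rep_hom Q (vertex_projective x) Y h" "h x (vertex_generator x) = v"
  using free_cyclic_vertex_projective[OF assms(1)] assms(2,3) by (auto simp: free_cyclic_def)

lemma projective_vertex_projective:
  assumes x: "x \<in> verts Q"
  shows "projective Q I (vertex_projective x)" (is "projective Q I ?P")
  unfolding projective_def
proof (intro conjI ballI allI impI)
  let ?e = "vertex_generator x"
  note mP = vertex_projective_mod_cat[OF x] and e = vertex_generator_in[OF x]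
  note lP = mod_cat_linear_rep[OF mP]
  show "?P \<in> mod_cat Q I" by (rule mP)
  fix X Y g f assume X: "X \<in> mod_cat Q I" and Y: "Y \<in> mod_cat Q I" and gf: "rep_epi Q X Y g \<and> rep_hom Q ?P Y f"
  note lX = mod_cat_linear_rep[OF X] and lY = mod_cat_linear_rep[OF Y]
  have f: "rep_hom Q ?P Y f" and g: "rep_hom Q X Y g" using gf by (auto simp: rep_epi_def)
  have "f x ?e \<in> g x ` vsp X x" using rep_epi_image[of Q X Y g x] gf rep_hom_in[OF f x e] x by simp
  then obtain u where u: "u \<in> vsp X x" "g x u = f x ?e" by auto
  obtain h where h: "rep_hom Q ?P X h" "h x ?e = u" using vertex_projective_hom[OF x X u(1)] by blast
  note gh = rep_hom_compose[OF h(1) g]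
  have eq_sub: "subrep Q ?P (\<lambda>y. {v \<in> vsp ?P y. g y (h y v) = f y v})"
  proof (rule subrepI)
    fix y assume y: "y \<in> verts Q"
    note lin = rep_hom_linear[OF gh y] rep_hom_linear[OF f y] and S = linear_rep_subspace[OF lP y]
    show "vect.subspace {v \<in> vsp ?P y. g y (h y v) = f y v}"
      using vect.subspace_0[OF S] vect.subspace_add[OF S] vect.subspace_scale[OF S]
        linear_between_zero[OF S lin(1)] linear_between_zero[OF S lin(2)]
        linear_between_add[OF lin(1)] linear_between_add[OF lin(2)]
        linear_between_scale[OF lin(1)] linear_between_scale[OF lin(2)]
      by (intro vect.subspaceI) auto
  next
    fix a v assume a: "a \<in> arcs Q" and v: "v \<in> {v \<in> vsp ?P (tail Q a). g (tail Q a) (h (tail Q a) v) = f (tail Q a) v}"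
    then show "amap ?P a v \<in> {v \<in> vsp ?P (head Q a). g (head Q a) (h (head Q a) v) = f (head Q a) v}"
      using rep_hom_amap[OF gh a, of v] rep_hom_amap[OF f a, of v] amap_in[OF lP a, of v] by simp
  qed auto
  have "?e \<in> {v \<in> vsp ?P x. g x (h x v) = f x v}" using e h(2) u(2) by simp
  then have "g y (h y v) = f y v" if "y \<in> verts Q" "v \<in> vsp ?P y" for y v
    using generated_by_minimal[OF eq_sub _ that(1)] vertex_projective_generated[OF x that(1)] that(2) by blast
  with h(1) show "\<exists>h. rep_hom Q ?P X h \<and> (\<forall>y\<in>verts Q. \<forall>v\<in>vsp ?P y. g y (h y v) = f y v)" by blast
qed

text \<open>
  Every path except the trivial one maps into the radical, so the generator spans the top.
\<close>

lemma vertex_projective_mod_rad: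
  assumes x: "x \<in> verts Q" and y: "y \<in> verts Q" and u: "u \<in> vsp (vertex_projective x) y"
  obtains c where "u - vscale c (if y = x then vertex_generator x else 0) \<in> rad Q (vertex_projective x) y"
proof -
  let ?P = "vertex_projective x" and ?e = "if y = x then vertex_generator x else 0"
  note lP = mod_cat_linear_rep[OF vertex_projective_mod_cat[OF x]]
  have "path_map ?P (x, p) (vertex_generator x) \<in> insert ?e (rad Q ?P y)" if "walk x p y" for p
    using path_map_in_rad[OF lP that _ vertex_generator_in[OF x]] that by (cases "p = []") auto
  then have "{path_map ?P (x, p) (vertex_generator x) | p. walk x p y} \<subseteq> insert ?e (rad Q ?P y)" by blast
  then have "u \<in> vect.span (insert ?e (rad Q ?P y))"
    using u vertex_projective_generated[OF x y] vect.span_mono unfolding generated_by_def by blast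
  then obtain c where "u - vscale c ?e \<in> vect.span (rad Q ?P y)"
    unfolding vect.span_breakdown_eq by blast
  then have "u - vscale c ?e \<in> rad Q ?P y" by (simp only: span_rad)
  then show ?thesis by (rule that)
qed

text \<open>
  A projective cover of \<open>M\<close> is built from a basis of its top, that is, of \<open>M\<close> modulo its radical. A
  basis vector at \<open>x\<close> contributes the projective at \<open>x\<close>.
\<close>

definition top_span :: "('v, 'a, 'k) rep \<Rightarrow> ('v \<times> 'k vect) list \<Rightarrow> 'v \<Rightarrow> 'k vect set" where
  "top_span M gs y = vect.span ({v. (y, v) \<in> set gs} \<union> rad Q M y)"

primrec top_independent :: "('v, 'a, 'k) rep \<Rightarrow> ('v \<times> 'k vect) list \<Rightarrow> bool" where
  "top_independent M [] = True"
| "top_independent M (g # gs) = (snd g \<notin> top_span M gs (fst g) \<and> top_independent M gs)"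

lemma top_span_Nil: "top_span M [] y = rad Q M y"
  by (simp add: top_span_def span_rad)

lemma top_span_Cons:
  "top_span M ((x, m) # gs) y = (if y = x then vect.span (insert m (top_span M gs y)) else top_span M gs y)"
proof (cases "y = x")
  case True
  have "{v. (y, v) \<in> set ((x, m) # gs)} \<union> rad Q M y = insert m ({v. (y, v) \<in> set gs} \<union> rad Q M y)"
    using True by auto
  moreover have "vect.span (insert m (vect.span A)) = vect.span (insert m A)" for A
  proof (rule vect.span_eq[THEN iffD2], intro conjI)
    have "vect.span A \<subseteq> vect.span (insert m A)" by (rule vect.span_mono) blast
    then show "insert m (vect.span A) \<subseteq> vect.span (insert m A)"
      using vect.span_base[of m "insert m A"] by blast
    show "insert m A \<subseteq> vect.span (insert m (vect.span A))"
      using vect.span_superset[of A] vect.span_superset[of "insert m (vect.span A)"] by blast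
  qed
  ultimately show ?thesis using True by (simp add: top_span_def)
qed (simp add: top_span_def)

lemma subspace_top_span: "vect.subspace (top_span M gs y)"
  by (simp add: top_span_def)

lemma span_top_span: "vect.span (top_span M gs y) = top_span M gs y"
  by (simp add: top_span_def)

lemma rad_subset_top_span: "rad Q M y \<subseteq> top_span M gs y"
  unfolding top_span_def using vect.span_superset by blast

lemma top_independent_exists:
  "\<exists>hs. top_independent M hs \<and> set hs \<subseteq> set gs \<and> (\<forall>y. top_span M hs y = top_span M gs y)"
proof (induction gs)
  case Nil
  show ?case by (rule exI[of _ "[]"]) simp
next
  case (Cons g gs)
  then obtain hs where hs: "top_independent M hs" "set hs \<subseteq> set gs" "\<And>y. top_span M hs y = top_span M gs y"
    by blast
  obtain x m where g: "g = (x, m)" by (cases g)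
  show ?case
  proof (cases "m \<in> top_span M hs x")
    case True
    then have "vect.span (insert m (top_span M hs x)) = top_span M hs x"
      by (simp add: insert_absorb span_top_span)
    then have "top_span M hs y = top_span M (g # gs) y" for y
      using hs(3) by (simp add: g top_span_Cons)
    with hs show ?thesis by auto
  next
    case False
    with hs have "top_independent M (g # hs)" "set (g # hs) \<subseteq> set (g # gs)"
      "\<And>y. top_span M (g # hs) y = top_span M (g # gs) y"
      by (auto simp: g top_span_Cons)
    then show ?thesis by blast
  qed
qed

lemma top_basis_exists:
  assumes M: "M \<in> mod_cat Q I"
  obtains gs where "top_independent M gs" "\<And>x v. (x, v) \<in> set gs \<Longrightarrow> x \<in> verts Q \<and> v \<in> vsp M x"
    "\<And>y. y \<in> verts Q \<Longrightarrow> top_span M gs y = vsp M y"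
proof -
  have "\<exists>B. finite B \<and> vect.span B = vsp M y" if "y \<in> verts Q" for y
    using mod_cat_fin_dim[OF M that] by (auto simp: fin_dim_space_def)
  then obtain B where B: "\<And>y. y \<in> verts Q \<Longrightarrow> finite (B y) \<and> vect.span (B y) = vsp M y" by metis
  have "finite (Sigma (verts Q) B)" using B by (intro finite_SigmaI) auto
  then obtain gs where gs: "set gs = Sigma (verts Q) B" using finite_list by blast
  obtain hs where hs: "top_independent M hs" "set hs \<subseteq> set gs" "\<And>y. top_span M hs y = top_span M gs y"
    using top_independent_exists by blast
  have in_M: "x \<in> verts Q \<and> v \<in> vsp M x" if "(x, v) \<in> set gs" for x v
    using that B[of x] vect.span_superset[of "B x"] by (auto simp: gs)
  have "top_span M gs y = vsp M y" if y: "y \<in> verts Q" for y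
  proof
    show "top_span M gs y \<subseteq> vsp M y"
      unfolding top_span_def using in_M rad_subset[OF mod_cat_linear_rep[OF M] y]
      by (intro vect.span_minimal linear_rep_subspace[OF mod_cat_linear_rep[OF M] y]) blast
    have "vect.span (B y) \<subseteq> top_span M gs y"
      unfolding top_span_def by (rule vect.span_mono) (use y in \<open>auto simp: gs\<close>)
    then show "vsp M y \<subseteq> top_span M gs y" using B[OF y] by simp
  qed
  with hs in_M show ?thesis by (intro that[of hs]) auto
qed

text \<open>
  The map \<open>f\<close> induces an isomorphism from the top of \<open>P\<close> onto the subspace of the top of \<open>M\<close> spanned
  by \<open>gs\<close>. In this form the property can be proved by induction on \<open>gs\<close>.
\<close>

definition top_cover ::
    "('v, 'a, 'k) rep \<Rightarrow> ('v \<times> 'k vect) list \<Rightarrow> ('v, 'a, 'k) rep \<Rightarrow> ('v \<Rightarrow> 'k vect \<Rightarrow> 'k vect) \<Rightarrow> bool"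
  where "top_cover M gs P f \<longleftrightarrow> rep_hom Q P M f \<and>
    (\<forall>y\<in>verts Q. \<forall>w\<in>vsp P y. f y w \<in> top_span M gs y \<and> (f y w \<in> rad Q M y \<longrightarrow> w \<in> rad Q P y)) \<and>
    (\<forall>y\<in>verts Q. \<forall>v\<in>top_span M gs y. \<exists>w\<in>vsp P y. v - f y w \<in> rad Q M y)"

lemma top_independent_cover:
  assumes M: "M \<in> mod_cat Q I"
  shows "top_independent M gs \<Longrightarrow> (\<And>x v. (x, v) \<in> set gs \<Longrightarrow> x \<in> verts Q \<and> v \<in> vsp M x) \<Longrightarrow>
    \<exists>f. top_cover M gs (rep_sum_list (map (vertex_projective \<circ> fst) gs)) f"
proof (induction gs)
  case Nil
  have "rep_hom Q rep_zero M (\<lambda>y w. 0)"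
    using amap_zero[OF mod_cat_linear_rep[OF M]] linear_rep_subspace[OF mod_cat_linear_rep[OF M]]
    by (intro rep_homI linear_between_const_0) auto
  moreover have "\<forall>y\<in>verts Q. \<forall>w\<in>vsp (rep_zero :: ('v, 'a, 'k) rep) y.
      0 \<in> rad Q M y \<and> (0 \<in> rad Q M y \<longrightarrow> w \<in> rad Q rep_zero y)"
  proof (intro ballI conjI impI)
    fix y w assume "w \<in> vsp (rep_zero :: ('v, 'a, 'k) rep) y"
    then have w: "w = 0" by (simp add: rep_zero_def)
    show "w \<in> rad Q rep_zero y" unfolding w by (rule vect.subspace_0[OF subspace_rad])
  qed (rule vect.subspace_0[OF subspace_rad])
  moreover have "\<forall>y\<in>verts Q. \<forall>v\<in>rad Q M y. \<exists>w\<in>vsp (rep_zero :: ('v, 'a, 'k) rep) y. v - 0 \<in> rad Q M y"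
    by (simp add: rep_zero_def)
  ultimately show ?case
    unfolding list.map rep_sum_list_Nil top_span_Nil top_cover_def
    by (intro exI[of _ "\<lambda>y w. 0"] conjI)
next
  case (Cons g gs)
  obtain x m where g: "g = (x, m)" by (cases g)
  have x: "x \<in> verts Q" and m: "m \<in> vsp M x" using Cons.prems(2)[of x m] by (simp_all add: g)
  have m_indep: "m \<notin> top_span M gs x" using Cons.prems(1) by (simp add: g)
  let ?P = "vertex_projective x" and ?e = "vertex_generator x"
  let ?S = "rep_sum_list (map (vertex_projective \<circ> fst) gs)"
  note lM = mod_cat_linear_rep[OF M]
  have lP: "linear_rep Q ?P" by (rule mod_cat_linear_rep[OF vertex_projective_mod_cat[OF x]])
  have "a \<in> verts Q" if "(a, b) \<in> set gs" for a b using Cons.prems(2)[of a b] that by simp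
  then have "set (map (vertex_projective \<circ> fst) gs) \<subseteq> mod_cat Q I"
    by (auto intro: vertex_projective_mod_cat)
  then have "?S \<in> mod_cat Q I" by (rule mod_cat_sum_list)
  then have lS: "linear_rep Q ?S" by (rule mod_cat_linear_rep)
  obtain h where h: "rep_hom Q ?P M h" "h x ?e = m" using vertex_projective_hom[OF x M m] by blast
  have "top_independent M gs" using Cons.prems(1) by simp
  moreover have "x \<in> verts Q \<and> v \<in> vsp M x" if "(x, v) \<in> set gs" for x v
    using Cons.prems(2)[of x v] that by simp
  ultimately obtain f where "top_cover M gs ?S f" using Cons.IH by blast
  then have f: "rep_hom Q ?S M f"
    and f_top: "\<And>y w. y \<in> verts Q \<Longrightarrow> w \<in> vsp ?S y \<Longrightarrow> f y w \<in> top_span M gs y"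
    and f_rad: "\<And>y w. y \<in> verts Q \<Longrightarrow> w \<in> vsp ?S y \<Longrightarrow> f y w \<in> rad Q M y \<Longrightarrow> w \<in> rad Q ?S y"
    and f_onto: "\<And>y v. y \<in> verts Q \<Longrightarrow> v \<in> top_span M gs y \<Longrightarrow> \<exists>w\<in>vsp ?S y. v - f y w \<in> rad Q M y"
    unfolding top_cover_def by blast+
  let ?f = "\<lambda>y w. h y (vfst w) + f y (vsnd w)"
  have hom: "rep_hom Q (rep_sum ?P ?S) M ?f" by (rule rep_hom_copair[OF h(1) f lM])
  have split: "\<exists>c. u - vscale c (if y = x then ?e else 0) \<in> rad Q ?P y \<and>
      h y u - vscale c (if y = x then m else 0) \<in> rad Q M y" if y: "y \<in> verts Q" and u: "u \<in> vsp ?P y" for y u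
  proof -
    obtain c where c: "u - vscale c (if y = x then ?e else 0) \<in> rad Q ?P y"
      using vertex_projective_mod_rad[OF x y u] by blast
    have e': "(if y = x then ?e else 0) \<in> vsp ?P y"
      using vertex_generator_in[OF x] vect.subspace_0[OF linear_rep_subspace[OF lP y]] by simp
    then have ce: "vscale c (if y = x then ?e else 0) \<in> vsp ?P y"
      by (rule vect.subspace_scale[OF linear_rep_subspace[OF lP y]])
    have "h y (if y = x then ?e else 0) = (if y = x then m else 0)"
      using h(2) rep_hom_0[OF lP h(1) y] by simp
    then have "h y (u - vscale c (if y = x then ?e else 0)) = h y u - vscale c (if y = x then m else 0)"
      using rep_hom_diff[OF lP h(1) y u ce] linear_between_scale[OF rep_hom_linear[OF h(1) y] e', of c]
      by (simp only:)
    then have "h y u - vscale c (if y = x then m else 0) \<in> rad Q M y"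
      using rep_hom_rad[OF lP h(1) y c] by (simp only:)
    with c show ?thesis by blast
  qed
  have "?f y w \<in> top_span M (g # gs) y \<and> (?f y w \<in> rad Q M y \<longrightarrow> w \<in> rad Q (rep_sum ?P ?S) y)"
    if y: "y \<in> verts Q" and w: "w \<in> vsp (rep_sum ?P ?S) y" for y w
  proof -
    have u: "vfst w \<in> vsp ?P y" and v: "vsnd w \<in> vsp ?S y" using w by (auto simp: in_vsp_rep_sum)
    obtain c where c: "vfst w - vscale c (if y = x then ?e else 0) \<in> rad Q ?P y"
        "h y (vfst w) - vscale c (if y = x then m else 0) \<in> rad Q M y" (is "?r \<in> _")
      using split[OF y u] by blast
    have ft: "f y (vsnd w) \<in> top_span M gs y" by (rule f_top[OF y v])
    note T = subspace_top_span[of M gs y]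
    have rT: "?r \<in> top_span M gs y" using c(2) rad_subset_top_span by blast
    have top: "?f y w \<in> top_span M (g # gs) y"
    proof (cases "y = x")
      case True
      have "?r + f y (vsnd w) \<in> vect.span (insert m (top_span M gs y))"
        using vect.subspace_add[OF T rT ft] by (intro vect.span_base) simp
      moreover have "vscale c m \<in> vect.span (insert m (top_span M gs y))"
        by (intro vect.span_scale vect.span_base) simp
      ultimately have "(?r + f y (vsnd w)) + vscale c m \<in> vect.span (insert m (top_span M gs y))"
        by (rule vect.span_add)
      moreover have "(?r + f y (vsnd w)) + vscale c m = ?f y w" using True by simp
      ultimately show ?thesis using True by (simp add: g top_span_Cons)
    next
      case False
      then show ?thesis using vect.subspace_add[OF T rT ft] by (simp add: g top_span_Cons)
    qed
    have "w \<in> rad Q (rep_sum ?P ?S) y" if r: "?f y w \<in> rad Q M y"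
    proof -
      \<comment> \<open>A nonzero coefficient of \<open>m\<close> would put \<open>m\<close> into the span of the other vectors.\<close>
      have zero: "vscale c (if y = x then ?e else 0) = 0"
      proof (cases "y = x \<and> c \<noteq> 0")
        case True
        have "?f y w \<in> top_span M gs y" using r rad_subset_top_span by blast
        then have "?f y w - (?r + f y (vsnd w)) \<in> top_span M gs y"
          using vect.subspace_diff[OF T _ vect.subspace_add[OF T rT ft]] by blast
        moreover have "?f y w - (?r + f y (vsnd w)) = vscale c m" using True by simp
        ultimately have "vscale c m \<in> top_span M gs x" using True by metis
        then have "vscale (inverse c) (vscale c m) \<in> top_span M gs x"
          by (rule vect.subspace_scale[OF subspace_top_span])
        with True m_indep show ?thesis by simp
      qed auto
      have u_rad: "vfst w \<in> rad Q ?P y" using c(1) unfolding zero by simp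
      have "?f y w - h y (vfst w) \<in> rad Q M y"
        by (rule vect.subspace_diff[OF subspace_rad r rep_hom_rad[OF lP h(1) y u_rad]])
      then have "vsnd w \<in> rad Q ?S y" using f_rad[OF y v] by simp
      with u_rad show ?thesis by (simp add: in_rad_sum[OF lP lS y])
    qed
    with top show ?thesis by blast
  qed
  moreover have "\<exists>w\<in>vsp (rep_sum ?P ?S) y. v - ?f y w \<in> rad Q M y"
    if y: "y \<in> verts Q" and v: "v \<in> top_span M (g # gs) y" for y v
  proof -
    obtain c where c: "v - vscale c (if y = x then m else 0) \<in> top_span M gs y"
    proof (cases "y = x")
      case True
      then have "v \<in> vect.span (insert m (top_span M gs y))" using v by (simp add: g top_span_Cons)
      then obtain c where "v - vscale c m \<in> vect.span (top_span M gs y)"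
        unfolding vect.span_breakdown_eq by blast
      then have "v - vscale c m \<in> top_span M gs y" by (simp only: span_top_span)
      with True show ?thesis by (intro that[of c]) simp
    next
      case False
      then show ?thesis using v by (intro that[of 0]) (simp add: g top_span_Cons)
    qed
    obtain w where w: "w \<in> vsp ?S y" "(v - vscale c (if y = x then m else 0)) - f y w \<in> rad Q M y"
      using f_onto[OF y c] by blast
    have e': "(if y = x then ?e else 0) \<in> vsp ?P y"
      using vertex_generator_in[OF x] vect.subspace_0[OF linear_rep_subspace[OF lP y]] by simp
    have he: "h y (if y = x then ?e else 0) = (if y = x then m else 0)"
      using h(2) rep_hom_0[OF lP h(1) y] by simp
    let ?w = "vpair (vscale c (if y = x then ?e else 0)) w"
    have "?w \<in> vsp (rep_sum ?P ?S) y"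
      using vect.subspace_scale[OF linear_rep_subspace[OF lP y] e'] w(1) by (simp add: in_vsp_rep_sum)
    moreover have "v - ?f y ?w = (v - vscale c (if y = x then m else 0)) - f y w"
      using linear_between_scale[OF rep_hom_linear[OF h(1) y] e', of c] he by (simp add: algebra_simps)
    ultimately show ?thesis using w(2) by metis
  qed
  ultimately have "top_cover M (g # gs) (rep_sum ?P ?S) ?f"
    unfolding top_cover_def using hom by blast
  moreover have "rep_sum_list (map (vertex_projective \<circ> fst) (g # gs)) = rep_sum ?P ?S"
    by (simp add: g)
  ultimately show ?case by metis
qed

text \<open>
  That the cover is a sum of projectives at vertices leaves finitely many possible building
  blocks for the modules that arise as syzygies.
\<close>

lemma projective_cover_vertex_projectives:
  assumes M: "M \<in> mod_cat Q I"
  obtains xs f where "set xs \<subseteq> verts Q"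
    "projective_cover Q I M (rep_sum_list (map vertex_projective xs)) f"
proof -
  obtain gs where gs: "top_independent M gs" "\<And>x v. (x, v) \<in> set gs \<Longrightarrow> x \<in> verts Q \<and> v \<in> vsp M x"
    "\<And>y. y \<in> verts Q \<Longrightarrow> top_span M gs y = vsp M y"
    using top_basis_exists[OF M] by blast
  let ?xs = "map fst gs"
  let ?P = "rep_sum_list (map vertex_projective ?xs)"
  have xs: "set ?xs \<subseteq> verts Q" using gs(2) by auto
  obtain f where "top_cover M gs ?P f" using top_independent_cover[OF M gs(1,2)] by (auto simp: comp_def)
  then have f: "rep_hom Q ?P M f"
    and f_rad: "\<And>y w. y \<in> verts Q \<Longrightarrow> w \<in> vsp ?P y \<Longrightarrow> f y w \<in> rad Q M y \<Longrightarrow> w \<in> rad Q ?P y"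
    and f_onto: "\<And>y v. y \<in> verts Q \<Longrightarrow> v \<in> vsp M y \<Longrightarrow> \<exists>w\<in>vsp ?P y. v - f y w \<in> rad Q M y"
    unfolding top_cover_def using gs(3) by blast+
  have "projective Q I (rep_sum_list (map vertex_projective zs))" if "set zs \<subseteq> verts Q" for zs
    using that
  proof (induction zs)
    case Nil
    show ?case by (rule projective_zero) (simp_all add: mod_cat_zero, simp add: rep_zero_def)
  qed (auto intro: projective_sum projective_vertex_projective)
  then have P: "projective Q I ?P" using xs by blast
  have epi: "rep_epi Q ?P M f"
    by (rule nakayama_epi[OF mod_cat_linear_rep[OF projective_imp_mod_cat[OF P]] M f f_onto])
  have "projective_cover Q I M ?P f"
    unfolding projective_cover_iff[OF mod_cat_linear_rep[OF M]]
  proof (intro conjI ballI impI)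
    fix y w assume y: "y \<in> verts Q" and w: "w \<in> vsp ?P y" and zero: "f y w = 0"
    have "f y w \<in> rad Q M y" unfolding zero by (rule vect.subspace_0[OF subspace_rad])
    then show "w \<in> rad Q ?P y" by (rule f_rad[OF y w])
  qed (use P epi in blast)+
  with xs show ?thesis by (rule that)
qed


section \<open>Syzygies\<close>

lemma syzygy_cover:
  assumes M: "M \<in> mod_cat Q I"
  obtains P f where "projective_cover Q I M P f" "syzygy Q I M = rep_ker P f"
proof -
  obtain xs f where "projective_cover Q I M (rep_sum_list (map vertex_projective xs)) f"
    by (rule projective_cover_vertex_projectives[OF M])
  then have "\<exists>N P f. projective_cover Q I M P f \<and> N = rep_ker P f" by metis
  then have "\<exists>P f. projective_cover Q I M P f \<and> syzygy Q I M = rep_ker P f"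
    unfolding syzygy_def by (rule someI_ex)
  with that show ?thesis by blast
qed

lemma projective_cover_ker_mod_cat:
  assumes M: "M \<in> mod_cat Q I" and P: "projective_cover Q I M P f"
  shows "rep_ker P f \<in> mod_cat Q I"
  using P mod_cat_ker[OF projective_imp_mod_cat mod_cat_linear_rep[OF M] rep_epi_hom]
  by (simp add: projective_cover_def)

lemma syzygy_mod_cat: "M \<in> mod_cat Q I \<Longrightarrow> syzygy Q I M \<in> mod_cat Q I"
  using syzygy_cover projective_cover_ker_mod_cat by metis

lemma syzygy_iso_ker:
  assumes M: "M \<in> mod_cat Q I" and N: "N \<in> mod_cat Q I" and iso: "rep_iso Q M N"
    and P: "projective_cover Q I N P f"
  shows "rep_iso Q (syzygy Q I M) (rep_ker P f)"
  using projective_cover_unique[OF M N iso _ P] syzygy_cover[OF M] by metis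

lemma syzygy_iso:
  assumes M: "M \<in> mod_cat Q I" and N: "N \<in> mod_cat Q I" and iso: "rep_iso Q M N"
  shows "rep_iso Q (syzygy Q I M) (syzygy Q I N)"
  using syzygy_iso_ker[OF M N iso] syzygy_cover[OF N] by metis

lemma projective_cover_sum:
  assumes M: "M \<in> mod_cat Q I" and N: "N \<in> mod_cat Q I"
    and cM: "projective_cover Q I M P f" and cN: "projective_cover Q I N R g"
  shows "projective_cover Q I (rep_sum M N) (rep_sum P R) (\<lambda>x w. vpair (f x (vfst w)) (g x (vsnd w)))"
    (is "projective_cover Q I _ _ ?h")
proof -
  note lM = mod_cat_linear_rep[OF M] and lN = mod_cat_linear_rep[OF N]
  have P: "projective Q I P" "rep_epi Q P M f" "\<And>x v. x \<in> verts Q \<Longrightarrow> v \<in> vsp P x \<Longrightarrow> f x v = 0 \<Longrightarrow> v \<in> rad Q P x"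
    using cM unfolding projective_cover_iff[OF lM] by auto
  have R: "projective Q I R" "rep_epi Q R N g" "\<And>x v. x \<in> verts Q \<Longrightarrow> v \<in> vsp R x \<Longrightarrow> g x v = 0 \<Longrightarrow> v \<in> rad Q R x"
    using cN unfolding projective_cover_iff[OF lN] by auto
  note lP = mod_cat_linear_rep[OF projective_imp_mod_cat[OF P(1)]]
    and lR = mod_cat_linear_rep[OF projective_imp_mod_cat[OF R(1)]]
  have hom: "rep_hom Q (rep_sum P R) (rep_sum M N) ?h"
    by (rule rep_hom_sum_map[OF rep_epi_hom[OF P(2)] rep_epi_hom[OF R(2)]])
  have "?h x ` vsp (rep_sum P R) x = vsp (rep_sum M N) x" if x: "x \<in> verts Q" for x
  proof
    show "?h x ` vsp (rep_sum P R) x \<subseteq> vsp (rep_sum M N) x" using rep_hom_in[OF hom x] by blast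
    show "vsp (rep_sum M N) x \<subseteq> ?h x ` vsp (rep_sum P R) x"
    proof
      fix w assume "w \<in> vsp (rep_sum M N) x"
      then have "vfst w \<in> f x ` vsp P x" "vsnd w \<in> g x ` vsp R x"
        using rep_epi_image[OF P(2) x] rep_epi_image[OF R(2) x] by (auto simp: in_vsp_rep_sum)
      then obtain u v where uv: "u \<in> vsp P x" "vfst w = f x u" "v \<in> vsp R x" "vsnd w = g x v" by blast
      then have "w = vpair (f x u) (g x v)" by (metis vpair_vfst_vsnd)
      with uv show "w \<in> ?h x ` vsp (rep_sum P R) x"
        by (intro image_eqI[of _ _ "vpair u v"]) (simp_all add: in_vsp_rep_sum)
    qed
  qed
  with hom have epi: "rep_epi Q (rep_sum P R) (rep_sum M N) ?h" by (simp add: rep_epi_def)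
  have "w \<in> rad Q (rep_sum P R) x" if x: "x \<in> verts Q" and w: "w \<in> vsp (rep_sum P R) x" "?h x w = 0" for x w
    using P(3)[OF x, of "vfst w"] R(3)[OF x, of "vsnd w"] w
    by (simp add: in_rad_sum[OF lP lR x] in_vsp_rep_sum)
  with epi projective_sum[OF P(1) R(1)] show ?thesis
    unfolding projective_cover_iff[OF linear_rep_sum[OF lM lN]] by blast
qed

lemma rep_ker_sum:
  "rep_ker (rep_sum P R) (\<lambda>x w. vpair (f x (vfst w)) (g x (vsnd w))) = rep_sum (rep_ker P f) (rep_ker R g)"
proof -
  have "vsp (rep_ker (rep_sum P R) (\<lambda>x w. vpair (f x (vfst w)) (g x (vsnd w)))) x
      = vsp (rep_sum (rep_ker P f) (rep_ker R g)) x" for x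
    by (auto simp: in_vsp_rep_sum rep_ker_def)
  then show ?thesis by (intro rep.equality) (auto simp: amap_rep_sum rep_ker_def fun_eq_iff)
qed

lemma syzygy_sum:
  assumes M: "M \<in> mod_cat Q I" and N: "N \<in> mod_cat Q I"
  shows "rep_iso Q (syzygy Q I (rep_sum M N)) (rep_sum (syzygy Q I M) (syzygy Q I N))"
proof -
  obtain P f where P: "projective_cover Q I M P f" "syzygy Q I M = rep_ker P f"
    using syzygy_cover[OF M] by blast
  obtain R g where R: "projective_cover Q I N R g" "syzygy Q I N = rep_ker R g"
    using syzygy_cover[OF N] by blast
  from syzygy_iso_ker[OF mod_cat_sum[OF M N] mod_cat_sum[OF M N] rep_iso_refl
      projective_cover_sum[OF M N P(1) R(1)]]
  show ?thesis unfolding P(2) R(2) rep_ker_sum .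
qed

lemma syzygy_projective:
  assumes P: "projective Q I P" and x: "x \<in> verts Q"
  shows "vsp (syzygy Q I P) x = {0}"
proof -
  note mP = projective_imp_mod_cat[OF P]
  note lP = mod_cat_linear_rep[OF mP]
  have cov: "projective_cover Q I P P (\<lambda>x v. v)"
    unfolding projective_cover_iff[OF lP]
    using P vect.subspace_0[OF subspace_rad[of P]] by (simp add: rep_epi_def rep_hom_id)
  obtain f where f: "rep_hom Q (syzygy Q I P) (rep_ker P (\<lambda>x v. v)) f"
      "\<And>x. x \<in> verts Q \<Longrightarrow> bij_betw (f x) (vsp (syzygy Q I P) x) (vsp (rep_ker P (\<lambda>x v. v)) x)"
    using rep_isoE[OF syzygy_iso_ker[OF mP mP rep_iso_refl cov]] by blast
  note lS = mod_cat_linear_rep[OF syzygy_mod_cat[OF mP]]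
  have "v = 0" if "v \<in> vsp (syzygy Q I P) x" for v
  proof -
    have "f x v = 0" using rep_hom_in[OF f(1) x that] by (simp add: rep_ker_def)
    then show ?thesis
      using inj_on_linear_iff[OF linear_rep_subspace[OF lS x] rep_hom_linear[OF f(1) x]] f(2)[OF x] that
      by (auto simp: bij_betw_def)
  qed
  with vect.subspace_0[OF linear_rep_subspace[OF lS x]] show ?thesis by blast
qed

lemma syzygy_funpow_mod_cat: "M \<in> mod_cat Q I \<Longrightarrow> (syzygy Q I ^^ n) M \<in> mod_cat Q I"
  by (induction n) (auto simp: syzygy_mod_cat)

lemma syzygy_funpow_iso:
  "M \<in> mod_cat Q I \<Longrightarrow> N \<in> mod_cat Q I \<Longrightarrow> rep_iso Q M N \<Longrightarrow>
     rep_iso Q ((syzygy Q I ^^ n) M) ((syzygy Q I ^^ n) N)"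
  by (induction n) (auto intro: syzygy_iso syzygy_funpow_mod_cat)

lemma syzygy_funpow_sum:
  assumes M: "M \<in> mod_cat Q I" and N: "N \<in> mod_cat Q I"
  shows "rep_iso Q ((syzygy Q I ^^ n) (rep_sum M N)) (rep_sum ((syzygy Q I ^^ n) M) ((syzygy Q I ^^ n) N))"
proof (induction n)
  case (Suc n)
  have "rep_iso Q (syzygy Q I ((syzygy Q I ^^ n) (rep_sum M N)))
      (syzygy Q I (rep_sum ((syzygy Q I ^^ n) M) ((syzygy Q I ^^ n) N)))"
    using M N Suc by (intro syzygy_iso mod_cat_sum syzygy_funpow_mod_cat)
  moreover have "rep_iso Q \<dots> (rep_sum (syzygy Q I ((syzygy Q I ^^ n) M)) (syzygy Q I ((syzygy Q I ^^ n) N)))"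
    using M N by (intro syzygy_sum syzygy_funpow_mod_cat)
  ultimately show ?case using rep_iso_trans by simp
qed (simp add: rep_iso_refl)

lemma syzygy_funpow_zero: "x \<in> verts Q \<Longrightarrow> vsp ((syzygy Q I ^^ n) rep_zero) x = {0}"
proof (induction n arbitrary: x)
  case (Suc n)
  have "projective Q I ((syzygy Q I ^^ n) rep_zero)"
    by (rule projective_zero[OF syzygy_funpow_mod_cat[OF mod_cat_zero] Suc.IH])
  from syzygy_projective[OF this Suc.prems] show ?case by (simp only: funpow.simps o_apply)
qed (simp add: rep_zero_def)

lemma syzygy_funpow_sum_list:
  "set Ms \<subseteq> mod_cat Q I \<Longrightarrow>
     rep_iso Q ((syzygy Q I ^^ n) (rep_sum_list Ms)) (rep_sum_list (map (syzygy Q I ^^ n) Ms))"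
proof (induction Ms)
  case Nil
  have "rep_iso Q ((syzygy Q I ^^ n) rep_zero) rep_zero"
    using syzygy_funpow_zero mod_cat_linear_rep[OF syzygy_funpow_mod_cat[OF mod_cat_zero]]
      mod_cat_linear_rep[OF mod_cat_zero]
    by (intro rep_iso_zero) (auto simp: rep_zero_def)
  then show ?case by simp
next
  case (Cons M Ms)
  then have "M \<in> mod_cat Q I" "rep_sum_list Ms \<in> mod_cat Q I" by (auto intro: mod_cat_sum_list)
  note s = syzygy_funpow_sum[OF this, of n]
  have "rep_iso Q (rep_sum_list Ms) (rep_sum_list Ms)" by (rule rep_iso_refl)
  have "rep_iso Q ((syzygy Q I ^^ n) (rep_sum_list Ms)) (rep_sum_list (map (syzygy Q I ^^ n) Ms))"
    using Cons by simp
  from rep_iso_trans[OF s rep_iso_sum[OF rep_iso_refl this]] show ?case by simp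
qed

end


section \<open>Restriction to and extension from a convex subquiver\<close>

locale convex_subquiver =
  big: bound_quiver_algebra Q I + small: bound_quiver_algebra Q' I'
  for Q :: "('v, 'a) quiver" and I :: "(('v, 'a) path \<Rightarrow>\<^sub>0 'k::field) set"
    and Q' :: "('v, 'a) quiver" and I' :: "(('v, 'a) path \<Rightarrow>\<^sub>0 'k) set" +
  assumes verts_subset: "verts Q' \<subseteq> verts Q"
    and arcs_iff: "a \<in> arcs Q' \<longleftrightarrow> a \<in> arcs Q \<and> tail Q a \<in> verts Q' \<and> head Q a \<in> verts Q'"
    and tail_eq: "a \<in> arcs Q' \<Longrightarrow> tail Q' a = tail Q a"
    and head_eq: "a \<in> arcs Q' \<Longrightarrow> head Q' a = head Q a"
    and convex: "big.walk x p y \<Longrightarrow> x \<in> verts Q' \<Longrightarrow> y \<in> verts Q' \<Longrightarrow> set p \<subseteq> arcs Q'"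
    and relations: "I \<inter> carrier (path_algebra Q') = I'"
begin

lemma vertex_in_big: "x \<in> verts Q' \<Longrightarrow> x \<in> verts Q"
  using verts_subset by blast

lemma arc_in_big: "a \<in> arcs Q' \<Longrightarrow> a \<in> arcs Q"
  using arcs_iff by blast

lemma walk_in_big: "small.walk x p y \<Longrightarrow> big.walk x p y"
  by (induction p arbitrary: x) (auto simp: vertex_in_big arc_in_big tail_eq head_eq)

lemma walk_in_small:
  assumes "big.walk x p y" "x \<in> verts Q'" "y \<in> verts Q'"
  shows "small.walk x p y"
proof -
  have "big.walk x p y \<Longrightarrow> set p \<subseteq> arcs Q' \<Longrightarrow> x \<in> verts Q' \<Longrightarrow> small.walk x p y"
  proof (induction p arbitrary: x)
    case (Cons a p)
    then show ?case using arcs_iff[of a] by (auto simp: tail_eq head_eq)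
  qed auto
  with assms convex show ?thesis by blast
qed

text \<open>
  A representation of the large quiver is at the same time one of the subquiver, as the values outside
  of a quiver are not constrained. Restriction is therefore the identity on representations; only
  extension by zero changes them.
\<close>

lemma restrict_mod_cat:
  assumes M: "M \<in> mod_cat Q I"
  shows "M \<in> mod_cat Q' I'"
proof -
  have "(\<Sum>p\<in>Poly_Mapping.keys \<rho>. vscale (Poly_Mapping.lookup \<rho> p) (path_map M p v)) = 0"
    if \<rho>: "\<rho> \<in> I'" and x: "x \<in> verts Q'" and y: "y \<in> verts Q'"
      and par: "\<forall>p\<in>Poly_Mapping.keys \<rho>. fst p = x \<and> path_end Q' p = y" and v: "v \<in> vsp M x" for \<rho> x y v
  proof -
    have "fst p = x \<and> path_end Q p = y" if p: "p \<in> Poly_Mapping.keys \<rho>" for p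
    proof -
      have "small.walk x (snd p) y"
        using small.relation_keys[OF \<rho> p] par p small.paths_iff[of x "snd p"] by force
      then have "path_end Q (x, snd p) = y" by (intro big.path_end_walk walk_in_big)
      with par p show ?thesis by force
    qed
    moreover have "\<rho> \<in> I" using \<rho> relations by blast
    ultimately show ?thesis
      using mod_cat_relation[OF M _ vertex_in_big[OF x] vertex_in_big[OF y] _ v] by blast
  qed
  moreover have "\<forall>x\<in>verts Q'. fin_dim_space (vsp M x)" using M vertex_in_big by (simp add: mod_cat_def)
  moreover have "\<forall>a\<in>arcs Q'. linear_between (vsp M (tail Q' a)) (vsp M (head Q' a)) (amap M a)"
    using M arc_in_big tail_eq head_eq by (simp add: mod_cat_def)
  ultimately show ?thesis unfolding mod_cat_def by blast
qed

lemma restrict_hom: "rep_hom Q M N f \<Longrightarrow> rep_hom Q' M N f"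
  by (simp add: rep_hom_def vertex_in_big arc_in_big tail_eq head_eq)

lemma restrict_epi: "rep_epi Q M N f \<Longrightarrow> rep_epi Q' M N f"
  by (simp add: rep_epi_def vertex_in_big restrict_hom)

lemma restrict_iso: "rep_iso Q M N \<Longrightarrow> rep_iso Q' M N"
  unfolding rep_iso_iff using restrict_hom vertex_in_big by blast

lemma restrict_summand: "is_summand Q I N M \<Longrightarrow> is_summand Q' I' N M"
  unfolding is_summand_def using restrict_mod_cat restrict_iso by blast

lemma vsp_rep_on: "vsp (rep_on Q' X) x = (if x \<in> verts Q' then vsp X x else {0})"
  and amap_rep_on: "amap (rep_on Q' X) a = (if a \<in> arcs Q' then amap X a else (\<lambda>v. 0))"
  by (simp_all add: rep_on_def)

lemma rep_on_sum: "rep_on Q' (rep_sum M N) = rep_sum (rep_on Q' M) (rep_on Q' N)"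
proof (rule rep.equality)
  show "vsp (rep_on Q' (rep_sum M N)) = vsp (rep_sum (rep_on Q' M) (rep_on Q' N))"
    by (rule ext) (auto simp: vsp_rep_on in_vsp_rep_sum intro: vpair_eq_0D)
  show "amap (rep_on Q' (rep_sum M N)) = amap (rep_sum (rep_on Q' M) (rep_on Q' N))"
    by (rule ext, rule ext) (simp only: amap_rep_on amap_rep_sum vpair_zero split: if_splits, simp)
qed simp

lemma rep_on_zero: "rep_on Q' rep_zero = rep_zero"
  by (simp add: rep_on_def rep_zero_def fun_eq_iff)

lemma rep_on_sum_list: "rep_on Q' (rep_sum_list Ms) = rep_sum_list (map (rep_on Q') Ms)"
  by (induction Ms) (simp_all add: rep_on_zero rep_on_sum rep_sum_list_def)

lemma rep_hom_rep_on_iff: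
  "rep_hom Q' (rep_on Q' X) N f \<longleftrightarrow> rep_hom Q' X N f"
  "rep_hom Q' M (rep_on Q' X) f \<longleftrightarrow> rep_hom Q' M X f"
  by (simp_all add: rep_hom_def vsp_rep_on amap_rep_on)

lemma rep_iso_rep_on: "rep_iso Q' (rep_on Q' X) X"
  by (rule rep_isoI[where f = "\<lambda>x v. v"])
    (simp_all add: rep_hom_rep_on_iff rep_hom_id vsp_rep_on bij_betw_def)

lemma extend_linear_rep:
  assumes X: "linear_rep Q' X"
  shows "linear_rep Q (rep_on Q' X)"
  unfolding linear_rep_def
proof (intro conjI ballI)
  show sub: "vect.subspace (vsp (rep_on Q' X) x)" for x
    using linear_rep_subspace[OF X] by (simp add: vsp_rep_on)
  show "linear_between (vsp (rep_on Q' X) (tail Q a)) (vsp (rep_on Q' X) (head Q a)) (amap (rep_on Q' X) a)"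
    if a: "a \<in> arcs Q" for a
  proof (cases "a \<in> arcs Q'")
    case True
    then show ?thesis
      using linear_rep_amap[OF X True] arcs_iff by (simp add: vsp_rep_on amap_rep_on tail_eq head_eq)
  next
    case False
    then show ?thesis using linear_between_const_0[OF sub] by (simp add: amap_rep_on)
  qed
qed

lemma path_map_rep_on:
  assumes "small.walk x p y"
  shows "path_map (rep_on Q' X) (x, p) v = path_map X (x, p) v"
proof -
  have "set p \<subseteq> arcs Q'" using assms by (simp add: pre_digraph.awalk_def)
  then show ?thesis by (induction p arbitrary: v) (simp_all add: path_map_def amap_rep_on)
qed

text \<open>
  A relation of the large quiver acts on an extended module either as a relation of the subquiver, by
  convexity, or as zero, because its paths start or end where the module vanishes.
\<close>

lemma extend_mod_cat:
  assumes X: "X \<in> mod_cat Q' I'"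
  shows "rep_on Q' X \<in> mod_cat Q I"
proof -
  let ?E = "rep_on Q' X"
  note lE = extend_linear_rep[OF mod_cat_linear_rep[OF X]]
  have "(\<Sum>p\<in>Poly_Mapping.keys \<rho>. vscale (Poly_Mapping.lookup \<rho> p) (path_map ?E p v)) = 0"
    if \<rho>: "\<rho> \<in> I" and x: "x \<in> verts Q" and y: "y \<in> verts Q"
      and par: "\<forall>p\<in>Poly_Mapping.keys \<rho>. fst p = x \<and> path_end Q p = y" and v: "v \<in> vsp ?E x" for \<rho> x y v
  proof -
    have walk: "fst p = x \<and> big.walk x (snd p) y" if "p \<in> Poly_Mapping.keys \<rho>" for p
      using big.relation_keys[OF \<rho> that] par that big.paths_iff[of x "snd p"] by force
    show ?thesis
    proof (cases "x \<in> verts Q' \<and> y \<in> verts Q'")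
      case True
      have small: "fst p = x \<and> small.walk x (snd p) y \<and> path_end Q' p = y" if "p \<in> Poly_Mapping.keys \<rho>" for p
        using walk_in_small[of x "snd p" y] walk[OF that] True small.path_end_walk[of x "snd p" y]
        by (cases p) auto
      have "p \<in> paths Q'" if "p \<in> Poly_Mapping.keys \<rho>" for p
        using small[OF that] by (simp add: paths_def)
      then have \<rho>': "\<rho> \<in> I'" using \<rho> relations by (auto simp: path_algebra_def)
      have "v \<in> vsp X x" using v True by (simp add: vsp_rep_on)
      then have "(\<Sum>p\<in>Poly_Mapping.keys \<rho>. vscale (Poly_Mapping.lookup \<rho> p) (path_map X p v)) = 0"
        using mod_cat_relation[OF X \<rho>'] True small by blast
      moreover have "path_map ?E p v = path_map X p v" if "p \<in> Poly_Mapping.keys \<rho>" for p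
        using path_map_rep_on[of x "snd p" y] small[OF that] by (cases p) auto
      ultimately show ?thesis by (simp cong: sum.cong)
    next
      case False
      have zero: "path_map ?E p v = 0" if p: "p \<in> Poly_Mapping.keys \<rho>" for p
      proof (cases "y \<in> verts Q'")
        case True
        with False v have "v = 0" by (simp add: vsp_rep_on)
        then show ?thesis
          using linear_between_zero[OF linear_rep_subspace[OF lE x] big.linear_path_map[OF lE]] walk[OF p]
          by (cases p) auto
      next
        case False
        have "path_map ?E p v \<in> vsp ?E y"
          using big.path_map_in[OF lE _ v, of "snd p" y] walk[OF p] by (cases p) auto
        with False show ?thesis by (simp add: vsp_rep_on)
      qed
      show ?thesis by (rule sum.neutral) (simp add: zero)
    qed
  qed
  moreover have "\<forall>x\<in>verts Q. fin_dim_space (vsp ?E x)"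
    using mod_cat_fin_dim[OF X] by (simp add: vsp_rep_on fin_dim_zero)
  moreover have "\<forall>a\<in>arcs Q. linear_between (vsp ?E (tail Q a)) (vsp ?E (head Q a)) (amap ?E a)"
    using lE by (simp add: linear_rep_def)
  ultimately show ?thesis unfolding mod_cat_def by blast
qed

text \<open>
  Outside of the subquiver the value must be zero and not that of \<open>f\<close>, which is arbitrary there.
\<close>

definition extend_map :: "('v \<Rightarrow> 'k vect \<Rightarrow> 'k vect) \<Rightarrow> 'v \<Rightarrow> 'k vect \<Rightarrow> 'k vect" where
  "extend_map f x = (if x \<in> verts Q' then f x else (\<lambda>v. 0))"

lemma extend_hom:
  assumes X: "linear_rep Q' X" and Y: "linear_rep Q' Y" and f: "rep_hom Q' X Y f"
  shows "rep_hom Q (rep_on Q' X) (rep_on Q' Y) (extend_map f)"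
proof (rule rep_homI)
  show "linear_between (vsp (rep_on Q' X) x) (vsp (rep_on Q' Y) x) (extend_map f x)" for x
    using rep_hom_linear[OF f] by (auto simp: vsp_rep_on extend_map_def linear_between_def)
  fix a v assume a: "a \<in> arcs Q" and v: "v \<in> vsp (rep_on Q' X) (tail Q a)"
  show "extend_map f (head Q a) (amap (rep_on Q' X) a v) = amap (rep_on Q' Y) a (extend_map f (tail Q a) v)"
  proof (cases "a \<in> arcs Q'")
    case True
    then show ?thesis
      using rep_hom_amap[OF f True, of v] v arcs_iff[of a]
      by (simp add: extend_map_def vsp_rep_on amap_rep_on tail_eq head_eq)
  next
    case False
    then show ?thesis using small.rep_hom_0[OF X f] by (simp add: extend_map_def amap_rep_on)
  qed
qed

lemma extend_epi:
  assumes "linear_rep Q' X" "linear_rep Q' Y" "rep_epi Q' X Y f"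
  shows "rep_epi Q (rep_on Q' X) (rep_on Q' Y) (extend_map f)"
  using extend_hom[OF assms(1,2) rep_epi_hom[OF assms(3)]] rep_epi_image[OF assms(3)]
  by (simp add: rep_epi_def vsp_rep_on extend_map_def)

lemma extend_iso:
  fixes X Y :: "('v, 'a, 'k) rep"
  assumes "linear_rep Q' X" "linear_rep Q' Y" "rep_iso Q' X Y"
  shows "rep_iso Q (rep_on Q' X) (rep_on Q' Y)"
proof -
  obtain f where f: "rep_hom Q' X Y f" "\<And>x. x \<in> verts Q' \<Longrightarrow> bij_betw (f x) (vsp X x) (vsp Y x)"
    using rep_isoE[OF assms(3)] by blast
  show ?thesis
    by (rule rep_isoI[OF extend_hom[OF assms(1,2) f(1)]])
      (use f(2) in \<open>auto simp: vsp_rep_on extend_map_def bij_betw_def\<close>)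
qed

lemma extend_iso_mod_cat:
  "X \<in> mod_cat Q' I' \<Longrightarrow> Y \<in> mod_cat Q' I' \<Longrightarrow> rep_iso Q' X Y \<Longrightarrow> rep_iso Q (rep_on Q' X) (rep_on Q' Y)"
  by (intro extend_iso mod_cat_linear_rep)

lemma extend_short_exact:
  fixes L M N :: "('v, 'a, 'k) rep"
  assumes lin: "linear_rep Q' L" "linear_rep Q' M" "linear_rep Q' N" and ex: "short_exact Q' L M N"
  shows "short_exact Q (rep_on Q' L) (rep_on Q' M) (rep_on Q' N)"
proof -
  obtain f g where fg: "rep_mono Q' L M f" "rep_epi Q' M N g"
      "\<And>x. x \<in> verts Q' \<Longrightarrow> f x ` vsp L x = vsp (rep_ker M g) x"
    using ex by (auto simp: short_exact_def)
  have f: "rep_hom Q' L M f" using fg(1) by (simp add: rep_mono_def)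
  have "rep_mono Q (rep_on Q' L) (rep_on Q' M) (extend_map f)"
    using extend_hom[OF lin(1,2) f] fg(1) by (auto simp: rep_mono_def vsp_rep_on extend_map_def)
  moreover have "rep_epi Q (rep_on Q' M) (rep_on Q' N) (extend_map g)"
    by (rule extend_epi[OF lin(2,3) fg(2)])
  moreover have "extend_map f x ` vsp (rep_on Q' L) x = vsp (rep_ker (rep_on Q' M) (extend_map g)) x" for x
    using fg(3)[of x] by (auto simp: rep_ker_def vsp_rep_on extend_map_def)
  ultimately show ?thesis unfolding short_exact_def by blast
qed

lemma extend_summand:
  assumes "is_summand Q' I' N M" "M \<in> mod_cat Q' I'"
  shows "is_summand Q I (rep_on Q' N) (rep_on Q' M)"
proof -
  obtain N' where N': "N \<in> mod_cat Q' I'" "N' \<in> mod_cat Q' I'" "rep_iso Q' M (rep_sum N N')"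
    using assms by (auto simp: is_summand_def)
  have "rep_iso Q (rep_on Q' M) (rep_sum (rep_on Q' N) (rep_on Q' N'))"
    unfolding rep_on_sum[symmetric] using assms(2) N' by (intro extend_iso_mod_cat small.mod_cat_sum)
  then show ?thesis by (rule big.is_summandI[OF extend_mod_cat[OF N'(1)] extend_mod_cat[OF N'(2)]])
qed

lemma extend_add_cat:
  assumes X: "X \<in> add_cat Q' I' \<C>" and C: "\<C> \<subseteq> mod_cat Q' I'"
  shows "rep_on Q' X \<in> add_cat Q I (rep_on Q' ` \<C>)"
proof -
  obtain Ns where Ns: "\<forall>N\<in>set Ns. \<exists>M\<in>\<C>. is_summand Q' I' N M" "rep_iso Q' X (rep_sum_list Ns)"
    and mX: "X \<in> mod_cat Q' I'" using X by (auto simp: add_cat_def)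
  have "set Ns \<subseteq> mod_cat Q' I'" using Ns(1) small.summand_imp_mod_cat by blast
  then have "rep_iso Q (rep_on Q' X) (rep_sum_list (map (rep_on Q') Ns))"
    unfolding rep_on_sum_list[symmetric] using mX Ns(2) by (intro extend_iso_mod_cat small.mod_cat_sum_list)
  moreover have "\<exists>M\<in>rep_on Q' ` \<C>. is_summand Q I N M" if "N \<in> set (map (rep_on Q') Ns)" for N
    using that Ns(1) C extend_summand by fastforce
  ultimately show ?thesis using extend_mod_cat[OF mX] by (intro big.add_catI)
qed

definition supported :: "('v, 'a, 'k) rep \<Rightarrow> bool" where
  "supported M \<longleftrightarrow> (\<forall>x\<in>verts Q - verts Q'. vsp M x = {0})"

lemma supported_rep_on: "supported (rep_on Q' X)"
  by (simp add: supported_def vsp_rep_on)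

lemma rep_iso_supported:
  assumes M: "linear_rep Q M" and sup: "supported M"
  shows "rep_iso Q (rep_on Q' M) M"
proof (rule rep_isoI)
  have vsp: "vsp (rep_on Q' M) x = vsp M x" if "x \<in> verts Q" for x
    using sup that by (simp add: vsp_rep_on supported_def)
  show "rep_hom Q (rep_on Q' M) M (\<lambda>x v. v)"
  proof (rule rep_homI)
    fix a v assume a: "a \<in> arcs Q" and "v \<in> vsp (rep_on Q' M) (tail Q a)"
    then have v: "v \<in> vsp M (tail Q a)" by (simp add: vsp)
    show "amap (rep_on Q' M) a v = amap M a v"
    proof (cases "a \<in> arcs Q'")
      case False
      have "amap M a v = 0"
      proof (cases "tail Q a \<in> verts Q'")
        case True
        with False a have "head Q a \<in> verts Q - verts Q'" using arcs_iff by auto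
        then show ?thesis using big.amap_in[OF M a v] sup by (auto simp: supported_def)
      next
        case False
        then have "v = 0" using v sup a by (auto simp: supported_def)
        then show ?thesis using big.amap_zero[OF M a] by simp
      qed
      with False show ?thesis by (simp add: amap_rep_on)
    qed (simp add: amap_rep_on)
  qed (simp add: vsp linear_between_id)
  show "bij_betw (\<lambda>v. v) (vsp (rep_on Q' M) x) (vsp M x)" if "x \<in> verts Q" for x
    using vsp[OF that] by (simp add: bij_betw_def)
qed

lemma supported_iso:
  fixes M N :: "('v, 'a, 'k) rep"
  assumes "supported N" "rep_iso Q M N" "linear_rep Q M"
  shows "supported M"
  unfolding supported_def
proof
  fix x assume x: "x \<in> verts Q - verts Q'"
  obtain f where f: "bij_betw (f x) (vsp M x) (vsp N x)"
    using rep_isoE[OF assms(2)] x by (metis DiffD1)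
  have "vsp N x = {0}" using assms(1) x by (simp add: supported_def)
  then have "f x u = 0" if "u \<in> vsp M x" for u using f that by (auto simp: bij_betw_def)
  moreover have 0: "0 \<in> vsp M x" by (rule vect.subspace_0[OF linear_rep_subspace[OF assms(3)]]) (use x in blast)
  ultimately have "u = 0" if "u \<in> vsp M x" for u
    using f that inj_onD[of "f x" "vsp M x" u 0] by (simp add: bij_betw_def)
  with 0 show "vsp M x = {0}" by blast
qed

lemma supported_sum_iff:
  assumes M: "linear_rep Q M" and N: "linear_rep Q N"
  shows "supported (rep_sum M N) \<longleftrightarrow> supported M \<and> supported N"
proof -
  have "vsp (rep_sum M N) x = {0} \<longleftrightarrow> vsp M x = {0} \<and> vsp N x = {0}" if x: "x \<in> verts Q" for x
  proof
    assume s: "vsp (rep_sum M N) x = {0}"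
    have 0: "0 \<in> vsp M x" "0 \<in> vsp N x"
      using linear_rep_subspace[OF M x] linear_rep_subspace[OF N x] by (simp_all add: vect.subspace_0)
    have "u = 0" if "u \<in> vsp M x" for u
    proof -
      have "vpair u 0 \<in> vsp (rep_sum M N) x" using that 0 by (simp add: in_vsp_rep_sum)
      then show ?thesis by (simp add: s)
    qed
    moreover have "v = 0" if "v \<in> vsp N x" for v
    proof -
      have "vpair 0 v \<in> vsp (rep_sum M N) x" using that 0 by (simp add: in_vsp_rep_sum)
      then show ?thesis by (simp add: s)
    qed
    ultimately show "vsp M x = {0} \<and> vsp N x = {0}" using 0 by blast
  next
    assume MN: "vsp M x = {0} \<and> vsp N x = {0}"
    then have "w \<in> vsp (rep_sum M N) x \<longleftrightarrow> vfst w = 0 \<and> vsnd w = 0" for w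
      by (simp add: in_vsp_rep_sum)
    then have "w \<in> vsp (rep_sum M N) x \<longleftrightarrow> w = 0" for w
      by (metis vpair_eq_0D vfst_zero vsnd_zero)
    then show "vsp (rep_sum M N) x = {0}" by blast
  qed
  then have "supported (rep_sum M N) \<longleftrightarrow> (\<forall>x\<in>verts Q - verts Q'. vsp M x = {0} \<and> vsp N x = {0})"
    unfolding supported_def by (intro ball_cong refl) (simp only: Diff_iff)
  then show ?thesis by (simp only: supported_def ball_conj_distrib)
qed

lemma restrict_add_cat:
  assumes X: "X \<in> add_cat Q I \<C>"
  shows "X \<in> add_cat Q' I' \<C>"
proof -
  obtain Ns where Ns: "\<forall>N\<in>set Ns. \<exists>M\<in>\<C>. is_summand Q I N M" "rep_iso Q X (rep_sum_list Ns)"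
    and mX: "X \<in> mod_cat Q I" using X by (auto simp: add_cat_def)
  show ?thesis
    by (rule small.add_catI[OF restrict_mod_cat[OF mX] _ restrict_iso[OF Ns(2)]])
      (use Ns(1) restrict_summand in blast)
qed

end

text \<open>
  If no arrow enters the subquiver from outside, restriction preserves projectivity and radicals, hence
  projective covers and syzygies.
\<close>

locale predecessor_closed_subquiver = convex_subquiver Q I Q' I'
  for Q :: "('v, 'a) quiver" and I :: "(('v, 'a) path \<Rightarrow>\<^sub>0 'k::field) set"
    and Q' :: "('v, 'a) quiver" and I' :: "(('v, 'a) path \<Rightarrow>\<^sub>0 'k) set" +
  assumes predecessors: "a \<in> arcs Q \<Longrightarrow> head Q a \<in> verts Q' \<Longrightarrow> a \<in> arcs Q'"
begin

lemma restrict_rad: "x \<in> verts Q' \<Longrightarrow> rad Q M x = rad Q' M x"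
proof -
  assume x: "x \<in> verts Q'"
  have "{a \<in> arcs Q. head Q a = x} = {a \<in> arcs Q'. head Q' a = x}"
    using x predecessors arc_in_big head_eq by auto
  moreover have "tail Q a = tail Q' a" if "a \<in> arcs Q'" for a using tail_eq[OF that] by simp
  ultimately show ?thesis unfolding rad_def by (intro arg_cong[where f = vect.span] SUP_cong) auto
qed

lemma restrict_projective:
  assumes P: "projective Q I P"
  shows "projective Q' I' P"
  unfolding projective_def
proof (intro conjI ballI allI impI)
  note mP = big.projective_imp_mod_cat[OF P]
  show "P \<in> mod_cat Q' I'" using mP by (rule restrict_mod_cat)
  fix X Y g f assume X: "X \<in> mod_cat Q' I'" and Y: "Y \<in> mod_cat Q' I'"
    and gf: "rep_epi Q' X Y g \<and> rep_hom Q' P Y f"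
  then have f: "rep_hom Q' P Y f" by blast
  have f': "rep_hom Q P (rep_on Q' Y) (extend_map f)"
  proof (rule rep_homI)
    show "linear_between (vsp P x) (vsp (rep_on Q' Y) x) (extend_map f x)" for x
      using rep_hom_linear[OF f] by (auto simp: vsp_rep_on extend_map_def linear_between_def)
    fix a v assume a: "a \<in> arcs Q" and v: "v \<in> vsp P (tail Q a)"
    show "extend_map f (head Q a) (amap P a v) = amap (rep_on Q' Y) a (extend_map f (tail Q a) v)"
    proof (cases "a \<in> arcs Q'")
      case True
      then show ?thesis
        using rep_hom_amap[OF f True, of v] v arcs_iff[of a]
        by (simp add: extend_map_def amap_rep_on tail_eq head_eq)
    next
      case False
      with predecessors[OF a] show ?thesis by (auto simp: extend_map_def amap_rep_on)
    qed
  qed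
  have g': "rep_epi Q (rep_on Q' X) (rep_on Q' Y) (extend_map g)"
    using gf by (intro extend_epi mod_cat_linear_rep[OF X] mod_cat_linear_rep[OF Y]) blast
  obtain h where h: "rep_hom Q P (rep_on Q' X) h"
      "\<And>x v. x \<in> verts Q \<Longrightarrow> v \<in> vsp P x \<Longrightarrow> extend_map g x (h x v) = extend_map f x v"
    using big.projective_lift[OF P extend_mod_cat[OF X] extend_mod_cat[OF Y] g' f'] by blast
  have "rep_hom Q' P X h" using restrict_hom[OF h(1)] by (simp add: rep_hom_rep_on_iff)
  moreover have "g x (h x v) = f x v" if "x \<in> verts Q'" "v \<in> vsp P x" for x v
    using h(2)[OF vertex_in_big[OF that(1)] that(2)] that(1) by (simp add: extend_map_def)
  ultimately show "\<exists>h. rep_hom Q' P X h \<and> (\<forall>x\<in>verts Q'. \<forall>v\<in>vsp P x. g x (h x v) = f x v)" by blast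
qed

lemma restrict_projective_cover:
  assumes M: "M \<in> mod_cat Q I" and P: "projective_cover Q I M P f"
  shows "projective_cover Q' I' M P f"
  using P restrict_projective restrict_epi vertex_in_big restrict_rad
  unfolding big.projective_cover_iff[OF mod_cat_linear_rep[OF M]]
    small.projective_cover_iff[OF mod_cat_linear_rep[OF restrict_mod_cat[OF M]]]
  by blast

lemma restrict_syzygy:
  assumes M: "M \<in> mod_cat Q I" and P: "projective_cover Q I M P f"
  shows "rep_iso Q' (syzygy Q' I' M) (rep_ker P f)"
  using restrict_mod_cat[OF M]
  by (intro small.syzygy_iso_ker[OF _ _ rep_iso_refl restrict_projective_cover[OF M P]])

end

text \<open>
  If no arrow leaves the subquiver, extension by zero has these properties.
\<close>

locale successor_closed_subquiver = convex_subquiver Q I Q' I'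
  for Q :: "('v, 'a) quiver" and I :: "(('v, 'a) path \<Rightarrow>\<^sub>0 'k::field) set"
    and Q' :: "('v, 'a) quiver" and I' :: "(('v, 'a) path \<Rightarrow>\<^sub>0 'k) set" +
  assumes successors: "a \<in> arcs Q \<Longrightarrow> tail Q a \<in> verts Q' \<Longrightarrow> a \<in> arcs Q'"
begin

lemma extend_projective:
  assumes P: "projective Q' I' P"
  shows "projective Q I (rep_on Q' P)"
  unfolding projective_def
proof (intro conjI ballI allI impI)
  note mP = small.projective_imp_mod_cat[OF P]
  note lP = mod_cat_linear_rep[OF mP]
  show "rep_on Q' P \<in> mod_cat Q I" by (rule extend_mod_cat[OF mP])
  fix X Y g f assume X: "X \<in> mod_cat Q I" and Y: "Y \<in> mod_cat Q I"
    and gf: "rep_epi Q X Y g \<and> rep_hom Q (rep_on Q' P) Y f"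
  then have g: "rep_hom Q X Y g" and f: "rep_hom Q (rep_on Q' P) Y f" by (auto simp: rep_epi_def)
  note lX = mod_cat_linear_rep[OF X]
  have "rep_hom Q' P Y f" using restrict_hom[OF f] by (simp add: rep_hom_rep_on_iff)
  then obtain h where h: "rep_hom Q' P X h" "\<And>x v. x \<in> verts Q' \<Longrightarrow> v \<in> vsp P x \<Longrightarrow> g x (h x v) = f x v"
    using small.projective_lift[OF P restrict_mod_cat[OF X] restrict_mod_cat[OF Y] restrict_epi] gf by blast
  have zero: "extend_map h x 0 = 0" for x
    using small.rep_hom_0[OF lP h(1)] by (simp add: extend_map_def)
  have "rep_hom Q (rep_on Q' P) X (extend_map h)"
  proof (rule rep_homI)
    show "linear_between (vsp (rep_on Q' P) x) (vsp X x) (extend_map h x)" if "x \<in> verts Q" for x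
      using rep_hom_linear[OF h(1)] linear_between_const_0[OF linear_rep_subspace[OF lX that]]
      by (simp add: vsp_rep_on extend_map_def)
    fix a v assume a: "a \<in> arcs Q" and v: "v \<in> vsp (rep_on Q' P) (tail Q a)"
    show "extend_map h (head Q a) (amap (rep_on Q' P) a v) = amap X a (extend_map h (tail Q a) v)"
    proof (cases "a \<in> arcs Q'")
      case True
      then show ?thesis
        using rep_hom_amap[OF h(1) True, of v] v arcs_iff[of a]
        by (simp add: extend_map_def amap_rep_on vsp_rep_on tail_eq head_eq)
    next
      case False
      then have "tail Q a \<notin> verts Q'" using successors[OF a] by blast
      then have "v = 0" using v by (simp add: vsp_rep_on)
      with False show ?thesis by (simp add: amap_rep_on zero big.amap_zero[OF lX a])
    qed
  qed
  moreover have "g x (extend_map h x v) = f x v" if x: "x \<in> verts Q" and v: "v \<in> vsp (rep_on Q' P) x" for x v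
  proof (cases "x \<in> verts Q'")
    case True
    then show ?thesis using h(2) v by (simp add: extend_map_def vsp_rep_on)
  next
    case False
    then have "v = 0" using v by (simp add: vsp_rep_on)
    then show ?thesis
      using big.rep_hom_0[OF lX g x] big.rep_hom_0[OF extend_linear_rep[OF lP] f x] zero by simp
  qed
  ultimately show "\<exists>h. rep_hom Q (rep_on Q' P) X h \<and>
      (\<forall>x\<in>verts Q. \<forall>v\<in>vsp (rep_on Q' P) x. g x (h x v) = f x v)" by blast
qed

lemma extend_rad: "x \<in> verts Q' \<Longrightarrow> rad Q' X x \<subseteq> rad Q (rep_on Q' X) x"
proof (rule small.rad_minimal[OF big.subspace_rad])
  fix a v assume a: "a \<in> arcs Q'" and hd: "head Q' a = x" and v: "v \<in> vsp X (tail Q' a)"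
  have "v \<in> vsp (rep_on Q' X) (tail Q a)" using a v arcs_iff[of a] by (simp add: vsp_rep_on tail_eq)
  from big.amap_in_rad[OF arc_in_big[OF a] this]
  show "amap X a v \<in> rad Q (rep_on Q' X) x" using a hd by (simp add: amap_rep_on head_eq)
qed

lemma extend_projective_cover:
  assumes X: "X \<in> mod_cat Q' I'" and P: "projective_cover Q' I' X P f"
  shows "projective_cover Q I (rep_on Q' X) (rep_on Q' P) (extend_map f)"
proof -
  have P': "projective Q' I' P" and f: "rep_epi Q' P X f"
    and ker: "\<And>x v. x \<in> verts Q' \<Longrightarrow> v \<in> vsp P x \<Longrightarrow> f x v = 0 \<Longrightarrow> v \<in> rad Q' P x"
    using P unfolding small.projective_cover_iff[OF mod_cat_linear_rep[OF X]] by auto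
  have "v \<in> rad Q (rep_on Q' P) x"
    if "x \<in> verts Q" "v \<in> vsp (rep_on Q' P) x" "extend_map f x v = 0" for x v
  proof (cases "x \<in> verts Q'")
    case True
    then show ?thesis using ker[OF True] extend_rad[OF True] that by (auto simp: vsp_rep_on extend_map_def)
  next
    case False
    with that have "v = 0" by (simp add: vsp_rep_on)
    then show ?thesis using vect.subspace_0[OF big.subspace_rad[of "rep_on Q' P"]] by simp
  qed
  moreover have "rep_epi Q (rep_on Q' P) (rep_on Q' X) (extend_map f)"
    using X small.projective_imp_mod_cat[OF P'] f by (intro extend_epi mod_cat_linear_rep)
  ultimately show ?thesis
    unfolding big.projective_cover_iff[OF mod_cat_linear_rep[OF extend_mod_cat[OF X]]]
    using extend_projective[OF P'] by blast
qed

lemma rep_ker_extend: "rep_ker (rep_on Q' P) (extend_map f) = rep_on Q' (rep_ker P f)"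
proof (rule rep.equality)
  show "vsp (rep_ker (rep_on Q' P) (extend_map f)) = vsp (rep_on Q' (rep_ker P f))"
    by (rule ext) (auto simp: rep_ker_def vsp_rep_on extend_map_def)
  show "amap (rep_ker (rep_on Q' P) (extend_map f)) = amap (rep_on Q' (rep_ker P f))"
    by (rule ext) (simp add: rep_ker_def amap_rep_on)
qed simp

lemma extend_syzygy:
  assumes X: "X \<in> mod_cat Q' I'"
  shows "rep_iso Q (syzygy Q I (rep_on Q' X)) (rep_on Q' (syzygy Q' I' X))"
proof -
  obtain P f where P: "projective_cover Q' I' X P f" "syzygy Q' I' X = rep_ker P f"
    using small.syzygy_cover[OF X] by blast
  from big.syzygy_iso_ker[OF extend_mod_cat[OF X] extend_mod_cat[OF X] rep_iso_refl
      extend_projective_cover[OF X P(1)]]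
  show ?thesis unfolding P(2) rep_ker_extend .
qed

lemma extend_syzygy_funpow:
  assumes X: "X \<in> mod_cat Q' I'"
  shows "rep_iso Q ((syzygy Q I ^^ n) (rep_on Q' X)) (rep_on Q' ((syzygy Q' I' ^^ n) X))"
proof (induction n)
  case (Suc n)
  note mods = extend_mod_cat[OF X] small.syzygy_funpow_mod_cat[OF X, of n]
  have "rep_iso Q (syzygy Q I ((syzygy Q I ^^ n) (rep_on Q' X)))
      (syzygy Q I (rep_on Q' ((syzygy Q' I' ^^ n) X)))"
    by (rule big.syzygy_iso[OF big.syzygy_funpow_mod_cat[OF mods(1)] extend_mod_cat[OF mods(2)] Suc])
  from big.rep_iso_trans[OF this extend_syzygy[OF mods(2)]] show ?case by simp
qed (simp add: rep_iso_refl)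

end


section \<open>The group \<open>K\<^sub>0\<close>\<close>

definition frag_map :: "('x \<Rightarrow> 'y) \<Rightarrow> ('x \<Rightarrow>\<^sub>0 int) \<Rightarrow> ('y \<Rightarrow>\<^sub>0 int)" where
  "frag_map F = frag_extend (\<lambda>M. frag_of (F M))"

lemma frag_map_zero [simp]: "frag_map F 0 = 0"
  and frag_map_of [simp]: "frag_map F (frag_of M) = frag_of (F M)"
  and frag_map_add: "frag_map F (a + b) = frag_map F a + frag_map F b"
  and frag_map_minus: "frag_map F (- a) = - frag_map F a"
  and frag_map_diff: "frag_map F (a - b) = frag_map F a - frag_map F b"
  by (simp_all add: frag_map_def frag_extend_add frag_extend_minus frag_extend_diff)

lemma keys_frag_map: "Poly_Mapping.keys (frag_map F c) \<subseteq> F ` Poly_Mapping.keys c"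
  using keys_frag_extend[of "\<lambda>M. frag_of (F M)" c] by (auto simp: frag_map_def)

lemma frag_map_funpow_diff:
  fixes F :: "'x \<Rightarrow> 'x"
  shows "(frag_map F ^^ m) (a - b) = (frag_map F ^^ m) a - (frag_map F ^^ m) b"
  by (induction m) (simp_all add: frag_map_diff)

lemma keys_frag_map_funpow:
  fixes F :: "'x \<Rightarrow> 'x"
  assumes "F ` S \<subseteq> S" "Poly_Mapping.keys c \<subseteq> S"
  shows "Poly_Mapping.keys ((frag_map F ^^ m) c) \<subseteq> S"
proof (induction m)
  case (Suc m)
  then have "Poly_Mapping.keys (frag_map F ((frag_map F ^^ m) c)) \<subseteq> S"
    using keys_frag_map[of F "(frag_map F ^^ m) c"] assms(1) by blast
  then show ?case by (simp only: funpow.simps o_apply)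
qed (use assms in simp)

context bound_quiver_algebra
begin

abbreviation "free_group \<equiv> free_Abelian_group (mod_cat Q I)"

lemma relations_generators_subset:
  "{frag_of M - (frag_of M' + frag_of M'') | M M' M''.
      M \<in> mod_cat Q I \<and> M' \<in> mod_cat Q I \<and> M'' \<in> mod_cat Q I \<and> rep_iso Q M (rep_sum M' M'')} \<union>
   {frag_of P | P. projective Q I P} \<subseteq> carrier free_group"
proof -
  have "frag_of M - (frag_of M' + frag_of M'') \<in> carrier free_group"
    if "M \<in> mod_cat Q I" "M' \<in> mod_cat Q I" "M'' \<in> mod_cat Q I" for M M' M''
  proof -
    have "Poly_Mapping.keys (frag_of M - (frag_of M' + frag_of M'')) \<subseteq>
        Poly_Mapping.keys (frag_of M) \<union> (Poly_Mapping.keys (frag_of M') \<union> Poly_Mapping.keys (frag_of M''))"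
      using keys_diff[of "frag_of M" "frag_of M' + frag_of M''"]
        Poly_Mapping.keys_add[of "frag_of M'" "frag_of M''"] by blast
    then show ?thesis using that by auto
  qed
  then show ?thesis using projective_imp_mod_cat by auto
qed

lemma subgroup_relations: "subgroup (K0_relations Q I) free_group"
  unfolding K0_relations_def
  by (rule group.generate_is_subgroup[OF group_free_Abelian_group relations_generators_subset])

lemma relations_keys: "c \<in> K0_relations Q I \<Longrightarrow> Poly_Mapping.keys c \<subseteq> mod_cat Q I"
  using subsetD[OF subgroup.subset[OF subgroup_relations]]
  by (simp only: carrier_free_Abelian_group_iff)

lemma relations_zero: "0 \<in> K0_relations Q I"
  using subgroup.one_closed[OF subgroup_relations] by simp

lemma relations_add: "a \<in> K0_relations Q I \<Longrightarrow> b \<in> K0_relations Q I \<Longrightarrow> a + b \<in> K0_relations Q I"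
  using subgroup.m_closed[OF subgroup_relations, of a b] by simp

lemma relations_minus: "a \<in> K0_relations Q I \<Longrightarrow> - a \<in> K0_relations Q I"
  using subgroup.m_inv_closed[OF subgroup_relations, of a] relations_keys[of a] by simp

lemma relations_diff: "a \<in> K0_relations Q I \<Longrightarrow> b \<in> K0_relations Q I \<Longrightarrow> a - b \<in> K0_relations Q I"
  using relations_add[of a "- b"] relations_minus[of b] by simp

lemma relations_sum:
  "M \<in> mod_cat Q I \<Longrightarrow> M' \<in> mod_cat Q I \<Longrightarrow> M'' \<in> mod_cat Q I \<Longrightarrow> rep_iso Q M (rep_sum M' M'') \<Longrightarrow>
     frag_of M - (frag_of M' + frag_of M'') \<in> K0_relations Q I"
  unfolding K0_relations_def by (rule generate.incl) blast

lemma relations_projective: "projective Q I P \<Longrightarrow> frag_of P \<in> K0_relations Q I"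
  unfolding K0_relations_def by (rule generate.incl) blast

lemma relations_iso:
  assumes "M \<in> mod_cat Q I" "N \<in> mod_cat Q I" "rep_iso Q M N"
  shows "frag_of M - frag_of N \<in> K0_relations Q I"
proof -
  have "projective Q I rep_zero" by (rule projective_zero[OF mod_cat_zero]) (simp add: rep_zero_def)
  then have z: "frag_of rep_zero \<in> K0_relations Q I" by (rule relations_projective)
  have "rep_iso Q N (rep_sum N rep_zero)"
    using rep_iso_sym[OF mod_cat_linear_rep[OF mod_cat_sum[OF assms(2) mod_cat_zero]] rep_iso_sum_rep_zero(1)] .
  then have "frag_of M - (frag_of N + frag_of rep_zero) \<in> K0_relations Q I"
    using assms rep_iso_trans mod_cat_zero by (intro relations_sum) blast+
  from relations_add[OF this z] show ?thesis by simp
qed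

lemma relations_cong:
  assumes "Poly_Mapping.keys c \<subseteq> S"
    and "\<And>M. M \<in> S \<Longrightarrow> frag_of (F M) - frag_of (G M) \<in> K0_relations Q I"
  shows "frag_map F c - frag_map G c \<in> K0_relations Q I"
  using assms(1)
proof (induction c rule: frag_induction)
  case (diff a b)
  from relations_diff[OF this] show ?case by (simp add: frag_map_diff algebra_simps)
qed (simp_all add: relations_zero assms(2))

text \<open>
  An operation on modules that respects direct sums up to isomorphism and preserves projectivity
  induces a homomorphism on \<open>K\<^sub>0\<close>.
\<close>

lemma relations_map:
  assumes "bound_quiver_algebra Q2 I2"
    and sum: "\<And>M M' M''. M \<in> mod_cat Q I \<Longrightarrow> M' \<in> mod_cat Q I \<Longrightarrow> M'' \<in> mod_cat Q I \<Longrightarrow>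
      rep_iso Q M (rep_sum M' M'') \<Longrightarrow> rep_iso Q2 (F M) (rep_sum (F M') (F M''))"
    and mods: "\<And>M. M \<in> mod_cat Q I \<Longrightarrow> F M \<in> mod_cat Q2 I2"
    and proj: "\<And>P. projective Q I P \<Longrightarrow> projective Q2 I2 (F P)"
    and c: "c \<in> K0_relations Q I"
  shows "frag_map F c \<in> K0_relations Q2 I2"
proof -
  interpret target: bound_quiver_algebra Q2 I2 by fact
  show ?thesis
    using c unfolding K0_relations_def[of Q I]
  proof (induction c rule: generate.induct)
    case one
    then show ?case by (simp add: target.relations_zero)
  next
    case (incl h)
    then show ?case
      using sum mods proj
      by (auto simp: frag_map_diff frag_map_add intro!: target.relations_sum target.relations_projective)
  next
    case (inv h)
    then have "h \<in> carrier free_group" using relations_generators_subset by blast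
    moreover have "frag_map F h \<in> K0_relations Q2 I2"
      using inv sum mods proj
      by (auto simp: frag_map_diff frag_map_add intro!: target.relations_sum target.relations_projective)
    ultimately show ?case by (simp add: frag_map_minus target.relations_minus)
  next
    case (eng h1 h2)
    then show ?case by (simp add: frag_map_add target.relations_add)
  qed
qed

lemma K0_proj_eq: "K0_proj Q I c = {r + c | r. r \<in> K0_relations Q I}"
  by (auto simp: K0_proj_def r_coset_def)

lemma in_K0_proj_iff: "d \<in> K0_proj Q I c \<longleftrightarrow> d - c \<in> K0_relations Q I"
  unfolding K0_proj_eq by (auto intro: exI[of _ "d - c"])

lemma K0_proj_eq_iff: "K0_proj Q I c = K0_proj Q I d \<longleftrightarrow> c - d \<in> K0_relations Q I"
proof
  assume "K0_proj Q I c = K0_proj Q I d"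
  moreover have "c \<in> K0_proj Q I c" by (simp add: in_K0_proj_iff relations_zero)
  ultimately show "c - d \<in> K0_relations Q I" by (simp add: in_K0_proj_iff)
next
  assume cd: "c - d \<in> K0_relations Q I"
  have "e - c \<in> K0_relations Q I \<longleftrightarrow> e - d \<in> K0_relations Q I" for e
    using relations_add[OF _ cd, of "e - c"] relations_diff[OF _ cd, of "e - d"] by auto
  then show "K0_proj Q I c = K0_proj Q I d" by (auto simp: in_K0_proj_iff)
qed

lemma syzygy_respects_sum:
  assumes "M \<in> mod_cat Q I" "M' \<in> mod_cat Q I" "M'' \<in> mod_cat Q I" "rep_iso Q M (rep_sum M' M'')"
  shows "rep_iso Q (syzygy Q I M) (rep_sum (syzygy Q I M') (syzygy Q I M''))"
  using rep_iso_trans[OF syzygy_iso[OF assms(1) mod_cat_sum[OF assms(2,3)] assms(4)] syzygy_sum[OF assms(2,3)]] .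

abbreviation "\<omega> \<equiv> frag_map (syzygy Q I)"

lemma syzygy_relations:
  assumes "c \<in> K0_relations Q I"
  shows "\<omega> c \<in> K0_relations Q I"
proof (rule relations_map[OF bound_quiver_algebra_axioms, where F = "syzygy Q I"])
  show "c \<in> K0_relations Q I" by (rule assms)
next
  fix M M' M''
  assume "M \<in> mod_cat Q I" "M' \<in> mod_cat Q I" "M'' \<in> mod_cat Q I" "rep_iso Q M (rep_sum M' M'')"
  then show "rep_iso Q (syzygy Q I M) (rep_sum (syzygy Q I M') (syzygy Q I M''))"
    by (rule syzygy_respects_sum)
next
  fix M assume "M \<in> mod_cat Q I"
  then show "syzygy Q I M \<in> mod_cat Q I" by (rule syzygy_mod_cat)
next
  fix P assume P: "projective Q I P"
  show "projective Q I (syzygy Q I P)"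
    by (rule projective_zero[OF syzygy_mod_cat[OF projective_imp_mod_cat[OF P]] syzygy_projective[OF P]])
qed

lemma K0_syzygy_proj: "K0_syzygy Q I (K0_proj Q I c) = K0_proj Q I (\<omega> c)"
proof -
  have "K0_proj Q I (\<omega> d) = K0_proj Q I (\<omega> c)" if "d \<in> K0_proj Q I c" for d
    using syzygy_relations[of "d - c"] that by (simp add: K0_proj_eq_iff in_K0_proj_iff frag_map_diff)
  moreover have "c \<in> K0_proj Q I c" by (simp add: in_K0_proj_iff relations_zero)
  ultimately have "(\<lambda>d. K0_proj Q I (\<omega> d)) ` K0_proj Q I c = {K0_proj Q I (\<omega> c)}" by blast
  then show ?thesis by (simp add: K0_syzygy_def frag_map_def)
qed

lemma K0_syzygy_funpow_proj: "(K0_syzygy Q I ^^ m) (K0_proj Q I c) = K0_proj Q I ((\<omega> ^^ m) c)"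
  by (induction m) (simp_all add: K0_syzygy_proj)

text \<open>
  The classes of summands generate the image of the free group on the summands. So everything about
  \<open>\<phi>\<close> can be expressed by representatives in the free group.
\<close>

lemma K0_subgroup_eq:
  "K0_subgroup Q I \<C> = K0_proj Q I ` {c. Poly_Mapping.keys c \<subseteq> {N. \<exists>M\<in>\<C>. is_summand Q I N M}}"
proof
  let ?S = "{N. \<exists>M\<in>\<C>. is_summand Q I N M}"
  have S: "?S \<subseteq> mod_cat Q I" by (auto intro: summand_imp_mod_cat)
  interpret F: comm_group free_group by (rule abelian_free_Abelian_group)
  interpret R: normal "K0_relations Q I" free_group
    by (rule F.subgroup_imp_normal[OF subgroup_relations])
  interpret G: group "K0 Q I" unfolding K0_def by (rule R.factorgroup_is_group)
  have mult: "K0_proj Q I a \<otimes>\<^bsub>K0 Q I\<^esub> K0_proj Q I b = K0_proj Q I (a + b)"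
    if "a \<in> carrier free_group" "b \<in> carrier free_group" for a b
    using R.rcos_sum[OF that] by (simp add: K0_def K0_proj_def)
  have carr: "K0_proj Q I a \<in> carrier (K0 Q I)" if "a \<in> carrier free_group" for a
    using that by (auto simp: K0_def K0_proj_def FactGroup_def RCOSETS_def)
  have inv: "inv\<^bsub>K0 Q I\<^esub> (K0_proj Q I a) = K0_proj Q I (- a)" if a: "a \<in> carrier free_group" for a
  proof -
    from carr[OF a] have "inv\<^bsub>K0 Q I\<^esub> (K0_proj Q I a) = set_inv\<^bsub>free_group\<^esub> (K0_proj Q I a)"
      unfolding K0_def by (rule R.inv_FactGroup)
    then show ?thesis using R.rcos_inv[OF a] a by (simp add: K0_proj_def)
  qed
  have one: "\<one>\<^bsub>K0 Q I\<^esub> = K0_proj Q I 0"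
    by (simp add: K0_def in_K0_proj_iff set_eq_iff)
  show "K0_subgroup Q I \<C> \<subseteq> K0_proj Q I ` {c. Poly_Mapping.keys c \<subseteq> ?S}"
  proof
    fix X assume "X \<in> K0_subgroup Q I \<C>"
    then show "X \<in> K0_proj Q I ` {c. Poly_Mapping.keys c \<subseteq> ?S}"
      unfolding K0_subgroup_def
    proof (induction rule: generate.induct)
      case one
      then show ?case unfolding \<open>\<one>\<^bsub>K0 Q I\<^esub> = K0_proj Q I 0\<close> by (rule imageI) simp
    next
      case (incl h)
      then obtain N where "h = K0_proj Q I (frag_of N)" "N \<in> ?S" by (auto simp: K0_class_def)
      then show ?case by auto
    next
      case (inv h)
      then obtain N where N: "h = K0_proj Q I (frag_of N)" "N \<in> ?S" by (auto simp: K0_class_def)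
      then have "inv\<^bsub>K0 Q I\<^esub> h = K0_proj Q I (- frag_of N)"
        using S \<open>\<And>a. a \<in> carrier free_group \<Longrightarrow> inv\<^bsub>K0 Q I\<^esub> (K0_proj Q I a) = K0_proj Q I (- a)\<close> by auto
      then show ?case using N by (intro image_eqI[of _ _ "- frag_of N"]) auto
    next
      case (eng h1 h2)
      then obtain c1 c2 where c: "h1 = K0_proj Q I c1" "Poly_Mapping.keys c1 \<subseteq> ?S"
        "h2 = K0_proj Q I c2" "Poly_Mapping.keys c2 \<subseteq> ?S" by auto
      then have "h1 \<otimes>\<^bsub>K0 Q I\<^esub> h2 = K0_proj Q I (c1 + c2)" using S by (simp add: mult subset_trans)
      moreover have "Poly_Mapping.keys (c1 + c2) \<subseteq> ?S" using c Poly_Mapping.keys_add[of c1 c2] by blast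
      ultimately show ?case by blast
    qed
  qed
  have gens: "{K0_class Q I N | N. \<exists>M\<in>\<C>. is_summand Q I N M} \<subseteq> carrier (K0 Q I)"
  proof safe
    fix N M assume "M \<in> \<C>" "is_summand Q I N M"
    then have "N \<in> mod_cat Q I" by (blast intro: summand_imp_mod_cat)
    then show "K0_class Q I N \<in> carrier (K0 Q I)" unfolding K0_class_def by (intro carr) simp
  qed
  show "K0_proj Q I ` {c. Poly_Mapping.keys c \<subseteq> ?S} \<subseteq> K0_subgroup Q I \<C>"
  proof safe
    fix c :: "('v, 'a, 'k) rep \<Rightarrow>\<^sub>0 int" assume "Poly_Mapping.keys c \<subseteq> ?S"
    then have "K0_proj Q I c \<in> K0_subgroup Q I \<C> \<and> c \<in> carrier free_group"
      unfolding K0_subgroup_def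
    proof (induction c rule: frag_induction)
      case zero
      show ?case using generate.one[of "K0 Q I"] by (simp add: one)
    next
      case (one N)
      then show ?case using S by (auto intro: generate.incl simp: K0_class_def)
    next
      case (diff a b)
      then have "K0_proj Q I a \<otimes>\<^bsub>K0 Q I\<^esub> inv\<^bsub>K0 Q I\<^esub> (K0_proj Q I b) \<in>
          generate (K0 Q I) {K0_class Q I N | N. \<exists>M\<in>\<C>. is_summand Q I N M}"
        by (intro generate.eng G.generate_m_inv_closed[OF gens]) auto
      moreover have "- b \<in> carrier free_group" using diff by simp
      ultimately have "K0_proj Q I (a - b) \<in>
          generate (K0 Q I) {K0_class Q I N | N. \<exists>M\<in>\<C>. is_summand Q I N M}"
        using diff mult[of a "- b"] inv[of b] by simp
      moreover have "a - b \<in> carrier free_group" using diff keys_diff[of a b] by auto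
      ultimately show ?case by blast
    qed
    then show "K0_proj Q I c \<in> K0_subgroup Q I \<C>" by blast
  qed
qed

lemma enat_Inf_eq_0_iff: "Inf A = (0 :: enat) \<longleftrightarrow> 0 \<in> A"
proof
  assume "Inf A = 0"
  then have "A \<noteq> {}" by (auto simp: Inf_enat_def)
  then have "Inf A \<in> A" by (auto simp: Inf_enat_def intro: LeastI_ex)
  with \<open>Inf A = 0\<close> show "0 \<in> A" by simp
qed (auto intro: antisym Inf_lower)

lemma IT_phi_eq_0_iff:
  "IT_phi Q I M = 0 \<longleftrightarrow>
     (\<forall>m c. Poly_Mapping.keys c \<subseteq> {N. \<exists>M'\<in>add_cat Q I {M}. is_summand Q I N M'} \<longrightarrow>
        (\<omega> ^^ Suc m) c \<in> K0_relations Q I \<longrightarrow> (\<omega> ^^ m) c \<in> K0_relations Q I)"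
    (is "_ \<longleftrightarrow> (\<forall>m c. Poly_Mapping.keys c \<subseteq> ?S \<longrightarrow> _ \<longrightarrow> _)")
proof -
  let ?H = "\<lambda>m. (K0_syzygy Q I ^^ m) ` K0_subgroup Q I (add_cat Q I {M})"
  have H: "?H m = (\<lambda>c. K0_proj Q I ((\<omega> ^^ m) c)) ` {c. Poly_Mapping.keys c \<subseteq> ?S}" for m
    unfolding K0_subgroup_eq image_image K0_syzygy_funpow_proj ..
  have "inj_on (K0_syzygy Q I) (?H m) \<longleftrightarrow>
      (\<forall>c. Poly_Mapping.keys c \<subseteq> ?S \<longrightarrow> (\<omega> ^^ Suc m) c \<in> K0_relations Q I \<longrightarrow> (\<omega> ^^ m) c \<in> K0_relations Q I)"
    (is "_ \<longleftrightarrow> ?r m") for m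
  proof
    assume inj: "inj_on (K0_syzygy Q I) (?H m)"
    show "?r m"
    proof (intro allI impI)
      fix c assume c: "Poly_Mapping.keys c \<subseteq> ?S" "(\<omega> ^^ Suc m) c \<in> K0_relations Q I"
      have "K0_proj Q I ((\<omega> ^^ m) 0) \<in> ?H m" "K0_proj Q I ((\<omega> ^^ m) c) \<in> ?H m"
        unfolding H using c(1) by (auto intro!: imageI)
      moreover have "(\<omega> ^^ m) 0 = 0" by (induction m) simp_all
      moreover from this have "K0_syzygy Q I (K0_proj Q I ((\<omega> ^^ m) c)) = K0_syzygy Q I (K0_proj Q I ((\<omega> ^^ m) 0))"
        using c(2) by (simp add: K0_syzygy_proj K0_proj_eq_iff)
      ultimately have "K0_proj Q I ((\<omega> ^^ m) c) = K0_proj Q I 0" using inj by (metis inj_onD)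
      then show "(\<omega> ^^ m) c \<in> K0_relations Q I" by (simp add: K0_proj_eq_iff)
    qed
  next
    assume r: "?r m"
    show "inj_on (K0_syzygy Q I) (?H m)"
      unfolding H
    proof (rule inj_onI)
      fix X Y assume "X \<in> (\<lambda>c. K0_proj Q I ((\<omega> ^^ m) c)) ` {c. Poly_Mapping.keys c \<subseteq> ?S}"
        "Y \<in> (\<lambda>c. K0_proj Q I ((\<omega> ^^ m) c)) ` {c. Poly_Mapping.keys c \<subseteq> ?S}"
        and eq: "K0_syzygy Q I X = K0_syzygy Q I Y"
      then obtain a b where ab: "X = K0_proj Q I ((\<omega> ^^ m) a)" "Poly_Mapping.keys a \<subseteq> ?S"
        "Y = K0_proj Q I ((\<omega> ^^ m) b)" "Poly_Mapping.keys b \<subseteq> ?S" by auto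
      have "Poly_Mapping.keys (a - b) \<subseteq> ?S" using ab keys_diff[of a b] by blast
      moreover have "(\<omega> ^^ Suc m) (a - b) \<in> K0_relations Q I"
        using eq by (simp add: ab K0_syzygy_proj K0_proj_eq_iff frag_map_funpow_diff frag_map_diff)
      ultimately have "(\<omega> ^^ m) (a - b) \<in> K0_relations Q I" using r by blast
      then show "X = Y" by (simp add: ab K0_proj_eq_iff frag_map_funpow_diff)
    qed
  qed
  moreover have "IT_phi Q I M = 0 \<longleftrightarrow> (\<forall>m. inj_on (K0_syzygy Q I) (?H m))"
    unfolding IT_phi_def enat_Inf_eq_0_iff by (auto simp: zero_enat_def)
  ultimately show ?thesis by blast
qed

lemma IT_phi_dim_eq_0_iff: "IT_phi_dim Q I \<D> = 0 \<longleftrightarrow> (\<forall>M\<in>\<D>. IT_phi Q I M = 0)"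
proof
  assume "IT_phi_dim Q I \<D> = 0"
  then have "IT_phi Q I M \<le> 0" if "M \<in> \<D>" for M
    unfolding IT_phi_dim_def using SUP_upper[OF that, of "IT_phi Q I"] by simp
  then show "\<forall>M\<in>\<D>. IT_phi Q I M = 0" by simp
next
  assume "\<forall>M\<in>\<D>. IT_phi Q I M = 0"
  then have "(SUP M\<in>\<D>. IT_phi Q I M) \<le> 0" by (intro SUP_least) simp
  then show "IT_phi_dim Q I \<D> = 0" by (simp add: IT_phi_dim_def)
qed

end


section \<open>Igusa--Todorov subcategories of a successor closed subquiver\<close>

context successor_closed_subquiver
begin

lemma supported_summand:
  assumes L: "is_summand Q I L N" and N: "N \<in> mod_cat Q I" and sup: "supported N"
  shows "supported L"
proof -
  obtain L' where L': "L \<in> mod_cat Q I" "L' \<in> mod_cat Q I" "rep_iso Q N (rep_sum L L')"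
    using L by (auto simp: is_summand_def)
  note lin = mod_cat_linear_rep[OF L'(1)] mod_cat_linear_rep[OF L'(2)] mod_cat_linear_rep[OF N]
  have "supported (rep_sum L L')"
    by (rule supported_iso[OF sup big.rep_iso_sym[OF lin(3) L'(3)] big.linear_rep_sum[OF lin(1,2)]])
  then show ?thesis using supported_sum_iff[OF lin(1,2)] by blast
qed

lemma supported_sum_list:
  "set Ns \<subseteq> {N \<in> mod_cat Q I. supported N} \<Longrightarrow> supported (rep_sum_list Ns)"
proof (induction Ns)
  case Nil
  show ?case by (simp add: supported_def rep_zero_def)
next
  case (Cons N Ns)
  then have "N \<in> mod_cat Q I" "rep_sum_list Ns \<in> mod_cat Q I"
    by (auto intro: big.mod_cat_sum_list)
  with Cons show ?case
    using supported_sum_iff[OF mod_cat_linear_rep mod_cat_linear_rep] by auto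
qed

lemma supported_add_cat:
  assumes X: "X \<in> add_cat Q I \<C>" and C: "\<And>M. M \<in> \<C> \<Longrightarrow> M \<in> mod_cat Q I \<and> supported M"
  shows "supported X"
proof -
  obtain Ns where Ns: "\<forall>N\<in>set Ns. \<exists>M\<in>\<C>. is_summand Q I N M" "rep_iso Q X (rep_sum_list Ns)"
    and mX: "X \<in> mod_cat Q I" using X by (auto simp: add_cat_def)
  have "set Ns \<subseteq> {N \<in> mod_cat Q I. supported N}"
    using Ns(1) C supported_summand big.summand_imp_mod_cat by blast
  from supported_iso[OF supported_sum_list[OF this] Ns(2) mod_cat_linear_rep[OF mX]] show ?thesis .
qed

lemma syzygy_supported:
  assumes M: "M \<in> mod_cat Q I" and sup: "supported M"
  shows "supported (syzygy Q I M)" and "rep_iso Q' (syzygy Q I M) (syzygy Q' I' M)"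
proof -
  note M' = restrict_mod_cat[OF M]
  note E = extend_mod_cat[OF M'] and S = big.syzygy_mod_cat[OF M]
  have "rep_iso Q M (rep_on Q' M)"
    by (rule big.rep_iso_sym[OF extend_linear_rep[OF mod_cat_linear_rep[OF M']]
          rep_iso_supported[OF mod_cat_linear_rep[OF M] sup]])
  from big.rep_iso_trans[OF big.syzygy_iso[OF M E this] extend_syzygy[OF M']]
  have iso: "rep_iso Q (syzygy Q I M) (rep_on Q' (syzygy Q' I' M))" .
  show "supported (syzygy Q I M)"
    by (rule supported_iso[OF supported_rep_on iso mod_cat_linear_rep[OF S]])
  show "rep_iso Q' (syzygy Q I M) (syzygy Q' I' M)"
    by (rule small.rep_iso_trans[OF restrict_iso[OF iso] rep_iso_rep_on])
qed

text \<open>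
  Restriction is not defined on \<open>K\<^sub>0\<close>, since the restriction of a projective need not be projective.
  But the syzygy of a projective vanishes, so restriction after one syzygy is defined; on modules
  supported on the subquiver it agrees with the syzygy there. Hence a relation in the large group becomes, one
  syzygy later, a relation in the small one, and injectivity of the syzygy in two consecutive degrees
  of the small group gives injectivity in the large one.
\<close>

lemma IT_phi_supported:
  assumes M: "M \<in> mod_cat Q I" and sup: "supported M" and phi: "IT_phi Q' I' M = 0"
  shows "IT_phi Q I M = 0"
  unfolding big.IT_phi_eq_0_iff
proof (intro allI impI)
  fix m c
  assume keys: "Poly_Mapping.keys c \<subseteq> {N. \<exists>M'\<in>add_cat Q I {M}. is_summand Q I N M'}"
    and rel: "(big.\<omega> ^^ Suc m) c \<in> K0_relations Q I"
  let ?T = "{N \<in> mod_cat Q I. supported N}"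
  have keysT: "Poly_Mapping.keys c \<subseteq> ?T"
    using keys supported_summand supported_add_cat[of _ "{M}"] M sup big.summand_imp_mod_cat
      big.add_cat_imp_mod_cat by blast
  have T_syz: "syzygy Q I ` ?T \<subseteq> ?T" using syzygy_supported(1) big.syzygy_mod_cat by blast
  have keysT_pow: "Poly_Mapping.keys ((big.\<omega> ^^ k) c) \<subseteq> ?T" for k
    by (rule keys_frag_map_funpow[OF T_syz keysT])
  have keys': "Poly_Mapping.keys c \<subseteq> {N. \<exists>M'\<in>add_cat Q' I' {M}. is_summand Q' I' N M'}"
    using keys restrict_add_cat restrict_summand by blast
  \<comment> \<open>The hypothesis on \<open>M\<close> over the subquiver: relations can be traced back along the syzygy.\<close>
  have down: "(small.\<omega> ^^ Suc k) c \<in> K0_relations Q' I' \<Longrightarrow> (small.\<omega> ^^ k) c \<in> K0_relations Q' I'" for k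
    using phi keys' unfolding small.IT_phi_eq_0_iff by blast
  have compare: "(big.\<omega> ^^ k) c - (small.\<omega> ^^ k) c \<in> K0_relations Q' I'" for k
  proof (induction k)
    case (Suc k)
    have "big.\<omega> ((big.\<omega> ^^ k) c) - small.\<omega> ((big.\<omega> ^^ k) c) \<in> K0_relations Q' I'"
    proof (rule small.relations_cong[OF keysT_pow])
      fix N assume N: "N \<in> ?T"
      then show "frag_of (syzygy Q I N) - frag_of (syzygy Q' I' N) \<in> K0_relations Q' I'"
        using syzygy_supported(2) big.syzygy_mod_cat small.syzygy_mod_cat restrict_mod_cat
        by (intro small.relations_iso) blast+
    qed
    from small.relations_add[OF this small.syzygy_relations[OF Suc]]
    show ?case by (simp add: frag_map_diff)
  qed (simp add: small.relations_zero)
  have "big.\<omega> ((big.\<omega> ^^ Suc m) c) \<in> K0_relations Q' I'"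
  proof (rule big.relations_map[OF small.bound_quiver_algebra_axioms, where F = "syzygy Q I"])
    show "(big.\<omega> ^^ Suc m) c \<in> K0_relations Q I" by (rule rel)
    show "rep_iso Q' (syzygy Q I L) (rep_sum (syzygy Q I L') (syzygy Q I L''))"
      if "L \<in> mod_cat Q I" "L' \<in> mod_cat Q I" "L'' \<in> mod_cat Q I" "rep_iso Q L (rep_sum L' L'')" for L L' L''
      by (rule restrict_iso[OF big.syzygy_respects_sum[OF that]])
    show "syzygy Q I L \<in> mod_cat Q' I'" if "L \<in> mod_cat Q I" for L
      by (rule restrict_mod_cat[OF big.syzygy_mod_cat[OF that]])
    show "projective Q' I' (syzygy Q I P)" if P: "projective Q I P" for P
      by (rule small.projective_zero[OF restrict_mod_cat[OF big.syzygy_mod_cat[OF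
              big.projective_imp_mod_cat[OF P]]] big.syzygy_projective[OF P vertex_in_big]])
  qed
  then have "(big.\<omega> ^^ Suc (Suc m)) c \<in> K0_relations Q' I'" by simp
  from small.relations_diff[OF this compare[of "Suc (Suc m)"]]
  have "(small.\<omega> ^^ Suc (Suc m)) c \<in> K0_relations Q' I'" by simp
  then have "(small.\<omega> ^^ m) c \<in> K0_relations Q' I'" by (rule down[OF down])
  from small.relations_add[OF compare[of m] this]
  have "(big.\<omega> ^^ m) c \<in> K0_relations Q' I'" by simp
  then have E: "frag_map (rep_on Q') ((big.\<omega> ^^ m) c) \<in> K0_relations Q I"
  proof (rule small.relations_map[OF big.bound_quiver_algebra_axioms, where F = "rep_on Q'", rotated -1])
    show "rep_iso Q (rep_on Q' L) (rep_sum (rep_on Q' L') (rep_on Q' L''))"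
      if "L \<in> mod_cat Q' I'" "L' \<in> mod_cat Q' I'" "L'' \<in> mod_cat Q' I'" "rep_iso Q' L (rep_sum L' L'')" for L L' L''
      unfolding rep_on_sum[symmetric] using that by (intro extend_iso_mod_cat small.mod_cat_sum)
  qed (auto intro: extend_mod_cat extend_projective)
  have "frag_map (rep_on Q') ((big.\<omega> ^^ m) c) - frag_map (\<lambda>N. N) ((big.\<omega> ^^ m) c) \<in> K0_relations Q I"
  proof (rule big.relations_cong[OF keysT_pow])
    fix N assume "N \<in> ?T"
    then have N: "N \<in> mod_cat Q I" "supported N" by auto
    show "frag_of (rep_on Q' N) - frag_of N \<in> K0_relations Q I"
      by (rule big.relations_iso[OF extend_mod_cat[OF restrict_mod_cat[OF N(1)]] N(1)
            rep_iso_supported[OF mod_cat_linear_rep[OF N(1)] N(2)]])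
  qed
  moreover have "frag_map (\<lambda>N. N) d = d" for d :: "('v, 'a, 'k) rep \<Rightarrow>\<^sub>0 int"
    unfolding frag_map_def using frag_expansion[of d] by simp
  ultimately have "frag_map (rep_on Q') ((big.\<omega> ^^ m) c) - (big.\<omega> ^^ m) c \<in> K0_relations Q I"
    by (simp only:)
  from big.relations_diff[OF E this] show "(big.\<omega> ^^ m) c \<in> K0_relations Q I" by simp
qed

text \<open>
  The condition \<open>M \<in> \<D>\<close> concerns the restriction of \<open>M\<close> to the subquiver.
\<close>

definition extension :: "('v, 'a, 'k) rep set \<Rightarrow> ('v, 'a, 'k) rep set" where
  "extension \<D> = {M \<in> mod_cat Q I. supported M \<and> M \<in> \<D>}"

lemma small_zero_IT_iso:
  assumes "zero_IT_subcategory Q' I' \<D>" "M \<in> \<D>" "N \<in> mod_cat Q' I'" "rep_iso Q' N M"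
  shows "N \<in> \<D>"
  using small.add_cat_iso[of M \<D> N] assms unfolding zero_IT_subcategory_def by metis

lemma zero_IT_extension:
  assumes D: "zero_IT_subcategory Q' I' \<D>"
  shows "zero_IT_subcategory Q I (extension \<D>)"
proof -
  have D_add: "\<D> = add_cat Q' I' \<D>" and D_syz: "syzygy Q' I' ` \<D> \<subseteq> \<D>" and D_phi: "IT_phi_dim Q' I' \<D> = 0"
    using D by (auto simp: zero_IT_subcategory_def)
  have "M \<in> add_cat Q I (extension \<D>)" if "M \<in> extension \<D>" for M
    using that big.add_cat_summand[OF that big.is_summand_refl] by (simp add: extension_def)
  moreover have "X \<in> extension \<D>" if X: "X \<in> add_cat Q I (extension \<D>)" for X
  proof -
    have "X \<in> add_cat Q' I' \<D>"
      by (rule small.add_cat_mono[OF restrict_add_cat[OF X]])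
        (auto simp: extension_def intro: small.is_summand_refl restrict_mod_cat)
    then have "X \<in> \<D>" using D_add by blast
    moreover have "supported X" by (rule supported_add_cat[OF X]) (simp add: extension_def)
    ultimately show ?thesis using big.add_cat_imp_mod_cat[OF X] by (simp add: extension_def)
  qed
  moreover have "syzygy Q I M \<in> extension \<D>" if "M \<in> extension \<D>" for M
  proof -
    have M: "M \<in> mod_cat Q I" "supported M" "M \<in> \<D>" using that by (auto simp: extension_def)
    have "syzygy Q I M \<in> \<D>"
      using D_syz M(3) by (intro small_zero_IT_iso[OF D _ restrict_mod_cat[OF big.syzygy_mod_cat[OF M(1)]]
            syzygy_supported(2)[OF M(1,2)]]) blast
    then show ?thesis using syzygy_supported(1)[OF M(1,2)] big.syzygy_mod_cat[OF M(1)] by (simp add: extension_def)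
  qed
  moreover have "IT_phi_dim Q I (extension \<D>) = 0"
    using D_phi IT_phi_supported unfolding big.IT_phi_dim_eq_0_iff small.IT_phi_dim_eq_0_iff
    by (auto simp: extension_def)
  moreover have "extension \<D> \<subseteq> mod_cat Q I" by (simp add: extension_def subset_iff)
  ultimately show ?thesis unfolding zero_IT_subcategory_def by (intro conjI equalityI subsetI) auto
qed

lemma rep_on_in_extension:
  assumes D: "zero_IT_subcategory Q' I' \<D>" and M: "M \<in> \<D>"
  shows "rep_on Q' M \<in> extension \<D>"
proof -
  have mM: "M \<in> mod_cat Q' I'" using D M by (auto simp: zero_IT_subcategory_def)
  note E = extend_mod_cat[OF mM]
  have "rep_on Q' M \<in> \<D>" by (rule small_zero_IT_iso[OF D M restrict_mod_cat[OF E] rep_iso_rep_on])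
  with E supported_rep_on show ?thesis by (simp add: extension_def)
qed

end


section \<open>Gluing two bound quivers along arrows in one direction\<close>

locale one_way_gluing =
  C: bound_quiver_algebra QC IC +
  A: predecessor_closed_subquiver QC IC QA IA + B: successor_closed_subquiver QC IC QB IB
  for QC :: "('v, 'a) quiver" and IC :: "(('v, 'a) path \<Rightarrow>\<^sub>0 'k::field) set"
    and QA :: "('v, 'a) quiver" and IA :: "(('v, 'a) path \<Rightarrow>\<^sub>0 'k) set"
    and QB :: "('v, 'a) quiver" and IB :: "(('v, 'a) path \<Rightarrow>\<^sub>0 'k) set" +
  assumes verts_union: "verts QC = verts QA \<union> verts QB"
    and verts_disjoint: "verts QA \<inter> verts QB = {}"
    and crossing_relation: "M \<in> mod_cat QC IC \<Longrightarrow> \<beta> \<in> arcs QA \<Longrightarrow> a \<in> arcs QC \<Longrightarrow>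
      a \<notin> arcs QA \<Longrightarrow> a \<notin> arcs QB \<Longrightarrow> head QC \<beta> = tail QC a \<Longrightarrow> v \<in> vsp M (tail QC \<beta>) \<Longrightarrow>
      amap M a (amap M \<beta> v) = 0"
begin

abbreviation "\<Omega>A \<equiv> syzygy QA IA"
abbreviation "\<Omega>B \<equiv> syzygy QB IB"
abbreviation "\<Omega>C \<equiv> syzygy QC IC"

lemma not_in_both: "x \<in> verts QA \<Longrightarrow> x \<notin> verts QB"
  using verts_disjoint by blast

lemma split_rep:
  assumes K: "K \<in> mod_cat QC IC"
    and cross: "\<And>a v. a \<in> arcs QC \<Longrightarrow> a \<notin> arcs QA \<Longrightarrow> a \<notin> arcs QB \<Longrightarrow> v \<in> vsp K (tail QC a) \<Longrightarrow> amap K a v = 0"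
  shows "rep_iso QC K (rep_sum (rep_on QA K) (rep_on QB K))"
proof (rule rep_isoI)
  let ?f = "\<lambda>x v. if x \<in> verts QA then vpair v 0 else vpair 0 v"
  note lK = mod_cat_linear_rep[OF K]
  have in_B: "x \<in> verts QB \<longleftrightarrow> x \<notin> verts QA" if "x \<in> verts QC" for x
    using that verts_union verts_disjoint by blast
  show "rep_hom QC K (rep_sum (rep_on QA K) (rep_on QB K)) ?f"
  proof (rule rep_homI)
    show "linear_between (vsp K x) (vsp (rep_sum (rep_on QA K) (rep_on QB K)) x) (?f x)" if "x \<in> verts QC" for x
      using in_B[OF that] linear_rep_subspace[OF lK that]
      by (intro linear_betweenI)
        (auto simp: in_vsp_rep_sum A.vsp_rep_on B.vsp_rep_on vpair_add vscale_vpair vect.subspace_0)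
    fix a v assume a: "a \<in> arcs QC" and v: "v \<in> vsp K (tail QC a)"
    consider "a \<in> arcs QA" | "a \<in> arcs QB" | "a \<notin> arcs QA" "a \<notin> arcs QB" by blast
    then show "?f (head QC a) (amap K a v) = amap (rep_sum (rep_on QA K) (rep_on QB K)) a (?f (tail QC a) v)"
    proof cases
      case 1
      then have "tail QC a \<in> verts QA" "head QC a \<in> verts QA" "a \<notin> arcs QB"
        using A.arcs_iff B.arcs_iff not_in_both by auto
      then show ?thesis using 1 by (simp add: amap_rep_sum A.amap_rep_on B.amap_rep_on)
    next
      case 2
      then have "tail QC a \<notin> verts QA" "head QC a \<notin> verts QA" "a \<notin> arcs QA"
        using A.arcs_iff B.arcs_iff not_in_both by auto
      then show ?thesis using 2 by (simp add: amap_rep_sum A.amap_rep_on B.amap_rep_on)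
    next
      case 3
      then show ?thesis using cross[OF a 3 v] by (simp add: amap_rep_sum A.amap_rep_on B.amap_rep_on)
    qed
  qed
  fix x assume x: "x \<in> verts QC"
  show "bij_betw (?f x) (vsp K x) (vsp (rep_sum (rep_on QA K) (rep_on QB K)) x)"
  proof (cases "x \<in> verts QA")
    case True
    then show ?thesis
      using not_in_both[OF True]
      by (intro bij_betw_byWitness[where f' = vfst])
        (auto simp: in_vsp_rep_sum A.vsp_rep_on B.vsp_rep_on, metis vpair_vfst_vsnd)
  next
    case False
    then show ?thesis
      using in_B[OF x]
      by (intro bij_betw_byWitness[where f' = vsnd])
        (auto simp: in_vsp_rep_sum A.vsp_rep_on B.vsp_rep_on, metis vpair_vfst_vsnd)
  qed
qed

text \<open>
  The kernel of a projective cover \<open>P\<close> lies in the radical of \<open>P\<close>, which at a vertex of \<open>QA\<close> is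
  generated by the images of arrows of \<open>QA\<close>; the connecting arrows annihilate these. So the kernel
  splits, and its part over \<open>QA\<close> is the syzygy over \<open>QA\<close>.
\<close>

lemma ker_projective_cover_split:
  assumes M: "M \<in> mod_cat QC IC" and P: "projective_cover QC IC M P f"
  shows "rep_iso QC (rep_ker P f) (rep_sum (rep_on QA (\<Omega>A M)) (rep_on QB (rep_ker P f)))"
proof -
  let ?K = "rep_ker P f"
  have K: "?K \<in> mod_cat QC IC" by (rule C.projective_cover_ker_mod_cat[OF M P])
  have mP: "P \<in> mod_cat QC IC" and ker: "\<And>x v. x \<in> verts QC \<Longrightarrow> v \<in> vsp ?K x \<Longrightarrow> v \<in> rad QC P x"
    using P unfolding C.projective_cover_iff[OF mod_cat_linear_rep[OF M]]
    by (auto simp: rep_ker_def C.projective_imp_mod_cat)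
  note lP = mod_cat_linear_rep[OF mP]
  have cross: "amap ?K a v = 0"
    if a: "a \<in> arcs QC" "a \<notin> arcs QA" "a \<notin> arcs QB" and v: "v \<in> vsp ?K (tail QC a)" for a v
  proof -
    have t: "tail QC a \<in> verts QC" using a by simp
    have tA: "tail QC a \<in> verts QA" using a B.successors t verts_union by blast
    have "rad QC P (tail QC a) \<subseteq> {v \<in> vsp P (tail QC a). amap P a v = 0}"
    proof (rule C.rad_minimal)
      show "vect.subspace {v \<in> vsp P (tail QC a). amap P a v = 0}"
        by (rule subspace_linear_kernel[OF linear_rep_subspace[OF lP t] linear_rep_amap[OF lP a(1)]])
      fix b w assume b: "b \<in> arcs QC" "head QC b = tail QC a" and w: "w \<in> vsp P (tail QC b)"
      have "b \<in> arcs QA" using A.predecessors b tA by simp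
      then show "amap P b w \<in> {v \<in> vsp P (tail QC a). amap P a v = 0}"
        using crossing_relation[OF mP _ a b(2) w] C.amap_in[OF lP b(1) w] b(2) by simp
    qed
    then have "amap P a v = 0" using ker[OF t v] by blast
    then show ?thesis by (simp add: rep_ker_def)
  qed
  have "rep_iso QC (rep_on QA ?K) (rep_on QA (\<Omega>A M))"
  proof (rule A.extend_iso_mod_cat)
    show "\<Omega>A M \<in> mod_cat QA IA" by (rule A.small.syzygy_mod_cat[OF A.restrict_mod_cat[OF M]])
    then show "rep_iso QA ?K (\<Omega>A M)"
      by (rule A.small.rep_iso_sym[OF mod_cat_linear_rep A.restrict_syzygy[OF M P]])
  qed (rule A.restrict_mod_cat[OF K])
  from C.rep_iso_trans[OF split_rep[OF K cross] C.rep_iso_sum[OF this rep_iso_refl]] show ?thesis .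
qed

lemma syzygy_split:
  assumes M: "M \<in> mod_cat QC IC"
  shows "rep_iso QC (\<Omega>C M) (rep_sum (rep_on QA (\<Omega>A M)) (rep_on QB (\<Omega>C M)))"
proof -
  obtain P f where "projective_cover QC IC M P f" "\<Omega>C M = rep_ker P f"
    using C.syzygy_cover[OF M] by blast
  then show ?thesis using ker_projective_cover_split[OF M] by metis
qed

text \<open>
  Since the extension of \<open>X\<close> vanishes on \<open>QB\<close>, the kernel of its projective cover is everything there.
\<close>

lemma syzygy_extend_left:
  assumes X: "X \<in> mod_cat QA IA"
  obtains xs where "set xs \<subseteq> verts QC"
    "rep_iso QC (\<Omega>C (rep_on QA X))
      (rep_sum (rep_on QA (\<Omega>A X)) (rep_on QB (rep_sum_list (map C.vertex_projective xs))))"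
proof -
  note E = A.extend_mod_cat[OF X]
  obtain xs f where xs: "set xs \<subseteq> verts QC"
      and P: "projective_cover QC IC (rep_on QA X) (rep_sum_list (map C.vertex_projective xs)) f"
    using C.projective_cover_vertex_projectives[OF E] by blast
  let ?P = "rep_sum_list (map C.vertex_projective xs)"
  have f: "rep_hom QC ?P (rep_on QA X) f" using P by (simp add: projective_cover_def rep_epi_def)
  have "rep_on QB (rep_ker ?P f) = rep_on QB ?P"
  proof (rule rep.equality)
    have "f x v = 0" if "x \<in> verts QB" "v \<in> vsp ?P x" for x v
      using rep_hom_in[OF f B.vertex_in_big[OF that(1)] that(2)] not_in_both that(1)
      by (auto simp: A.vsp_rep_on split: if_splits)
    then show "vsp (rep_on QB (rep_ker ?P f)) = vsp (rep_on QB ?P)"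
      by (intro ext) (auto simp: B.vsp_rep_on rep_ker_def)
    show "amap (rep_on QB (rep_ker ?P f)) = amap (rep_on QB ?P)"
      by (rule ext) (simp add: B.amap_rep_on rep_ker_def)
  qed simp
  with ker_projective_cover_split[OF E P]
  have ker: "rep_iso QC (rep_ker ?P f) (rep_sum (rep_on QA (\<Omega>A (rep_on QA X))) (rep_on QB ?P))" by simp
  have "rep_iso QA (\<Omega>A (rep_on QA X)) (\<Omega>A X)"
    by (rule A.small.syzygy_iso[OF A.restrict_mod_cat[OF E] X A.rep_iso_rep_on])
  then have "rep_iso QC (rep_on QA (\<Omega>A (rep_on QA X))) (rep_on QA (\<Omega>A X))"
    by (rule A.extend_iso_mod_cat[OF A.small.syzygy_mod_cat[OF A.restrict_mod_cat[OF E]] A.small.syzygy_mod_cat[OF X]])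
  from C.rep_iso_trans[OF C.rep_iso_trans[OF C.syzygy_iso_ker[OF E E rep_iso_refl P] ker]
      C.rep_iso_sum[OF this rep_iso_refl]]
  show ?thesis by (rule that[OF xs])
qed

text \<open>
  The modules over \<open>QB\<close> that the connecting arrows produce in the first \<open>n\<close> syzygies of a module over
  \<open>QA\<close>. Their number is finite.
\<close>

definition connecting_syzygies :: "nat \<Rightarrow> ('v, 'a, 'k) rep set" where
  "connecting_syzygies n =
     (\<lambda>(i, x). rep_on QB ((\<Omega>B ^^ i) (C.vertex_projective x))) ` ({..<n} \<times> verts QC)"

lemma vertex_projective_right: "x \<in> verts QC \<Longrightarrow> C.vertex_projective x \<in> mod_cat QB IB"
  by (rule B.restrict_mod_cat[OF C.vertex_projective_mod_cat])

lemma connecting_syzygies_mod_cat: "connecting_syzygies n \<subseteq> mod_cat QC IC"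
  by (auto simp: connecting_syzygies_def
      intro!: B.extend_mod_cat B.small.syzygy_funpow_mod_cat vertex_projective_right)

text \<open>
  Each syzygy over \<open>QC\<close> splits off restrictions of projectives to \<open>QB\<close>, whose further syzygies are
  those over \<open>QB\<close>. What the first of the \<open>n + 1\<close> steps splits off still undergoes \<open>n\<close> more.
\<close>

lemma syzygy_funpow_extend_left:
  "X \<in> mod_cat QA IA \<Longrightarrow> \<exists>W\<in>add_cat QC IC (connecting_syzygies n).
     rep_iso QC ((\<Omega>C ^^ n) (rep_on QA X)) (rep_sum (rep_on QA ((\<Omega>A ^^ n) X)) W)"
proof (induction n arbitrary: X)
  case 0
  have "rep_iso QC (rep_on QA X) (rep_sum (rep_on QA X) rep_zero)"
    by (rule C.rep_iso_sym[OF mod_cat_linear_rep[OF C.mod_cat_sum[OF A.extend_mod_cat[OF 0]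
            C.mod_cat_zero]] C.rep_iso_sum_rep_zero(1)])
  moreover have "rep_zero \<in> add_cat QC IC (connecting_syzygies 0)"
    by (rule C.add_cat_zero[OF C.mod_cat_zero]) (simp add: rep_zero_def)
  ultimately show ?case by auto
next
  case (Suc n)
  obtain xs where xs: "set xs \<subseteq> verts QC"
    and step: "rep_iso QC (\<Omega>C (rep_on QA X))
      (rep_sum (rep_on QA (\<Omega>A X)) (rep_on QB (rep_sum_list (map C.vertex_projective xs))))"
    using syzygy_extend_left[OF Suc.prems] by blast
  let ?T = "rep_sum_list (map C.vertex_projective xs)"
  note X1 = A.small.syzygy_mod_cat[OF Suc.prems]
  have xsB: "set (map C.vertex_projective xs) \<subseteq> mod_cat QB IB"
    using xs vertex_projective_right by auto
  then have T: "?T \<in> mod_cat QB IB" by (rule B.small.mod_cat_sum_list)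
  note EX = A.extend_mod_cat[OF X1] and ET = B.extend_mod_cat[OF T]
  obtain W where W: "W \<in> add_cat QC IC (connecting_syzygies n)"
      "rep_iso QC ((\<Omega>C ^^ n) (rep_on QA (\<Omega>A X))) (rep_sum (rep_on QA ((\<Omega>A ^^ n) (\<Omega>A X))) W)"
    using Suc.IH[OF X1] by blast
  let ?R = "rep_on QB ((\<Omega>B ^^ n) ?T)"
  have R: "?R \<in> add_cat QC IC (connecting_syzygies (Suc n))"
  proof (rule C.add_catI)
    show "?R \<in> mod_cat QC IC" by (rule B.extend_mod_cat[OF B.small.syzygy_funpow_mod_cat[OF T]])
    have "set (map (\<Omega>B ^^ n) (map C.vertex_projective xs)) \<subseteq> mod_cat QB IB"
      using xsB B.small.syzygy_funpow_mod_cat by auto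
    then have "rep_iso QC ?R (rep_on QB (rep_sum_list (map (\<Omega>B ^^ n) (map C.vertex_projective xs))))"
      using B.small.syzygy_funpow_mod_cat[OF T] B.small.mod_cat_sum_list B.small.syzygy_funpow_sum_list[OF xsB]
      by (intro B.extend_iso_mod_cat)
    then show "rep_iso QC ?R (rep_sum_list (map (rep_on QB) (map (\<Omega>B ^^ n) (map C.vertex_projective xs))))"
      unfolding B.rep_on_sum_list .
    fix N assume "N \<in> set (map (rep_on QB) (map (\<Omega>B ^^ n) (map C.vertex_projective xs)))"
    then have "N \<in> connecting_syzygies (Suc n)"
      using xs unfolding connecting_syzygies_def by force
    then show "\<exists>M\<in>connecting_syzygies (Suc n). is_summand QC IC N M"
      using C.is_summand_refl connecting_syzygies_mod_cat by blast
  qed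
  have "W \<in> add_cat QC IC (connecting_syzygies (Suc n))"
  proof (rule C.add_cat_mono[OF W(1)])
    fix M assume "M \<in> connecting_syzygies n"
    then have "M \<in> connecting_syzygies (Suc n)" by (auto simp: connecting_syzygies_def)
    then show "\<exists>N\<in>connecting_syzygies (Suc n). is_summand QC IC M N"
      using C.is_summand_refl connecting_syzygies_mod_cat by blast
  qed
  then have WR: "rep_sum W ?R \<in> add_cat QC IC (connecting_syzygies (Suc n))"
    using R by (rule C.add_cat_sum)
  have "rep_iso QC ((\<Omega>C ^^ n) (\<Omega>C (rep_on QA X))) ((\<Omega>C ^^ n) (rep_sum (rep_on QA (\<Omega>A X)) (rep_on QB ?T)))"
    by (rule C.syzygy_funpow_iso[OF C.syzygy_mod_cat[OF A.extend_mod_cat[OF Suc.prems]]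
          C.mod_cat_sum[OF EX ET] step])
  from C.rep_iso_trans[OF this C.syzygy_funpow_sum[OF EX ET]]
  have "rep_iso QC ((\<Omega>C ^^ n) (\<Omega>C (rep_on QA X)))
      (rep_sum ((\<Omega>C ^^ n) (rep_on QA (\<Omega>A X))) ((\<Omega>C ^^ n) (rep_on QB ?T)))" .
  from C.rep_iso_trans[OF this C.rep_iso_sum[OF W(2) B.extend_syzygy_funpow[OF T]]]
  have "rep_iso QC ((\<Omega>C ^^ n) (\<Omega>C (rep_on QA X)))
      (rep_sum (rep_sum (rep_on QA ((\<Omega>A ^^ n) (\<Omega>A X))) W) ?R)" .
  from C.rep_iso_trans[OF this C.rep_iso_sum_assoc]
  have "rep_iso QC ((\<Omega>C ^^ Suc n) (rep_on QA X)) (rep_sum (rep_on QA ((\<Omega>A ^^ Suc n) X)) (rep_sum W ?R))"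
    by (simp only: funpow_Suc_right o_apply)
  with WR show ?case by blast
qed

text \<open>
  The first syzygy separates the parts over \<open>QA\<close> and \<open>QB\<close>; this is the step that raises \<open>n\<close> by one. The
  remaining \<open>n\<close> syzygies are taken of the two parts separately.
\<close>

lemma LIT_gluing:
  assumes A_IT: "Igusa_Todorov_algebra QA IA n" and B_LIT: "LIT_algebra QB IB n"
  shows "LIT_algebra QC IC (n + 1)"
proof -
  obtain VA where VA: "LIT_with QA IA n VA (zero_cat QA IA)"
    using A_IT by (auto simp: Igusa_Todorov_algebra_def)
  obtain VB D where VB: "LIT_with QB IB n VB D"
    using B_LIT by (auto simp: LIT_algebra_def)
  have mVA: "VA \<in> mod_cat QA IA" and mVB: "VB \<in> mod_cat QB IB" and D: "zero_IT_subcategory QB IB D"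
    using VA VB by (auto simp: LIT_with_def)
  have "finite (connecting_syzygies n)" by (simp add: connecting_syzygies_def)
  then obtain Ws where Ws: "set Ws = connecting_syzygies n" using finite_list by blast
  have mWs: "set Ws \<subseteq> mod_cat QC IC" using connecting_syzygies_mod_cat by (simp add: Ws)
  define V where "V = rep_sum (rep_on QA VA) (rep_sum (rep_on QB VB) (rep_sum_list Ws))"
  note mods = A.extend_mod_cat[OF mVA] B.extend_mod_cat[OF mVB] C.mod_cat_sum_list[OF mWs]
  note mods' = C.mod_cat_sum[OF mods(2,3)]
  have mV: "V \<in> mod_cat QC IC" unfolding V_def by (rule C.mod_cat_sum[OF mods(1) mods'])
  have sumA: "is_summand QC IC (rep_on QA VA) V"
    unfolding V_def by (rule C.is_summand_sum(1)[OF mods(1) mods'])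
  have sumB: "is_summand QC IC (rep_on QB VB) V"
    unfolding V_def by (rule C.is_summand_trans[OF C.is_summand_sum(1)[OF mods(2,3)]
          C.is_summand_sum(2)[OF mods(1) mods']])
  have sumW: "is_summand QC IC W V" if "W \<in> connecting_syzygies n" for W
    unfolding V_def using that mWs
    by (intro C.is_summand_trans[OF C.is_summand_trans[OF C.is_summand_sum_list[OF mWs]
            C.is_summand_sum(2)[OF mods(2,3)]] C.is_summand_sum(2)[OF mods(1) mods']])
      (simp add: Ws)
  have addA: "rep_on QA X \<in> add_cat QC IC {V}" if "X \<in> add_cat QA IA {VA}" for X
    by (rule C.add_cat_mono[OF A.extend_add_cat[OF that]]) (use mVA sumA in auto)
  have addB: "rep_on QB X \<in> add_cat QC IC {V}" if "X \<in> add_cat QB IB {VB}" for X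
    by (rule C.add_cat_mono[OF B.extend_add_cat[OF that]]) (use mVB sumB in auto)
  have addW: "W \<in> add_cat QC IC {V}" if "W \<in> add_cat QC IC (connecting_syzygies n)" for W
    by (rule C.add_cat_mono[OF that]) (use sumW in auto)
  have "\<exists>V0\<in>add_cat QC IC {V}. \<exists>V1\<in>add_cat QC IC {V}. \<exists>D0\<in>B.extension D. \<exists>D1\<in>B.extension D.
      short_exact QC (rep_sum V1 D1) (rep_sum V0 D0) ((\<Omega>C ^^ (n + 1)) M)"
    if M: "M \<in> mod_cat QC IC" for M
  proof -
    note X = A.small.syzygy_mod_cat[OF A.restrict_mod_cat[OF M]]
    note NC = C.syzygy_mod_cat[OF M]
    note Y = B.restrict_mod_cat[OF NC]
    note EX = A.extend_mod_cat[OF X] and EY = B.extend_mod_cat[OF Y]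
    note XnM = A.small.syzygy_funpow_mod_cat[OF X, of n] and YnM = B.small.syzygy_funpow_mod_cat[OF Y, of n]
    obtain V0 V1 Z0 Z1 where VZ: "V0 \<in> add_cat QA IA {VA}" "V1 \<in> add_cat QA IA {VA}"
        "Z0 \<in> zero_cat QA IA" "Z1 \<in> zero_cat QA IA"
      and exA: "short_exact QA (rep_sum V1 Z1) (rep_sum V0 Z0) ((\<Omega>A ^^ n) (\<Omega>A M))"
      using VA X unfolding LIT_with_def by blast
    obtain U0 U1 D0 D1 where UD: "U0 \<in> add_cat QB IB {VB}" "U1 \<in> add_cat QB IB {VB}" "D0 \<in> D" "D1 \<in> D"
      and exB: "short_exact QB (rep_sum U1 D1) (rep_sum U0 D0) ((\<Omega>B ^^ n) (\<Omega>C M))"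
      using VB Y unfolding LIT_with_def by blast
    obtain W where W: "W \<in> add_cat QC IC (connecting_syzygies n)"
      "rep_iso QC ((\<Omega>C ^^ n) (rep_on QA (\<Omega>A M))) (rep_sum (rep_on QA ((\<Omega>A ^^ n) (\<Omega>A M))) W)"
      using syzygy_funpow_extend_left[OF X] by blast
    note mW = C.add_cat_imp_mod_cat[OF W(1)]
    have zero_add: "Z \<in> add_cat QA IA {VA}" if "Z \<in> zero_cat QA IA" for Z
      using that by (intro A.small.add_cat_zero) (auto simp: zero_cat_def)
    have a0: "rep_sum V0 Z0 \<in> add_cat QA IA {VA}" and a1: "rep_sum V1 Z1 \<in> add_cat QA IA {VA}"
      using VZ by (auto intro: A.small.add_cat_sum zero_add)
    note mA = A.small.add_cat_imp_mod_cat[OF a0] A.small.add_cat_imp_mod_cat[OF a1]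
    note mU = B.small.add_cat_imp_mod_cat[OF UD(1)] B.small.add_cat_imp_mod_cat[OF UD(2)]
    have mD: "D0 \<in> mod_cat QB IB" "D1 \<in> mod_cat QB IB"
      using UD D by (auto simp: zero_IT_subcategory_def)
    note lin = mod_cat_linear_rep
    have exA': "short_exact QC (rep_on QA (rep_sum V1 Z1)) (rep_on QA (rep_sum V0 Z0)) (rep_on QA ((\<Omega>A ^^ n) (\<Omega>A M)))"
      by (rule A.extend_short_exact[OF lin[OF mA(2)] lin[OF mA(1)] lin[OF XnM] exA])
    have exB': "short_exact QC (rep_sum (rep_on QB U1) (rep_on QB D1)) (rep_sum (rep_on QB U0) (rep_on QB D0))
        (rep_on QB ((\<Omega>B ^^ n) (\<Omega>C M)))"
      using B.extend_short_exact[OF lin[OF B.small.mod_cat_sum[OF mU(2) mD(2)]]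
          lin[OF B.small.mod_cat_sum[OF mU(1) mD(1)]] lin[OF YnM] exB]
      unfolding B.rep_on_sum .
    let ?V0 = "rep_sum (rep_sum (rep_on QA (rep_sum V0 Z0)) W) (rep_on QB U0)"
    let ?V1 = "rep_sum (rep_sum (rep_on QA (rep_sum V1 Z1)) rep_zero) (rep_on QB U1)"
    let ?N = "rep_sum (rep_sum (rep_on QA ((\<Omega>A ^^ n) (\<Omega>A M))) W) (rep_on QB ((\<Omega>B ^^ n) (\<Omega>C M)))"
    have ex: "short_exact QC
        (rep_sum (rep_sum (rep_on QA (rep_sum V1 Z1)) rep_zero) (rep_sum (rep_on QB U1) (rep_on QB D1)))
        (rep_sum (rep_sum (rep_on QA (rep_sum V0 Z0)) W) (rep_sum (rep_on QB U0) (rep_on QB D0))) ?N"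
      by (rule C.short_exact_sum[OF C.short_exact_sum[OF exA' C.short_exact_zero[OF lin[OF mW]]] exB'])
    have syz: "rep_iso QC ((\<Omega>C ^^ n) (\<Omega>C M)) ?N"
    proof -
      have "rep_iso QC ((\<Omega>C ^^ n) (\<Omega>C M)) ((\<Omega>C ^^ n) (rep_sum (rep_on QA (\<Omega>A M)) (rep_on QB (\<Omega>C M))))"
        by (rule C.syzygy_funpow_iso[OF NC C.mod_cat_sum[OF EX EY] syzygy_split[OF M]])
      from C.rep_iso_trans[OF this C.syzygy_funpow_sum[OF EX EY]]
      have "rep_iso QC ((\<Omega>C ^^ n) (\<Omega>C M))
          (rep_sum ((\<Omega>C ^^ n) (rep_on QA (\<Omega>A M))) ((\<Omega>C ^^ n) (rep_on QB (\<Omega>C M))))" .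
      from C.rep_iso_trans[OF this C.rep_iso_sum[OF W(2) B.extend_syzygy_funpow[OF Y]]]
      show ?thesis .
    qed
    have mN: "?N \<in> mod_cat QC IC"
      by (rule C.mod_cat_sum[OF C.mod_cat_sum[OF A.extend_mod_cat[OF XnM] mW] B.extend_mod_cat[OF YnM]])
    have mV0: "rep_sum (rep_on QA (rep_sum V0 Z0)) W \<in> mod_cat QC IC"
      by (rule C.mod_cat_sum[OF A.extend_mod_cat[OF mA(1)] mW])
    have "short_exact QC (rep_sum ?V1 (rep_on QB D1)) (rep_sum ?V0 (rep_on QB D0)) ((\<Omega>C ^^ n) (\<Omega>C M))"
    proof (rule C.short_exact_iso[OF ex C.rep_iso_sum_assoc])
      show "rep_iso QC (rep_sum (rep_sum (rep_on QA (rep_sum V0 Z0)) W) (rep_sum (rep_on QB U0) (rep_on QB D0)))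
          (rep_sum ?V0 (rep_on QB D0))"
        by (rule C.rep_iso_sym[OF lin[OF C.mod_cat_sum[OF C.mod_cat_sum[OF mV0
                  B.extend_mod_cat[OF mU(1)]] B.extend_mod_cat[OF mD(1)]]] C.rep_iso_sum_assoc])
      show "rep_iso QC ?N ((\<Omega>C ^^ n) (\<Omega>C M))"
        by (rule C.rep_iso_sym[OF lin[OF C.syzygy_funpow_mod_cat[OF NC]] syz])
      show "linear_rep QC ?N" by (rule lin[OF mN])
      show "linear_rep QC (rep_sum (rep_sum (rep_on QA (rep_sum V0 Z0)) W) (rep_sum (rep_on QB U0) (rep_on QB D0)))"
        by (rule lin[OF C.mod_cat_sum[OF mV0 C.mod_cat_sum[OF B.extend_mod_cat[OF mU(1)]
                  B.extend_mod_cat[OF mD(1)]]]])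
    qed
    then have "short_exact QC (rep_sum ?V1 (rep_on QB D1)) (rep_sum ?V0 (rep_on QB D0)) ((\<Omega>C ^^ (n + 1)) M)"
      by (simp only: Suc_eq_plus1[symmetric] funpow_Suc_right o_apply)
    moreover have "rep_zero \<in> add_cat QC IC {V}"
      by (rule C.add_cat_zero[OF C.mod_cat_zero]) (simp add: rep_zero_def)
    then have "?V1 \<in> add_cat QC IC {V}"
      by (intro C.add_cat_sum addA[OF a1] addB[OF UD(2)])
    moreover have "?V0 \<in> add_cat QC IC {V}"
      by (intro C.add_cat_sum addA[OF a0] addB[OF UD(1)] addW[OF W(1)])
    moreover have "rep_on QB D0 \<in> B.extension D" "rep_on QB D1 \<in> B.extension D"
      using B.rep_on_in_extension[OF D] UD by blast+
    ultimately show ?thesis by blast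
  qed
  with B.zero_IT_extension[OF D] mV have "LIT_with QC IC (n + 1) V (B.extension D)"
    unfolding LIT_with_def by blast
  then show ?thesis by (auto simp: LIT_algebra_def)
qed

end

theorem proposition3p3:
  fixes n :: nat
    and QA QB QC :: "('v, 'a) quiver"
    and IA IB IC :: "(('v, 'a) path \<Rightarrow>\<^sub>0 'k::field) set"
    and \<alpha> :: "'j \<Rightarrow> 'a" and J :: "'j set"
    and C0 :: "('v, 'a, 'k) rep"
  assumes A: "bound_quiver QA IA"
    and B: "bound_quiver QB IB"
    and C: "bound_quiver QC IC"
    and subA: "\<forall>a\<in>arcs QA. tail QC a = tail QA a \<and> head QC a = head QA a"
    and subB: "\<forall>a\<in>arcs QB. tail QC a = tail QB a \<and> head QC a = head QB a"
    and cornerA: "IC \<inter> carrier (path_algebra QA) = IA"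
    and cornerB: "IC \<inter> carrier (path_algebra QB) = IB"
    and verts: "verts QC = verts QA \<union> verts QB" "verts QA \<inter> verts QB = {}"
    and arcs: "arcs QC = arcs QA \<union> arcs QB \<union> \<alpha> ` J"
      "arcs QA \<inter> arcs QB = {}" "arcs QA \<inter> \<alpha> ` J = {}" "arcs QB \<inter> \<alpha> ` J = {}"
      "inj_on \<alpha> J"
    and alpha: "\<forall>j\<in>J. tail QC (\<alpha> j) \<in> verts QA \<and> head QC (\<alpha> j) \<in> verts QB"
    and ideal: "genideal (path_algebra QC)
        (IA \<union> IB \<union> {arrow_elt QC \<beta> \<otimes>\<^bsub>path_algebra QC\<^esub> arrow_elt QC (\<alpha> j) | \<beta> j. \<beta> \<in> arcs QA \<and> j \<in> J})
        \<subseteq> IC"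
    and C0: "simple_sum QC IC C0"
    and fin_gen: "finitely_generated_subgroup (K0 QC IC)
        (K0_subgroup QC IC
          (add_cat QC IC (rep_on QB ` syzygy_orbit QB IB (rep_on QB (syzygy QC IC C0)))))"
    and IT_A: "Igusa_Todorov_algebra QA IA n"
    and LIT_B: "LIT_algebra QB IB n"
  shows "LIT_algebra QC IC (n + 1)"
proof -
  interpret C: bound_quiver_algebra QC IC using C by unfold_locales
  interpret QA: bound_quiver_algebra QA IA using A by unfold_locales
  interpret QB: bound_quiver_algebra QB IB using B by unfold_locales
  have endsA: "tail QC a \<in> verts QA \<and> head QC a \<in> verts QA" if "a \<in> arcs QA" for a
    using that subA QA.tail_in[OF that] QA.head_in[OF that] by simp
  have endsB: "tail QC a \<in> verts QB \<and> head QC a \<in> verts QB" if "a \<in> arcs QB" for a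
    using that subB QB.tail_in[OF that] QB.head_in[OF that] by simp
  have ends_alpha: "tail QC a \<in> verts QA \<and> head QC a \<in> verts QB" if "a \<in> \<alpha> ` J" for a
    using that alpha by blast
  have intoA: "a \<in> arcs QA" if "a \<in> arcs QC" "head QC a \<in> verts QA" for a
    using that endsB ends_alpha arcs(1) verts(2) by blast
  have outofB: "a \<in> arcs QB" if "a \<in> arcs QC" "tail QC a \<in> verts QB" for a
    using that endsA ends_alpha arcs(1) verts(2) by blast
  interpret G: one_way_gluing QC IC QA IA QB IB
  proof (unfold_locales)
    show "a \<in> arcs QA \<longleftrightarrow> a \<in> arcs QC \<and> tail QC a \<in> verts QA \<and> head QC a \<in> verts QA" for a
      using endsA intoA arcs(1) by blast
    show "a \<in> arcs QB \<longleftrightarrow> a \<in> arcs QC \<and> tail QC a \<in> verts QB \<and> head QC a \<in> verts QB" for a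
      using endsB outofB arcs(1) by blast
    show "set p \<subseteq> arcs QA" if "C.walk x p y" "x \<in> verts QA" "y \<in> verts QA" for x p y
      by (rule C.walk_backward_closed[OF _ that(1,3)]) (use intoA endsA in blast)
    show "set p \<subseteq> arcs QB" if "C.walk x p y" "x \<in> verts QB" "y \<in> verts QB" for x p y
      by (rule C.walk_forward_closed[OF _ that(1,2)]) (use outofB endsB in blast)
    fix M :: "('v, 'a, 'k) rep" and \<beta> a v
    assume M: "M \<in> mod_cat QC IC" and \<beta>: "\<beta> \<in> arcs QA" and a: "a \<in> arcs QC" "a \<notin> arcs QA" "a \<notin> arcs QB"
      and comp: "head QC \<beta> = tail QC a" and v: "v \<in> vsp M (tail QC \<beta>)"
    have w: "C.walk (tail QC \<beta>) [\<beta>] (tail QC a)" using \<beta> a arcs(1) comp by auto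
    from a arcs(1) obtain j where j: "j \<in> J" "a = \<alpha> j" by blast
    have "arrow_elt QC \<beta> \<otimes>\<^bsub>path_algebra QC\<^esub> arrow_elt QC a
        = (Poly_Mapping.single (tail QC \<beta>, [\<beta>] @ [a]) 1 :: ('v, 'a) path \<Rightarrow>\<^sub>0 'k)"
      using C.single_path_mult[OF w] by (simp add: path_algebra_def arrow_elt_def)
    moreover have "(arrow_elt QC \<beta> \<otimes>\<^bsub>path_algebra QC\<^esub> arrow_elt QC a :: ('v, 'a) path \<Rightarrow>\<^sub>0 'k) \<in> IC"
      using ideal \<beta> j unfolding genideal_def by blast
    ultimately have rel: "(Poly_Mapping.single (tail QC \<beta>, [\<beta>] @ [a]) 1 :: ('v, 'a) path \<Rightarrow>\<^sub>0 'k) \<in> IC" by simp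
    have "C.walk (tail QC \<beta>) ([\<beta>] @ [a]) (head QC a)" using w a by simp
    from C.path_relation_acts_as_zero[OF rel this M v]
    show "amap M a (amap M \<beta> v) = 0" by simp
  next
    show "verts QA \<subseteq> verts QC" "verts QB \<subseteq> verts QC" using verts(1) by blast+
    show "tail QA a = tail QC a" "head QA a = head QC a" if "a \<in> arcs QA" for a
      using subA that by simp_all
    show "tail QB a = tail QC a" "head QB a = head QC a" if "a \<in> arcs QB" for a
      using subB that by simp_all
    show "IC \<inter> carrier (path_algebra QA) = IA" "IC \<inter> carrier (path_algebra QB) = IB"
      by (rule cornerA cornerB)+
    show "a \<in> arcs QA" if "a \<in> arcs QC" "head QC a \<in> verts QA" for a by (rule intoA[OF that])
    show "a \<in> arcs QB" if "a \<in> arcs QC" "tail QC a \<in> verts QB" for a by (rule outofB[OF that])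
    show "verts QC = verts QA \<union> verts QB" "verts QA \<inter> verts QB = {}" by (rule verts)+
  qed
  show ?thesis using IT_A LIT_B by (rule G.LIT_gluing)
qed

end
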